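(* Let $\nu$ be a splitting law and let $(m_n)_{n\ge1}$ be a sequence of random compact triangulations, where $m_n$ has distribution $\mathbb U_n^{\nu}$. For every $n$, conditionally on $m_n$, let $U_n$ be a vertex chosen uniformly at random in the set $\mathcal V(m_n)$ of internal vertices of $m_n$, and let $\mu_n=\frac1n\sum_{x\in\mathcal V(m_n)}\delta_x$ be the occupation measure of $m_n$. Then: 1. The random point $U_n$ converges in distribution to some random limit point $U_\infty$ as $n\to\infty$. 2. $\mu_n\to\delta_{U_\infty}$ as $n\to\infty$, where the convergence is in distribution on the space of probability measures on the filled triangle $\tilde T$ (equipped with the topology of weak convergence).
   Context: $A=(0,0)$, $B=(1,0)$, $C=e^{i\pi/3}$ in $\mathbb R^2\cong\mathbb C$; $T=[AB]\cup[BC]\cup[CA]$ and $\tilde T$ is the filled (closed) triangle. $V_2^*=\{x\in\mathbb R^3:x_i>0,\ x_1+x_2+x_3=1\}$. A splitting law is a probability distribution $\nu$ on $\mathbb R_+^3$ such that if $P=(P_1,P_2,P_3)\sim\nu$ then the law of $P$ is invariant under permutations of coordinates, $P_i>0$ a.s. for each $i$, and $P_1+P_2+P_3=1$ a.s. $\mathcal T^\infty=\bigcup_{n\ge0}\{1,2,3\}^n$. A ternary tree is a set $t\subseteq\mathcal T^\infty$ containing the empty word $\emptyset$, closed under removing the last letter, where each $u\in t$ has either none (leaf) or all three (internal node) of the children $u(1),u(2),u(3)$ in $t$. $t^0$ is the set of internal nodes, and $\mathcal T_n$ is the set of ternary trees with exactly $n$ internal nodes. Given $(P(u))_{u\in \mathcal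 T^\infty}$ with values in $V_2^*$, define for each $u$ an ordered triple of points: $(A_\emptyset,B_\emptyset,C_\emptyset)=(A,B,C)$; $M_u=P_1(u)A_u+P_2(u)B_u+P_3(u)C_u$; the triples of $u(1),u(2),u(3)$ are $(M_u,B_u,C_u)$, $(A_u,M_u,C_u)$, $(A_u,B_u,M_u)$. The compact triangulation associated with a finite ternary tree $t$ and $(P(u))_{u\in t^0}$ is $m=T\cup\bigcup_{u\in t^0}([A_uM_u]\cup[B_uM_u]\cup[C_uM_u])$, and its set of internal vertices is $\mathcal V(m)=\{M_u:u\in t^0\}$. $\mathbb U_n^\nu$ is the distribution of the compact triangulation associated with $t_n$ and $(P(u))_{u\in t_n^0}$, where $t_n$ is uniform on $\mathcal T_n$ and $(P(u))_{u\in\mathcal T^\infty}$ are i.i.d. with law $\nu$, independent of $t_n$. *)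

theory Defs
  imports "HOL-Probability.Probability"
begin

section \<open>Borel algebras, convergence in distribution, weak and Hausdorff topologies\<close>

definition borel_of :: "'a topology \<Rightarrow> 'a measure" where
  "borel_of X = sigma (topspace X) {W. openin X W}"

text \<open>
  Convergence in distribution of random elements of a topological space, for sequences indexed
  by \<open>n \<ge> 1\<close>. Each random element lives on its own probability space; measurability with respect to
  the Borel algebra is part of the notion.
\<close>
definition converges_in_distribution ::
    "'a topology \<Rightarrow> (nat \<Rightarrow> 'w measure) \<Rightarrow> (nat \<Rightarrow> 'w \<Rightarrow> 'a) \<Rightarrow> 'v measure \<Rightarrow> ('v \<Rightarrow> 'a) \<Rightarrow> bool" where
  "converges_in_distribution X \<Omega> Y N Z \<longleftrightarrow>
     (\<forall>n\<ge>1. Y n \<in> \<Omega> n \<rightarrow>\<^sub>M borel_of X) \<and> Z \<in> N \<rightarrow>\<^sub>M borel_of X \<and>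
     (\<forall>f. continuous_map X euclideanreal f \<and> bounded (f ` topspace X) \<longrightarrow>
        (\<lambda>n. \<integral>\<omega>. f (Y n \<omega>) \<partial>\<Omega> n) \<longlonglongrightarrow> (\<integral>\<omega>. f (Z \<omega>) \<partial>N))"

text \<open>
  The weak topology on the set of Borel probability measures on \<open>S\<close>: the coarsest topology for
  which integration against every bounded continuous real function on \<open>S\<close> is continuous.
\<close>
definition weak_topology :: "'a::topological_space set \<Rightarrow> 'a measure topology" where
  "weak_topology S = topology_generated_by
     {{\<mu> \<in> space (prob_algebra (restrict_space borel S)). (\<integral>x. f x \<partial>\<mu>) \<in> W} | (f :: 'a \<Rightarrow> real) W.
        continuous_on S f \<and> bounded (f ` S) \<and> open W}"

text \<open>
  The value \<open>0\<close> off the nonempty compact sets is a dummy: \<open>Metric_space\<close> asks for nonnegativity and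
  symmetry on the whole type.
\<close>
definition hausdorff_dist :: "'a::metric_space set \<Rightarrow> 'a set \<Rightarrow> real" where
  "hausdorff_dist K L =
     (if compact K \<and> K \<noteq> {} \<and> compact L \<and> L \<noteq> {}
      then max (SUP x\<in>K. infdist x L) (SUP y\<in>L. infdist y K) else 0)"

definition hausdorff_topology :: "'a::metric_space set topology" where
  "hausdorff_topology = Metric_space.mtopology {K. compact K \<and> K \<noteq> {}} hausdorff_dist"

lemma hausdorff_dist_commute: "hausdorff_dist K L = hausdorff_dist L K"
  by (auto simp: hausdorff_dist_def max.commute)

lemma infdist_le_hausdorff_dist:
  assumes "compact K" "compact L" "L \<noteq> {}" "x \<in> K"
  shows "infdist x L \<le> hausdorff_dist K L"
proof -
  have "compact ((\<lambda>x. infdist x L) ` K)"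
    by (intro compact_continuous_image continuous_intros assms)
  then have "bdd_above ((\<lambda>x. infdist x L) ` K)"
    by (intro bounded_imp_bdd_above compact_imp_bounded)
  then have "infdist x L \<le> (SUP x\<in>K. infdist x L)"
    using assms(4) by (intro cSUP_upper)
  moreover have "K \<noteq> {}"
    using assms(4) by auto
  ultimately show ?thesis
    using assms by (simp add: hausdorff_dist_def)
qed

lemma hausdorff_dist_le:
  assumes "compact K" "K \<noteq> {}" "compact L" "L \<noteq> {}"
    and "\<And>x. x \<in> K \<Longrightarrow> infdist x L \<le> r" "\<And>y. y \<in> L \<Longrightarrow> infdist y K \<le> r"
  shows "hausdorff_dist K L \<le> r"
  using assms by (auto simp: hausdorff_dist_def intro!: cSUP_least)

lemma hausdorff_dist_nonneg: "0 \<le> hausdorff_dist K L"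
proof (cases "compact K \<and> K \<noteq> {} \<and> compact L \<and> L \<noteq> {}")
  case True
  then obtain x where "x \<in> K" by auto
  with True have "infdist x L \<le> hausdorff_dist K L"
    by (intro infdist_le_hausdorff_dist) auto
  then show ?thesis
    using infdist_nonneg[of x L] by linarith
qed (auto simp: hausdorff_dist_def)

lemma infdist_hausdorff_triangle:
  fixes K L J :: "'a::heine_borel set"
  assumes "compact K" "compact L" "L \<noteq> {}" "compact J" "J \<noteq> {}" "x \<in> K"
  shows "infdist x J \<le> hausdorff_dist K L + hausdorff_dist L J"
proof -
  obtain y where y: "y \<in> L" "infdist x L = dist x y"
    using infdist_attains_inf[of L x] assms compact_imp_closed by blast
  have "infdist x J \<le> infdist y J + dist x y"
    by (rule infdist_triangle)
  moreover have "infdist x L \<le> hausdorff_dist K L" "infdist y J \<le> hausdorff_dist L J"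
    using assms y(1) by (auto intro: infdist_le_hausdorff_dist)
  ultimately show ?thesis
    using y(2) by linarith
qed

lemma Metric_space_hausdorff_dist:
  "Metric_space {K :: 'a::heine_borel set. compact K \<and> K \<noteq> {}} hausdorff_dist"
proof
  fix K L J :: "'a set"
  show "0 \<le> hausdorff_dist K L" by (rule hausdorff_dist_nonneg)
  show "hausdorff_dist K L = hausdorff_dist L K" by (rule hausdorff_dist_commute)
  assume K: "K \<in> {K. compact K \<and> K \<noteq> {}}" and L: "L \<in> {K. compact K \<and> K \<noteq> {}}"
  show "hausdorff_dist K L = 0 \<longleftrightarrow> K = L"
  proof
    assume *: "hausdorff_dist K L = 0"
    have "x \<in> B" if "x \<in> A" "compact A" "compact B" "B \<noteq> {}" "hausdorff_dist A B = 0"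
      for x and A B :: "'a set"
    proof -
      have "infdist x B = 0"
        using infdist_le_hausdorff_dist[of A B x] that infdist_nonneg[of x B] by simp
      then show ?thesis
        using that compact_imp_closed in_closed_iff_infdist_zero by blast
    qed
    then show "K = L"
      using K L * hausdorff_dist_commute[of K L] by (intro set_eqI iffI) auto
  next
    assume "K = L"
    then have "hausdorff_dist K L \<le> 0"
      using K by (intro hausdorff_dist_le) auto
    then show "hausdorff_dist K L = 0"
      using hausdorff_dist_nonneg[of K L] by simp
  qed
  assume J: "J \<in> {K. compact K \<and> K \<noteq> {}}"
  show "hausdorff_dist K J \<le> hausdorff_dist K L + hausdorff_dist L J"
  proof (rule hausdorff_dist_le)
    fix x assume "x \<in> K"
    then show "infdist x J \<le> hausdorff_dist K L + hausdorff_dist L J"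
      using K L J by (intro infdist_hausdorff_triangle) auto
  next
    fix y assume "y \<in> J"
    then have "infdist y K \<le> hausdorff_dist J L + hausdorff_dist L K"
      using K L J by (intro infdist_hausdorff_triangle) auto
    then show "infdist y K \<le> hausdorff_dist K L + hausdorff_dist L J"
      by (simp add: hausdorff_dist_commute)
  qed (use K J in auto)
qed

section \<open>Ternary trees\<close>

text \<open>Letters are elements of the type \<open>3\<close>, whose elements are \<open>1\<close>, \<open>2\<close> and \<open>3 = 0\<close>.\<close>
type_synonym word = "3 list"

definition ternary_tree :: "word set \<Rightarrow> bool" where
  "ternary_tree t \<longleftrightarrow> [] \<in> t \<and> (\<forall>u i. u @ [i] \<in> t \<longrightarrow> u \<in> t) \<and>
     (\<forall>u\<in>t. (\<forall>i. u @ [i] \<notin> t) \<or> (\<forall>i. u @ [i] \<in> t))"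

definition internal_nodes :: "word set \<Rightarrow> word set" where
  "internal_nodes t = {u\<in>t. \<forall>i. u @ [i] \<in> t}"

definition ternary_trees :: "nat \<Rightarrow> word set set" where
  "ternary_trees n = {t. ternary_tree t \<and> finite t \<and> card (internal_nodes t) = n}"

section \<open>Compact triangulations\<close>

definition base_corner :: "3 \<Rightarrow> complex" where
  "base_corner i = (if i = 1 then 0 else if i = 2 then 1 else cis (pi / 3))"

definition filled_triangle :: "complex set" where
  "filled_triangle = convex hull (range base_corner)"

definition triangle_boundary :: "complex set" where
  "triangle_boundary = closed_segment (base_corner 1) (base_corner 2) \<union>
     closed_segment (base_corner 2) (base_corner 3) \<union> closed_segment (base_corner 3) (base_corner 1)"

definition open_simplex :: "(real ^ 3) set" where
  "open_simplex = {x. (\<forall>i. x $ i > 0) \<and> (\<Sum>i\<in>UNIV. x $ i) = 1}"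

definition barycenter :: "real ^ 3 \<Rightarrow> (3 \<Rightarrow> complex) \<Rightarrow> complex" where
  "barycenter p c = (\<Sum>i\<in>UNIV. (p $ i) *\<^sub>R c i)"

text \<open>
  \<open>corners P u\<close> is the ordered triple \<open>(A\<^sub>u, B\<^sub>u, C\<^sub>u)\<close>; passing to the child \<open>u(i)\<close> replaces its
  \<open>i\<close>-th entry by \<open>M\<^sub>u\<close>.
\<close>
function corners :: "(word \<Rightarrow> real ^ 3) \<Rightarrow> word \<Rightarrow> 3 \<Rightarrow> complex" where
  "corners P [] = base_corner"
| "corners P (u @ [i]) = (corners P u)(i := barycenter (P u) (corners P u))"
  by (auto, metis rev_exhaust)
termination
  by (relation "Wellfounded.measure (\<lambda>(P, u). length u)") auto

definition vertex :: "(word \<Rightarrow> real ^ 3) \<Rightarrow> word \<Rightarrow> complex" where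
  "vertex P u = barycenter (P u) (corners P u)"

definition triangulation :: "word set \<Rightarrow> (word \<Rightarrow> real ^ 3) \<Rightarrow> complex set" where
  "triangulation t P = triangle_boundary \<union>
     (\<Union>u\<in>internal_nodes t. \<Union>i. closed_segment (corners P u i) (vertex P u))"

definition compact_triangulations :: "nat \<Rightarrow> complex set set" where
  "compact_triangulations n =
     {triangulation t P | t P. t \<in> ternary_trees n \<and> (\<forall>u\<in>internal_nodes t. P u \<in> open_simplex)}"

text \<open>
  The internal vertices of a compact triangulation, given as a subset \<open>m\<close> of the plane. All codings
  \<open>(t, P)\<close> of \<open>m\<close> have the same vertex set, because the \<open>M\<^sub>u\<close> are exactly the points of \<open>m\<close> in the open
  triangle near which \<open>m\<close> is not a line segment.
\<close>
definition internal_vertices :: "complex set \<Rightarrow> complex set" where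
  "internal_vertices m = {vertex P u | t P u. ternary_tree t \<and> finite t \<and>
     (\<forall>v\<in>internal_nodes t. P v \<in> open_simplex) \<and> m = triangulation t P \<and> u \<in> internal_nodes t}"

section \<open>Random compact triangulations\<close>

definition splitting_law :: "(real ^ 3) measure \<Rightarrow> bool" where
  "splitting_law \<nu> \<longleftrightarrow> prob_space \<nu> \<and> sets \<nu> = sets borel \<and>
     (\<forall>\<sigma>. \<sigma> permutes UNIV \<longrightarrow> distr \<nu> borel (\<lambda>x. \<chi> i. x $ \<sigma> i) = \<nu>) \<and>
     (\<forall>i. AE x in \<nu>. x $ i > 0) \<and> (AE x in \<nu>. (\<Sum>i\<in>UNIV. x $ i) = 1)"

text \<open>Random elements of this space are compact triangulations with \<open>n\<close> internal vertices.\<close>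
definition triangulation_space :: "nat \<Rightarrow> complex set measure" where
  "triangulation_space n = borel_of (subtopology hausdorff_topology (compact_triangulations n))"

text \<open>
  The law of the triangulation of a uniform tree with \<open>n\<close> internal nodes and an independent i.i.d.
  family with law \<open>\<nu>\<close>. A splitting law gives full mass to \<open>open_simplex\<close>; restricting \<open>\<nu>\<close> to it makes
  the family take its values there surely and not only almost surely.
\<close>
definition triangulation_law :: "(real ^ 3) measure \<Rightarrow> nat \<Rightarrow> complex set measure" where
  "triangulation_law \<nu> n =
     distr (uniform_count_measure (ternary_trees n) \<Otimes>\<^sub>M
            (\<Pi>\<^sub>M u\<in>(UNIV :: word set). restrict_space \<nu> open_simplex))
       (triangulation_space n) (\<lambda>(t, P). triangulation t P)"

text \<open>
  \<open>U\<close> is, conditionally on \<open>X\<close>, uniform in the finite nonempty set \<open>V X\<close>. The conditioning is with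
  respect to the sigma-algebra generated by \<open>X\<close>.
\<close>
definition conditionally_uniform ::
    "'w measure \<Rightarrow> 'x measure \<Rightarrow> ('w \<Rightarrow> 'x) \<Rightarrow> ('x \<Rightarrow> 'b::topological_space set) \<Rightarrow> ('w \<Rightarrow> 'b) \<Rightarrow> bool" where
  "conditionally_uniform \<Omega> R X V U \<longleftrightarrow> U \<in> borel_measurable \<Omega> \<and>
     (\<forall>B\<in>sets borel. AE \<omega> in \<Omega>.
        real_cond_exp \<Omega> (vimage_algebra (space \<Omega>) X R) (indicator (U -` B)) \<omega> =
        measure_pmf.prob (pmf_of_set (V (X \<omega>))) B)"

definition occupation_measure :: "nat \<Rightarrow> complex set \<Rightarrow> complex measure" where
  "occupation_measure n m = measure_of filled_triangle (sets (restrict_space borel filled_triangle))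
     (\<lambda>B. 1 / of_nat n * (\<Sum>x\<in>internal_vertices m. emeasure (return (restrict_space borel filled_triangle) x) B))"

end

theory Submission
  imports Defs "HOL-Computational_Algebra.Formal_Power_Series" "HOL-Real_Asymp.Real_Asymp"
begin

text \<open>
  The size of a uniform ternary tree concentrates in one branch: the counting series has radius of
  convergence \<open>4/27\<close> with ratio asymptotics and \<open>3 \<cdot> 4/27 \<cdot> S\<^sup>2 = 1\<close> for its value \<open>S = 3/2\<close> there, so that
  with probability close to \<open>3\<^sup>-\<^sup>k\<close> all but \<open>O(1)\<close> internal nodes lie below a given word of length \<open>k\<close>.
  Hence almost all the mass of \<open>\<mu>\<^sub>n\<close> sits in one uniformly chosen triangle of generation \<open>k\<close>. The
  expected perimeter of that triangle decays like \<open>(7/9)\<^sup>k\<close>, and \<open>U\<^sub>\<infinity>\<close> is the point to which a uniform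
  descent contracts. The laws being prescribed on subsets of the plane, one also needs that the tree
  and the splits can be recovered, measurably, from the triangulation.
\<close>

section \<open>Decomposition of ternary trees at the root\<close>

text \<open>At the singularity of \<open>a = 1 + x a^3\<close> one has \<open>3 x a^2 = 1\<close>,
  which forces \<open>a = 3/2\<close> and \<open>x = 4/27\<close>. In a uniform tree of size
  \<open>n + 1\<close>, the branch at a given letter holds all but \<open>j + 1\<close> nodes with
  probability \<open>tree_count (n - j) * pair_count j / tree_count (n + 1)\<close>. As
  \<open>n\<close> grows this tends to the \<open>j\<close>-th term of a series with sum
  \<open>1/3\<close>, so three letters exhaust the probability. Interchanging this limit with the
  infinite sum is avoided: only lower bounds from finitely many terms are proved. They suffice
  because the events for the \<open>3^k\<close> words of length \<open>k\<close> become disjoint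
  while their lower bounds nearly add up to one. Likewise a one-sided estimate, applied to a bounded
  functional and to its negative, becomes convergence. The rate is
  \<open>7/9 = (1 + 2 * 2/3) / 3\<close>: every side of a triangle survives in one child, every new
  edge lies in two children, and exchangeability gives each coordinate of a split the mean
  \<open>1/3\<close>.\<close>

lemma shift_3_neq: "i + 1 \<noteq> (i :: 3)" "i + 2 \<noteq> (i :: 3)" "i + 2 \<noteq> (i + 1 :: 3)"
proof -
  have "(1 :: 3) \<noteq> 0" "(2 :: 3) \<noteq> 0" "(2 :: 3) \<noteq> 1" by simp_all
  then show "i + 1 \<noteq> (i :: 3)" "i + 2 \<noteq> (i :: 3)" "i + 2 \<noteq> (i + 1 :: 3)"
    by (simp_all only: add_cancel_left_right add_left_cancel not_False_eq_True)
qed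

lemma UNIV_3_shift: "(UNIV :: 3 set) = {i, i + 1, i + 2}"
proof -
  have "card {i, i + 1, i + 2} = card (UNIV :: 3 set)"
  proof -
    have "card {i, i + 1, i + 2} = 3"
      unfolding card_3_iff using shift_3_neq[of i] by metis
    then show ?thesis by simp
  qed
  then show ?thesis by (rule card_subset_eq[OF finite_class.finite_UNIV subset_UNIV, symmetric])
qed

definition finite_tree :: "word set \<Rightarrow> bool" where
  "finite_tree t \<longleftrightarrow> ternary_tree t \<and> finite t"

definition graft :: "(3 \<Rightarrow> word set) \<Rightarrow> word set" where
  "graft f = insert [] (\<Union>i. (#) i ` f i)"

lemma Nil_in_graft [simp]: "[] \<in> graft f"
  and Cons_in_graft [simp]: "i # u \<in> graft f \<longleftrightarrow> u \<in> f i"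
  by (auto simp: graft_def)

lemma graft_inject: "graft f = graft g \<longleftrightarrow> f = g"
proof
  assume *: "graft f = graft g"
  show "f = g"
  proof (rule ext, rule set_eqI)
    fix i u show "u \<in> f i \<longleftrightarrow> u \<in> g i"
      using arg_cong[OF *, of "\<lambda>t. i # u \<in> t"] by simp
  qed
qed simp

lemma internal_nodes_leaf [simp]: "internal_nodes {[]} = {}"
  by (auto simp: internal_nodes_def)

lemma internal_nodes_graft:
  assumes "\<And>i. [] \<in> f i"
  shows "internal_nodes (graft f) = insert [] (\<Union>i. (#) i ` internal_nodes (f i))"
proof (rule set_eqI)
  fix u show "u \<in> internal_nodes (graft f) \<longleftrightarrow> u \<in> insert [] (\<Union>i. (#) i ` internal_nodes (f i))"
    using assms by (cases u) (auto simp: internal_nodes_def)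
qed

lemma Cons_in_internal_nodes_graft [simp]: "i # u \<in> internal_nodes (graft f) \<longleftrightarrow> u \<in> internal_nodes (f i)"
  by (auto simp: internal_nodes_def)

lemma Nil_in_internal_nodes_graft: "[] \<in> internal_nodes (graft f) \<longleftrightarrow> (\<forall>i. [] \<in> f i)"
  by (auto simp: internal_nodes_def)

lemma Nil_in_ternary_tree: "ternary_tree t \<Longrightarrow> [] \<in> t"
  by (simp add: ternary_tree_def)

lemma prefix_in_ternary_tree:
  assumes "ternary_tree t"
  shows "u @ w \<in> t \<Longrightarrow> u \<in> t"
proof (induction w rule: rev_induct)
  case (snoc i w)
  then have "(u @ w) @ [i] \<in> t" by simp
  then have "u @ w \<in> t" using assms unfolding ternary_tree_def by blast
  then show ?case by (rule snoc.IH)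
qed simp

lemma ternary_tree_leaf: "ternary_tree {[]}"
  by (auto simp: ternary_tree_def)

lemma ternary_tree_graft:
  assumes "\<And>i. ternary_tree (f i)"
  shows "ternary_tree (graft f)"
  unfolding ternary_tree_def
proof (intro conjI allI impI ballI)
  fix u i assume *: "u @ [i] \<in> graft f"
  show "u \<in> graft f"
  proof (cases u)
    case (Cons j w)
    with * show ?thesis using assms prefix_in_ternary_tree[of "f j" w "[i]"] by simp
  qed simp
next
  fix u assume *: "u \<in> graft f"
  show "(\<forall>i. u @ [i] \<notin> graft f) \<or> (\<forall>i. u @ [i] \<in> graft f)"
  proof (cases u)
    case Nil then show ?thesis using assms by (simp add: ternary_tree_def)
  next
    case (Cons j w)
    with * have "w \<in> f j" by simp
    with assms[of j] show ?thesis unfolding Cons ternary_tree_def by simp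
  qed
qed simp

lemma ternary_tree_cases:
  assumes "ternary_tree t"
  obtains "t = {[]}" | f where "t = graft f" "\<And>i. ternary_tree (f i)"
proof (cases "t = {[]}")
  case False
  define f where "f = (\<lambda>i. {u. i # u \<in> t})"
  obtain u where u: "u \<in> t" "u \<noteq> []" using False Nil_in_ternary_tree[OF assms] by blast
  then obtain j w where "u = j # w" by (cases u) auto
  then have "[] @ [j] \<in> t" using prefix_in_ternary_tree[OF assms, of "[j]" w] u by simp
  moreover have "[] \<in> t" using Nil_in_ternary_tree[OF assms] .
  ultimately have all: "[i] \<in> t" for i
    using assms unfolding ternary_tree_def by (metis append_Nil)
  have "t = graft f"
  proof (rule set_eqI)
    fix u show "u \<in> t \<longleftrightarrow> u \<in> graft f"
      using Nil_in_ternary_tree[OF assms] by (cases u) (auto simp: f_def)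
  qed
  moreover have "ternary_tree (f i)" for i
    unfolding ternary_tree_def
  proof (intro conjI allI impI ballI)
    show "[] \<in> f i" using all by (simp add: f_def)
    show "u \<in> f i" if "u @ [k] \<in> f i" for u k
      using that prefix_in_ternary_tree[OF assms, of "i # u" "[k]"] by (simp add: f_def)
    show "(\<forall>k. u @ [k] \<notin> f i) \<or> (\<forall>k. u @ [k] \<in> f i)" if "u \<in> f i" for u
    proof -
      have "i # u \<in> t" using that by (simp add: f_def)
      then have "(\<forall>k. (i # u) @ [k] \<notin> t) \<or> (\<forall>k. (i # u) @ [k] \<in> t)"
        using assms unfolding ternary_tree_def by blast
      then show ?thesis by (simp add: f_def)
    qed
  qed
  ultimately show ?thesis using that by blast
qed

lemma finite_graft: "finite (graft f) \<longleftrightarrow> (\<forall>i. finite (f i))"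
  by (auto simp: graft_def finite_image_iff)

lemma card_graft_gt:
  assumes "\<And>i. finite (f i)"
  shows "card (f i) < card (graft f)"
proof -
  have "card (f i) = card ((#) i ` f i)" by (simp add: card_image)
  also have "\<dots> < card (graft f)"
  proof (rule psubset_card_mono)
    show "finite (graft f)" using assms by (simp add: finite_graft)
    show "(#) i ` f i \<subset> graft f" by (auto simp: graft_def)
  qed
  finally show ?thesis .
qed

text \<open>Trees are sets of words, so structural induction has to be derived, here by strong
  induction on the number of nodes. Later proofs by recursion at the root rest on it.\<close>

lemma finite_tree_induct [consumes 1, case_names leaf node]:
  assumes "finite_tree t" "R {[]}"
    and "\<And>f. (\<And>i. finite_tree (f i)) \<Longrightarrow> (\<And>i. R (f i)) \<Longrightarrow> R (graft f)"
  shows "R t"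
  using assms(1)
proof (induction "card t" arbitrary: t rule: less_induct)
  case less
  then have "ternary_tree t" "finite t" by (auto simp: finite_tree_def)
  from this(1) show ?case
  proof (cases rule: ternary_tree_cases)
    case 1 then show ?thesis using assms(2) by simp
  next
    case (2 f)
    have fin: "finite (f i)" for i using 2 \<open>finite t\<close> by (simp add: finite_graft)
    with 2 have ft: "finite_tree (f i)" for i by (simp add: finite_tree_def)
    have "R (f i)" for i
    proof (rule less.hyps)
      show "card (f i) < card t" unfolding 2(1) by (rule card_graft_gt) (rule fin)
    qed (rule ft)
    with ft show ?thesis using assms(3) 2(1) by simp
  qed
qed

lemma finite_tree_Nil: "finite_tree t \<Longrightarrow> [] \<in> t"
  by (simp add: finite_tree_def Nil_in_ternary_tree)

lemma finite_tree_graft: "finite_tree (graft f)" if "\<And>i. finite_tree (f i)"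
  using that by (auto simp: finite_tree_def finite_graft intro!: ternary_tree_graft)

lemma finite_tree_leaf: "finite_tree {[]}"
  by (simp add: finite_tree_def ternary_tree_leaf)

lemma finite_internal_nodes: "finite_tree t \<Longrightarrow> finite (internal_nodes t)"
  by (auto simp: finite_tree_def internal_nodes_def)

lemma finite_tree_internal_nodes_empty:
  assumes "finite_tree t" "internal_nodes t = {}"
  shows "t = {[]}"
proof -
  have "ternary_tree t" using assms by (simp add: finite_tree_def)
  then show ?thesis
  proof (cases rule: ternary_tree_cases)
    case (2 f)
    then have "[] \<in> internal_nodes t" by (simp add: Nil_in_internal_nodes_graft Nil_in_ternary_tree)
    then show ?thesis using assms by simp
  qed
qed

lemma mem_ternary_trees: "t \<in> ternary_trees n \<longleftrightarrow> finite_tree t \<and> card (internal_nodes t) = n"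
  by (auto simp: ternary_trees_def finite_tree_def)

lemma card_internal_nodes_graft:
  assumes ft: "\<And>i. finite_tree (f i)"
  shows "card (internal_nodes (graft f)) = Suc (\<Sum>i\<in>UNIV. card (internal_nodes (f i)))"
proof -
  define I where "I = (\<lambda>i. (#) i ` internal_nodes (f i))"
  have fin: "finite (I i)" for i
    unfolding I_def by (intro finite_imageI finite_internal_nodes ft)
  have "[] \<notin> (\<Union>i. I i)" by (auto simp: I_def)
  moreover have "internal_nodes (graft f) = insert [] (\<Union>i. I i)"
    unfolding I_def by (rule internal_nodes_graft) (rule finite_tree_Nil[OF ft])
  ultimately have "card (internal_nodes (graft f)) = Suc (card (\<Union>i. I i))"
    using fin by simp
  also have "card (\<Union>i. I i) = (\<Sum>i\<in>UNIV. card (I i))"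
  proof (rule card_UN_disjoint)
    show "\<forall>i\<in>UNIV. \<forall>j\<in>UNIV. i \<noteq> j \<longrightarrow> I i \<inter> I j = {}" unfolding I_def by blast
  qed (auto simp: fin)
  also have "(\<Sum>i\<in>UNIV. card (I i)) = (\<Sum>i\<in>UNIV. card (internal_nodes (f i)))"
    unfolding I_def by (simp add: card_image)
  finally show ?thesis .
qed

section \<open>Counting ternary trees\<close>

text \<open>One child is singled out: \<open>x\<close> is going to be the large branch,
  \<open>y\<close> and \<open>z\<close> the small ones. Addition of letters is modulo 3, so one
  formula serves every \<open>i\<close>.\<close>

definition node :: "3 \<Rightarrow> word set \<Rightarrow> word set \<Rightarrow> word set \<Rightarrow> word set" where
  "node i x y z = graft ((\<lambda>_. z)(i := x, i + 1 := y))"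

lemma node_inject: "node i x y z = node i x' y' z' \<longleftrightarrow> x = x' \<and> y = y' \<and> z = z'"
proof (intro iffI conjI)
  assume "node i x y z = node i x' y' z'"
  then have *: "((\<lambda>_. z)(i := x, i + 1 := y)) j = ((\<lambda>_. z')(i := x', i + 1 := y')) j" for j
    unfolding node_def graft_inject by (rule fun_cong)
  show "x = x'" using *[of i] shift_3_neq(1)[of i] by (metis fun_upd_same fun_upd_other)
  show "y = y'" using *[of "i + 1"] by (metis fun_upd_same)
  show "z = z'" using *[of "i + 2"] shift_3_neq[of i] by (metis fun_upd_other)
qed blast

lemma finite_tree_node: "finite_tree x \<Longrightarrow> finite_tree y \<Longrightarrow> finite_tree z \<Longrightarrow> finite_tree (node i x y z)"
  unfolding node_def by (intro finite_tree_graft) auto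

lemma card_internal_nodes_node:
  assumes "finite_tree x" "finite_tree y" "finite_tree z"
  shows "card (internal_nodes (node i x y z)) =
    Suc (card (internal_nodes x) + (card (internal_nodes y) + card (internal_nodes z)))"
proof -
  have fs: "finite_tree (((\<lambda>_. z)(i := x, i + 1 := y)) j)" for j using assms by simp
  have "(\<Sum>j\<in>UNIV. card (internal_nodes (((\<lambda>_. z)(i := x, i + 1 := y)) j))) =
    (\<Sum>j\<in>{i, i + 1, i + 2}. card (internal_nodes (((\<lambda>_. z)(i := x, i + 1 := y)) j)))"
    by (rule sum.cong[OF UNIV_3_shift]) simp
  also have "\<dots> = card (internal_nodes x) + (card (internal_nodes y) + card (internal_nodes z))"
    using shift_3_neq[of i] shift_3_neq[of i, symmetric] by simp
  finally show ?thesis unfolding node_def by (subst card_internal_nodes_graft[OF fs]) simp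
qed

lemma graft_eq_node: "graft f = node i (f i) (f (i + 1)) (f (i + 2))"
proof -
  have "f j = ((\<lambda>_. f (i + 2))(i := f i, i + 1 := f (i + 1))) j" for j
  proof -
    have "j \<in> {i, i + 1, i + 2}" using UNIV_3_shift[of i] UNIV_I by blast
    then show ?thesis by auto
  qed
  then show ?thesis unfolding node_def graft_inject by (rule ext)
qed

definition tree_pairs :: "nat \<Rightarrow> (word set \<times> word set) set" where
  "tree_pairs m = {(y, z). finite_tree y \<and> finite_tree z \<and> card (internal_nodes y) + card (internal_nodes z) = m}"

lemma tree_pairs_eq: "tree_pairs m = (\<Union>q\<le>m. ternary_trees q \<times> ternary_trees (m - q))"
  by (auto simp: tree_pairs_def mem_ternary_trees)

text \<open>A common form for two counts. With all trees and \<open>J = n\<close> it is the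
  decomposition at the root; with concentrated trees and a fixed \<open>J\<close> it yields the
  lower bounds for condensation.\<close>

definition decorated :: "3 \<Rightarrow> (nat \<Rightarrow> word set set) \<Rightarrow> nat \<Rightarrow> word set set" where
  "decorated i X J = (\<lambda>(x, y, z). node i x y z) ` (\<Union>j\<le>J. X j \<times> tree_pairs j)"

lemma ternary_trees_Suc: "ternary_trees (Suc n) = decorated i (\<lambda>j. ternary_trees (n - j)) n"
proof (intro set_eqI iffI)
  fix t assume t: "t \<in> ternary_trees (Suc n)"
  then have ft: "finite_tree t" and c: "card (internal_nodes t) = Suc n" by (auto simp: mem_ternary_trees)
  then have "ternary_tree t" by (simp add: finite_tree_def)
  then show "t \<in> decorated i (\<lambda>j. ternary_trees (n - j)) n"
  proof (cases rule: ternary_tree_cases)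
    case 1 then show ?thesis using c by simp
  next
    case (2 f)
    have ff: "finite_tree (f j)" for j using 2 ft by (simp add: finite_tree_def finite_graft)
    have t: "t = node i (f i) (f (i + 1)) (f (i + 2))" using 2 graft_eq_node by simp
    then have "(f i, f (i + 1), f (i + 2)) \<in> (\<Union>j\<le>n. ternary_trees (n - j) \<times> tree_pairs j)"
      using c ff by (auto simp: card_internal_nodes_node mem_ternary_trees tree_pairs_def)
    then show ?thesis unfolding decorated_def t by (rule rev_image_eqI) simp
  qed
next
  fix t assume "t \<in> decorated i (\<lambda>j. ternary_trees (n - j)) n"
  then obtain j x y z where "t = node i x y z" "j \<le> n" "x \<in> ternary_trees (n - j)" "(y, z) \<in> tree_pairs j"
    unfolding decorated_def by auto
  then show "t \<in> ternary_trees (Suc n)"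
    by (simp add: tree_pairs_def mem_ternary_trees finite_tree_node card_internal_nodes_node)
qed

lemma ternary_trees_0: "ternary_trees 0 = {{[]}}"
proof -
  have "t = {[]}" if "t \<in> ternary_trees 0" for t
    using that finite_tree_internal_nodes_empty[of t] finite_internal_nodes[of t]
    by (simp add: mem_ternary_trees)
  moreover have "{[]} \<in> ternary_trees 0" by (simp add: mem_ternary_trees finite_tree_leaf)
  ultimately show ?thesis by blast
qed

lemma finite_ternary_trees: "finite (ternary_trees n)"
proof (induction n rule: less_induct)
  case (less n)
  show ?case
  proof (cases n)
    case (Suc m)
    then have "finite (tree_pairs j)" if "j \<le> m" for j
      unfolding tree_pairs_eq using less that by auto
    then show ?thesis unfolding Suc ternary_trees_Suc[of m 1] decorated_def using less Suc by auto
  qed (simp add: ternary_trees_0)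
qed

definition tree_count :: "nat \<Rightarrow> real" where
  "tree_count n = real (card (ternary_trees n))"

definition pair_count :: "nat \<Rightarrow> real" where
  "pair_count m = (\<Sum>q\<le>m. tree_count q * tree_count (m - q))"

lemma finite_tree_pairs: "finite (tree_pairs m)"
  by (auto simp: tree_pairs_eq finite_ternary_trees)

lemma card_tree_pairs: "real (card (tree_pairs m)) = pair_count m"
proof -
  have "card (tree_pairs m) = (\<Sum>q\<le>m. card (ternary_trees q \<times> ternary_trees (m - q)))"
    unfolding tree_pairs_eq
    by (intro card_UN_disjoint) (auto simp: finite_ternary_trees mem_ternary_trees)
  then show ?thesis by (simp add: card_cartesian_product pair_count_def tree_count_def)
qed

lemma card_decorated:
  assumes "\<And>j. j \<le> J \<Longrightarrow> finite (X j)"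
  shows "real (card (decorated i X J)) = (\<Sum>j\<le>J. real (card (X j)) * pair_count j)"
proof -
  have "card (decorated i X J) = card (\<Union>j\<le>J. X j \<times> tree_pairs j)"
    unfolding decorated_def by (intro card_image inj_onI) (auto simp: node_inject)
  also have "\<dots> = (\<Sum>j\<le>J. card (X j \<times> tree_pairs j))"
    using assms finite_tree_pairs by (intro card_UN_disjoint) (auto simp: tree_pairs_def)
  finally show ?thesis by (simp add: card_cartesian_product card_tree_pairs)
qed

lemma tree_count_0: "tree_count 0 = 1"
  by (simp add: tree_count_def ternary_trees_0)

lemma tree_count_Suc: "tree_count (Suc n) = (\<Sum>j\<le>n. tree_count (n - j) * pair_count j)"
proof -
  have "real (card (decorated 1 (\<lambda>j. ternary_trees (n - j)) n)) =
    (\<Sum>j\<le>n. real (card (ternary_trees (n - j))) * pair_count j)"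
    by (rule card_decorated[OF finite_ternary_trees])
  then show ?thesis unfolding tree_count_def by (simp only: ternary_trees_Suc[symmetric])
qed

lemma tree_count_nonneg: "0 \<le> tree_count n"
  by (simp add: tree_count_def)

lemma pair_count_nonneg: "0 \<le> pair_count n"
  by (auto simp: pair_count_def tree_count_nonneg intro!: sum_nonneg)

section \<open>Generating function, recurrence and ratio asymptotics of the counts\<close>

definition tree_fps :: "real fps" where
  "tree_fps = Abs_fps tree_count"

lemma tree_fps_nth: "fps_nth tree_fps n = tree_count n"
  by (simp add: tree_fps_def)

lemma tree_fps_square_nth: "fps_nth (tree_fps * tree_fps) n = pair_count n"
  by (simp add: fps_mult_nth tree_fps_nth pair_count_def atLeast0AtMost)

lemma tree_fps_equation: "tree_fps = 1 + fps_X * tree_fps ^ 3"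
proof (rule fps_ext)
  fix n show "fps_nth tree_fps n = fps_nth (1 + fps_X * tree_fps ^ 3) n"
  proof (cases n)
    case (Suc m)
    have "fps_nth (tree_fps ^ 3) m = fps_nth ((tree_fps * tree_fps) * tree_fps) m"
      by (simp add: power3_eq_cube)
    also have "\<dots> = tree_count (Suc m)"
      by (subst fps_mult_nth) (simp add: tree_fps_square_nth tree_fps_nth tree_count_Suc atLeast0AtMost mult.commute)
    finally show ?thesis using Suc by (simp add: tree_fps_nth)
  qed (simp add: tree_fps_nth tree_count_0)
qed

text \<open>
  The generating function is algebraic, hence holonomic: eliminating \<open>fps_X\<close> with \<open>x a\<^sup>3 = a - 1\<close>
  makes the second-order equation a polynomial identity in \<open>a\<close>.
\<close>
lemma tree_fps_ode:
  "(27 * fps_X ^ 2 - 4 * fps_X) * fps_deriv (fps_deriv tree_fps) + (54 * fps_X - 6) * fps_deriv tree_fps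
    + 6 * tree_fps = 0"
proof -
  define a x d e where "a = tree_fps" and "x = (fps_X :: real fps)"
    and "d = fps_deriv tree_fps" and "e = fps_deriv (fps_deriv tree_fps)"
  define E where "E = 3 - 2 * a"
  have u: "x * a ^ 3 = a - 1"
    using tree_fps_equation unfolding a_def x_def by (metis add_diff_cancel_left')
  have "d = a ^ 3 + x * (3 * a ^ 2 * d)"
    unfolding d_def a_def x_def
    by (subst (1) tree_fps_equation) (simp add: fps_deriv_power algebra_simps)
  then have "a * d = a ^ 4 + 3 * (x * a ^ 3) * d"
    by (metis (no_types) mult.commute mult.left_commute distrib_left power3_eq_cube power2_eq_square
        power4_eq_xxxx mult.assoc)
  then have d: "E * d = a ^ 4"
    unfolding u E_def by (simp add: algebra_simps)
  have "fps_deriv (E * d) = E * e - 2 * d * d"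
    unfolding E_def d_def e_def a_def by (simp add: algebra_simps)
  moreover have "fps_deriv (a ^ 4) = 4 * a ^ 3 * d"
    unfolding a_def d_def by (simp add: fps_deriv_power algebra_simps)
  ultimately have e: "E * e = 2 * d * d + 4 * a ^ 3 * d"
    using d by (metis diff_eq_eq add.commute)
  have "E ^ 3 * e = E ^ 2 * (E * e)" by (simp add: power3_eq_cube power2_eq_square mult.assoc)
  also have "\<dots> = 2 * (E * d) * (E * d) + 4 * a ^ 3 * E * (E * d)"
    unfolding e by (simp add: power2_eq_square algebra_simps)
  finally have e3: "E ^ 3 * e = 2 * a ^ 8 + 4 * a ^ 7 * E"
    unfolding d by (simp add: algebra_simps power_numeral_reduce)
  have "E ^ 3 * d = E ^ 2 * (E * d)" by (simp add: power3_eq_cube power2_eq_square mult.assoc)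
  then have d3: "E ^ 3 * d = E ^ 2 * a ^ 4" unfolding d .
  \<comment> \<open>\<open>E ^ 3\<close> clears the denominators of \<open>d = a ^ 4 / E\<close> and
    of \<open>e\<close>, and \<open>a ^ 6\<close> lets every \<open>x\<close> occur as
    \<open>x * a ^ 3\<close>. Both factors cancel at the end, since \<open>a\<close> and
    \<open>E\<close> have constant term \<open>1\<close>.\<close>
  have "E ^ 3 * a ^ 6 * ((27 * x ^ 2 - 4 * x) * e + (54 * x - 6) * d + 6 * a) =
    (27 * (x * a ^ 3) ^ 2 - 4 * (x * a ^ 3) * a ^ 3) * (E ^ 3 * e)
    + (54 * (x * a ^ 3) * a ^ 3 - 6 * a ^ 6) * (E ^ 3 * d) + 6 * a ^ 7 * E ^ 3"
    by (simp add: algebra_simps power_numeral_reduce)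
  also have "\<dots> = 0"
    unfolding u e3 d3 unfolding E_def by (simp add: algebra_simps power_numeral_reduce)
  finally have "E ^ 3 * a ^ 6 * ((27 * x ^ 2 - 4 * x) * e + (54 * x - 6) * d + 6 * a) = 0" .
  moreover have "fps_nth a 0 = 1" "fps_nth E 0 = 1"
    by (simp_all add: E_def a_def tree_fps_nth tree_count_0 numeral_fps_const)
  then have "a \<noteq> 0" "E \<noteq> 0" by auto
  ultimately show ?thesis unfolding a_def x_def d_def e_def by simp
qed

text \<open>Comparison of coefficients in \<open>tree_fps_ode\<close>. It makes the ratio of
  consecutive counts a rational function of \<open>n\<close>, so that no closed formula is
  required.\<close>

lemma tree_count_recurrence:
  "2 * (real n + 1) * (2 * real n + 3) * tree_count (Suc n) = 3 * (3 * real n + 1) * (3 * real n + 2) * tree_count n"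
proof -
  have "fps_nth ((27 * fps_X ^ 2 - 4 * fps_X) * fps_deriv (fps_deriv tree_fps) + (54 * fps_X - 6) * fps_deriv tree_fps
    + 6 * tree_fps) n = 0"
    by (simp only: tree_fps_ode fps_zero_nth)
  then show ?thesis
    \<comment> \<open>Multiplication by \<open>fps_X ^ 2\<close> shifts the index by two, so
      \<open>n = 0\<close> and \<open>n = 1\<close> are separate cases.\<close>
    by (cases n; cases "n - 1")
       (auto simp: numeral_fps_const tree_fps_nth power2_eq_square mult.assoc ring_distribs
         fps_sub_nth algebra_simps)
qed

lemma tree_count_pos: "0 < tree_count n"
proof (induction n)
  case (Suc n)
  have "0 < 3 * (3 * real n + 1) * (3 * real n + 2) * tree_count n" using Suc by simp
  then show ?case unfolding tree_count_recurrence[symmetric] by (rule zero_less_mult_pos) simp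
qed (simp add: tree_count_0)

lemma tree_count_ratio: "(\<lambda>n. tree_count n / tree_count (Suc n)) \<longlonglongrightarrow> 4 / 27"
proof -
  have "tree_count n / tree_count (Suc n) =
    2 * (real n + 1) * (2 * real n + 3) / (3 * (3 * real n + 1) * (3 * real n + 2))" for n
    using tree_count_recurrence[of n] tree_count_pos[of "Suc n"] by (simp add: divide_simps)
  moreover have "(\<lambda>n. 2 * (real n + 1) * (2 * real n + 3) / (3 * (3 * real n + 1) * (3 * real n + 2)))
      \<longlonglongrightarrow> 4 / 27"
    by real_asymp
  ultimately show ?thesis by simp
qed

lemma tree_count_ratio_shift: "(\<lambda>n. tree_count n / tree_count (n + j)) \<longlonglongrightarrow> (4 / 27) ^ j"
proof (induction j)
  case 0
  have "tree_count n / tree_count (n + 0) = 1" for n using tree_count_pos[of n] by simp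
  then show ?case by simp
next
  case (Suc j)
  have "(\<lambda>n. tree_count (n + j) / tree_count (Suc (n + j))) \<longlonglongrightarrow> 4 / 27"
    by (rule LIMSEQ_ignore_initial_segment[OF tree_count_ratio])
  from tendsto_mult[OF this Suc.IH]
  have "(\<lambda>n. tree_count (n + j) / tree_count (Suc (n + j)) * (tree_count n / tree_count (n + j)))
      \<longlonglongrightarrow> (4 / 27) ^ Suc j"
    by simp
  moreover have "tree_count (n + j) / tree_count (Suc (n + j)) * (tree_count n / tree_count (n + j)) =
      tree_count n / tree_count (n + Suc j)" for n
    using tree_count_pos[of "n + j"] by simp
  ultimately show ?case by simp
qed

section \<open>Value of the generating function at the critical point \<open>4/27\<close>\<close>

lemma partial_Cauchy_product_le:
  fixes f g :: "nat \<Rightarrow> real"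
  assumes "\<And>n. 0 \<le> f n" "\<And>n. 0 \<le> g n"
  shows "(\<Sum>k<n. \<Sum>i\<le>k. f i * g (k - i)) \<le> (\<Sum>i<n. f i) * (\<Sum>j<n. g j)"
proof -
  have "(\<Sum>k<n. \<Sum>i\<le>k. f i * g (k - i)) = (\<Sum>(i, j)\<in>{(i, j). i + j < n}. f i * g j)"
    by (rule sum.triangle_reindex[symmetric])
  also have "\<dots> \<le> (\<Sum>(i, j)\<in>{..<n} \<times> {..<n}. f i * g j)"
    using assms by (intro sum_mono2) auto
  also have "\<dots> = (\<Sum>i<n. f i) * (\<Sum>j<n. g j)"
    by (simp add: sum_product sum.cartesian_product)
  finally show ?thesis .
qed

abbreviation weight :: "nat \<Rightarrow> real" where
  "weight n \<equiv> tree_count n * (4 / 27) ^ n"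

lemma pair_weight: "pair_count k * (4 / 27) ^ k = (\<Sum>i\<le>k. weight i * weight (k - i))"
proof -
  have "tree_count i * tree_count (k - i) * (4 / 27) ^ k = weight i * weight (k - i)" if "i \<le> k" for i
  proof -
    have "(4 / 27 :: real) ^ k = (4 / 27) ^ i * (4 / 27) ^ (k - i)"
      using that by (simp add: power_add[symmetric])
    then show ?thesis by simp
  qed
  then show ?thesis unfolding pair_count_def sum_distrib_right by (intro sum.cong) auto
qed

lemma weight_Suc: "weight (Suc n) = 4 / 27 * (\<Sum>j\<le>n. (pair_count j * (4 / 27) ^ j) * weight (n - j))"
proof -
  have "tree_count (n - j) * pair_count j * (4 / 27) ^ Suc n =
      4 / 27 * ((pair_count j * (4 / 27) ^ j) * weight (n - j))" if "j \<le> n" for j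
  proof -
    have "(4 / 27 :: real) ^ n = (4 / 27) ^ j * (4 / 27) ^ (n - j)"
      using that by (simp add: power_add[symmetric])
    then show ?thesis by simp
  qed
  then show ?thesis unfolding tree_count_Suc sum_distrib_right sum_distrib_left by (intro sum.cong) auto
qed

lemma weight_nonneg: "0 \<le> weight n"
  by (simp add: tree_count_nonneg)

text \<open>The map \<open>s \<mapsto> 1 + 4/27 * s^3\<close> is increasing on the nonnegative reals
  and fixes \<open>3/2\<close>. Partial sums are dominated by its iterates, which gives convergence
  at the critical point itself.\<close>

lemma sum_weight_le: "(\<Sum>k<n. weight k) \<le> 3 / 2"
proof (induction n)
  case (Suc n)
  let ?S = "\<Sum>k<n. weight k"
  have S0: "0 \<le> ?S" by (intro sum_nonneg weight_nonneg)
  have "(\<Sum>k<n. pair_count k * (4 / 27) ^ k) \<le> ?S * ?S"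
    unfolding pair_weight by (intro partial_Cauchy_product_le weight_nonneg)
  moreover have "(\<Sum>k<n. \<Sum>j\<le>k. (pair_count j * (4 / 27) ^ j) * weight (k - j))
      \<le> (\<Sum>k<n. pair_count k * (4 / 27) ^ k) * ?S"
    by (intro partial_Cauchy_product_le weight_nonneg) (simp add: pair_count_nonneg)
  ultimately have "(\<Sum>k<n. \<Sum>j\<le>k. (pair_count j * (4 / 27) ^ j) * weight (k - j)) \<le> ?S * ?S * ?S"
    using S0 by (meson mult_right_mono order_trans)
  also have "\<dots> \<le> (3 / 2) * (3 / 2) * (3 / 2)"
    using Suc S0 by (intro mult_mono mult_nonneg_nonneg) auto
  finally have "(\<Sum>k<n. weight (Suc k)) \<le> 4 / 27 * (27 / 8)"
    unfolding weight_Suc sum_distrib_left[symmetric] by simp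
  then show ?case by (subst sum.lessThan_Suc_shift) (simp add: tree_count_0)
qed simp

lemma sums_weight: "weight sums (3 / 2)"
proof -
  have summ: "summable weight"
    by (rule bounded_imp_summable[where B = "3 / 2"])
       (use weight_nonneg sum_weight_le[of "Suc _"] in \<open>auto simp: lessThan_Suc_atMost\<close>)
  define S where "S = suminf weight"
  have S: "weight sums S" unfolding S_def using summ by (rule summable_sums)
  have absum: "summable (\<lambda>n. norm (weight n))" using summ weight_nonneg by simp
  have P: "(\<lambda>k. pair_count k * (4 / 27) ^ k) sums (S * S)"
    unfolding pair_weight S_def by (rule Cauchy_product_sums[OF absum absum])
  then have absP: "summable (\<lambda>k. norm (pair_count k * (4 / 27) ^ k))"
    using pair_count_nonneg by (simp add: sums_iff)
  have "(\<lambda>n. \<Sum>j\<le>n. (pair_count j * (4 / 27) ^ j) * weight (n - j)) sums (S * S * S)"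
    using Cauchy_product_sums[OF absP absum] P S by (simp add: sums_iff)
  then have "(\<lambda>n. weight (Suc n)) sums (4 / 27 * (S * S * S))"
    unfolding weight_Suc by (rule sums_mult)
  then have "weight sums (4 / 27 * (S * S * S) + weight 0)"
    by (rule sums_Suc)
  then have "S = 4 / 27 * (S * S * S) + 1"
    using S sums_unique2 by (fastforce simp: tree_count_0)
  \<comment> \<open>The fixed-point equation is a cubic with the double root \<open>3/2\<close>, a
    mark of criticality, and the root \<open>-3\<close>, excluded by sign.\<close>
  moreover have "(S - 3 / 2) * (S - 3 / 2) * (S + 3) = 27 / 4 * (4 / 27 * (S * S * S) + 1 - S)"
    by (simp add: field_simps)
  ultimately have "(S - 3 / 2) * (S - 3 / 2) * (S + 3) = 0" by simp
  moreover have "0 \<le> S" unfolding S_def by (rule suminf_nonneg[OF summ weight_nonneg])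
  ultimately have "S = 3 / 2" by simp
  with S show ?thesis by simp
qed

text \<open>\<open>4/27 * (3/2)^2 = 1/3\<close>. The \<open>j\<close>-th term is the limiting
  probability that a given branch of the root misses exactly \<open>j + 1\<close> nodes; the total
  \<open>1/3\<close> leaves nothing for trees without a dominant branch.\<close>

lemma sums_pair_weight: "(\<lambda>j. pair_count j * (4 / 27) ^ Suc j) sums (1 / 3)"
proof -
  have absum: "summable (\<lambda>n. norm (weight n))" using sums_weight weight_nonneg by (simp add: sums_iff)
  have "(\<lambda>k. pair_count k * (4 / 27) ^ k) sums (3 / 2 * (3 / 2))"
    unfolding pair_weight
    using Cauchy_product_sums[OF absum absum] unfolding sums_unique[OF sums_weight, symmetric] .
  from sums_mult[OF this, of "4 / 27"] show ?thesis by (simp add: mult_ac)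
qed

section \<open>Condensation: uniform trees consist of one large branch\<close>

text \<open>All but at most \<open>K\<close> nodes lie below \<open>v\<close>; the sum on the right
  avoids truncated subtraction.\<close>

definition concentrated :: "nat \<Rightarrow> word \<Rightarrow> nat \<Rightarrow> word set set" where
  "concentrated n v K = {t \<in> ternary_trees n. n \<le> card {w. v @ w \<in> internal_nodes t} + K}"

text \<open>At most \<open>K\<close> nodes are lost inside the large branch, at most
  \<open>J\<close> in the other two, and one more is the root.\<close>

lemma decorated_subset_concentrated:
  assumes "J \<le> n"
  shows "decorated i (\<lambda>j. concentrated (n - j) v K) J \<subseteq> concentrated (Suc n) (i # v) (Suc (K + J))"
proof
  fix t assume "t \<in> decorated i (\<lambda>j. concentrated (n - j) v K) J"
  then obtain j x y z where t: "t = node i x y z" "j \<le> J" "x \<in> concentrated (n - j) v K" "(y, z) \<in> tree_pairs j"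
    unfolding decorated_def by auto
  have "{w. (i # v) @ w \<in> internal_nodes t} = {w. v @ w \<in> internal_nodes x}"
    unfolding t(1) node_def using shift_3_neq(1)[of i] by auto
  with t assms show "t \<in> concentrated (Suc n) (i # v) (Suc (K + J))"
    by (auto simp: concentrated_def tree_pairs_def mem_ternary_trees finite_tree_node card_internal_nodes_node)
qed

text \<open>Each letter multiplies the limiting proportion by \<open>1/3\<close>. A finite part of
  the series for \<open>1/3\<close> is enough because the inequality
  \<open>c < (1 / 3) ^ length v\<close> is strict, and \<open>K\<close> grows with every
  letter.\<close>

lemma concentrated_proportion:
  assumes "c < (1 / 3) ^ length v"
  shows "\<exists>K. \<forall>\<^sub>F n in sequentially. c * tree_count n \<le> real (card (concentrated n v K))"
  using assms
proof (induction v arbitrary: c)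
  case Nil
  have "concentrated n [] 0 = ternary_trees n" for n
    by (auto simp: concentrated_def mem_ternary_trees)
  moreover have "c * tree_count n \<le> tree_count n" for n
    using Nil tree_count_nonneg[of n] mult_right_mono[of c 1 "tree_count n"] by simp
  ultimately show ?case by (intro exI[of _ 0]) (simp add: tree_count_def)
next
  case (Cons i v)
  define p where "p = (1 / 3 :: real) ^ length v"
  have p: "0 < p" "3 * c < p" using Cons.prems by (auto simp: p_def)
  \<comment> \<open>Strictly between \<open>3 * c\<close> and \<open>p\<close>; the maximum keeps it
    nonnegative when \<open>c\<close> is negative.\<close>
  define c' where "c' = max (p / 2) ((3 * c + p) / 2)"
  have c': "0 \<le> c'" "c' < p" "c < c' * (1 / 3)"
  proof -
    have "(3 * c + p) / 2 \<le> c'" "p / 2 \<le> c'" by (simp_all add: c'_def)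
    moreover have "3 * c < (3 * c + p) / 2" using p(2) by simp
    ultimately show "0 \<le> c'" "c < c' * (1 / 3)" using p by simp_all
    show "c' < p" using p by (auto simp: c'_def)
  qed
  obtain K where K: "\<forall>\<^sub>F n in sequentially. c' * tree_count n \<le> real (card (concentrated n v K))"
    using Cons.IH[of c'] c' p_def by auto
  have "(\<lambda>n. c' * (\<Sum>j<n. pair_count j * (4 / 27) ^ Suc j)) \<longlonglongrightarrow> c' * (1 / 3)"
    using sums_pair_weight unfolding sums_def by (rule tendsto_mult_left)
  then have "(\<lambda>n. c' * (\<Sum>j<Suc n. pair_count j * (4 / 27) ^ Suc j)) \<longlonglongrightarrow> c' * (1 / 3)"
    by (rule LIMSEQ_Suc)
  from order_tendstoD(1)[OF this c'(3)]
  obtain J where J: "c < c' * (\<Sum>j\<le>J. pair_count j * (4 / 27) ^ Suc j)"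
    unfolding eventually_sequentially lessThan_Suc_atMost by blast
  \<comment> \<open>The lower bound for the proportion in size \<open>Suc (m + J)\<close>. With the
    shift by \<open>J\<close> no difference \<open>m + J - j\<close> is truncated.\<close>
  define r where "r = (\<lambda>m. c' * (\<Sum>j\<le>J. pair_count j * (tree_count (m + J - j) / tree_count (Suc (m + J)))))"
  have "(\<lambda>m. tree_count (m + J - j) / tree_count (Suc (m + J))) \<longlonglongrightarrow> (4 / 27) ^ Suc j" if "j \<le> J" for j
  proof -
    have "(\<lambda>m. tree_count (m + (J - j)) / tree_count (m + (J - j) + Suc j)) \<longlonglongrightarrow> (4 / 27) ^ Suc j"
      by (rule LIMSEQ_ignore_initial_segment[OF tree_count_ratio_shift])
    then show ?thesis using that by simp
  qed
  then have "r \<longlonglongrightarrow> c' * (\<Sum>j\<le>J. pair_count j * (4 / 27) ^ Suc j)"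
    unfolding r_def by (intro tendsto_intros) auto
  then have "\<forall>\<^sub>F m in sequentially. c < r m" using J by (rule order_tendstoD(1))
  moreover have "\<forall>\<^sub>F m in sequentially. \<forall>j\<in>{..J}. c' * tree_count (m + (J - j)) \<le> real (card (concentrated (m + (J - j)) v K))"
    by (intro eventually_ball_finite ballI eventually_sequentially_seg[THEN iffD2] K) auto
  ultimately have "\<forall>\<^sub>F m in sequentially. c * tree_count (m + Suc J) \<le>
      real (card (concentrated (m + Suc J) (i # v) (Suc (K + J))))"
  proof eventually_elim
    case (elim m)
    have "c * tree_count (Suc (m + J)) \<le> r m * tree_count (Suc (m + J))"
      using elim tree_count_nonneg by (intro mult_right_mono) auto
    also have "\<dots> = (\<Sum>j\<le>J. c' * tree_count (m + J - j) * pair_count j)"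
      using tree_count_pos[of "Suc (m + J)"]
      by (simp add: r_def sum_distrib_left sum_distrib_right mult_ac)
    also have "\<dots> \<le> (\<Sum>j\<le>J. real (card (concentrated (m + J - j) v K)) * pair_count j)"
      using elim(2) pair_count_nonneg by (intro sum_mono mult_right_mono) auto
    also have "\<dots> = real (card (decorated i (\<lambda>j. concentrated (m + J - j) v K) J))"
      by (subst card_decorated)
         (auto simp: concentrated_def intro: finite_subset[OF _ finite_ternary_trees])
    also have "\<dots> \<le> real (card (concentrated (Suc (m + J)) (i # v) (Suc (K + J))))"
      using decorated_subset_concentrated[of J "m + J" i v K]
      by (intro of_nat_mono card_mono) (auto simp: concentrated_def intro: finite_subset[OF _ finite_ternary_trees])
    finally show ?case by simp
  qed
  then show ?case
    using eventually_sequentially_seg[of "\<lambda>n. c * tree_count n \<le> real (card (concentrated n (i # v) (Suc (K + J))))" "Suc J"]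
    by blast
qed

text \<open>Nodes below two different words of equal length are different, so a common tree would
  have at least \<open>2 * (n - K) > n\<close> nodes.\<close>

lemma disjoint_concentrated:
  assumes "length v = length v'" "v \<noteq> v'" "2 * K < n"
  shows "concentrated n v K \<inter> concentrated n v' K = {}"
proof -
  have False if "t \<in> concentrated n v K" "t \<in> concentrated n v' K" for t
  proof -
    from that have ft: "finite (internal_nodes t)" and ct: "card (internal_nodes t) = n"
      by (auto simp: concentrated_def mem_ternary_trees finite_internal_nodes)
    let ?B = "\<lambda>v. (@) v ` {w. v @ w \<in> internal_nodes t}"
    have "card (?B v \<union> ?B v') \<le> card (internal_nodes t)"
      by (intro card_mono ft) auto
    moreover have "card (?B v \<union> ?B v') = card (?B v) + card (?B v')"
      by (intro card_Un_disjoint finite_subset[OF _ ft]) (use assms in auto)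
    moreover have "card (?B v) = card {w. v @ w \<in> internal_nodes t}" for v
      by (simp add: card_image inj_on_def)
    ultimately show False using that ct assms(3) by (simp add: concentrated_def)
  qed
  then show ?thesis by blast
qed

section \<open>Triangulations in barycentric coordinates\<close>

lemma UNIV_3_distinct:
  assumes "i \<noteq> j" "j \<noteq> k" "i \<noteq> (k :: 3)"
  shows "UNIV = {i, j, k}"
proof -
  have "card {i, j, k} = card (UNIV :: 3 set)" using assms by simp
  then show ?thesis by (rule card_subset_eq[OF finite_class.finite_UNIV subset_UNIV, symmetric])
qed

lemma sum_3_distinct:
  fixes f :: "3 \<Rightarrow> 'b::comm_monoid_add"
  assumes "i \<noteq> j" "j \<noteq> k" "i \<noteq> (k :: 3)"
  shows "(\<Sum>l\<in>UNIV. f l) = f i + (f j + f k)"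
  unfolding UNIV_3_distinct[OF assms] using assms by simp

lemma forall_3_distinct:
  assumes "i \<noteq> j" "j \<noteq> k" "i \<noteq> (k :: 3)"
  shows "(\<forall>l. Q l) \<longleftrightarrow> Q i \<and> Q j \<and> Q k"
  using UNIV_3_distinct[OF assms] by (metis UNIV_I insert_iff empty_iff)

lemma third_index:
  assumes "i \<noteq> (j :: 3)"
  obtains k where "i \<noteq> j" "j \<noteq> k" "i \<noteq> k"
proof -
  have "card {i, j} \<noteq> card (UNIV :: 3 set)" using card_insert_le_m1[of 2 "{j}" i] by auto
  then have "{i, j} \<noteq> UNIV" by metis
  then obtain k where "k \<notin> {i, j}" by blast
  then show ?thesis using that[of k] assms by blast
qed

lemma two_other_indices:
  obtains j k where "i \<noteq> j" "j \<noteq> k" "i \<noteq> (k :: 3)"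
  using third_index[of i "i + 1"] shift_3_neq(1)[of i] by metis

text \<open>The linear map that sends \<open>axis i 1\<close> to \<open>p\<close> and fixes the
  other axis vectors: it turns barycentric coordinates in subtriangle \<open>i\<close> into
  coordinates in the big triangle. Being linear, it acts on cones without normalization.\<close>

definition expand :: "real ^ 3 \<Rightarrow> 3 \<Rightarrow> real ^ 3 \<Rightarrow> real ^ 3" where
  "expand p i y = y + (y $ i) *\<^sub>R (p - axis i 1)"

lemma expand_nth: "expand p i y $ j = (if j = i then y $ i * p $ i else y $ j + y $ i * p $ j)"
  by (simp add: expand_def axis_def algebra_simps)

lemma linear_expand: "linear (expand p i)"
  by (rule linearI) (simp_all add: expand_def algebra_simps)

lemma sum_expand:
  assumes "(\<Sum>j\<in>UNIV. p $ j) = 1"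
  shows "(\<Sum>j\<in>UNIV. expand p i y $ j) = (\<Sum>j\<in>UNIV. y $ j)"
proof -
  obtain j k where d: "i \<noteq> j" "j \<noteq> k" "i \<noteq> k" by (rule two_other_indices)
  have "p $ i = 1 - p $ j - p $ k" using assms unfolding sum_3_distinct[OF d] by simp
  then show ?thesis
    using d unfolding sum_3_distinct[OF d] by (simp add: expand_nth right_diff_distrib)
qed

lemma open_simplex_pos: "p \<in> open_simplex \<Longrightarrow> 0 < p $ i"
  and open_simplex_sum: "p \<in> open_simplex \<Longrightarrow> (\<Sum>i\<in>UNIV. p $ i) = 1"
  by (simp_all add: open_simplex_def)

lemma open_simplex_less_1:
  assumes "p \<in> open_simplex"
  shows "p $ i < 1"
proof -
  obtain j k where d: "i \<noteq> j" "j \<noteq> k" "i \<noteq> k" by (rule two_other_indices)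
  show ?thesis
    using open_simplex_sum[OF assms] open_simplex_pos[OF assms, of j] open_simplex_pos[OF assms, of k]
    unfolding sum_3_distinct[OF d] by linarith
qed

text \<open>Two subtriangles meet only in the edge from \<open>p\<close> to their common old corner.
  Coordinates \<open>i\<close> and \<open>j\<close> of the equation give
  \<open>z $ j \<le> y $ i\<close> and \<open>y $ i \<le> z $ j\<close>, and equality leaves no room
  for the remaining terms.\<close>

lemma expand_collision:
  assumes p: "p \<in> open_simplex" and "\<And>l. 0 \<le> y $ l" "\<And>l. 0 \<le> z $ l"
    and eq: "expand p i y = expand p j z" and "i \<noteq> j"
  shows "y $ j = 0" "z $ i = 0" "y $ i = z $ j"
proof -
  have "y $ i * p $ i = z $ i + z $ j * p $ i" "y $ j + y $ i * p $ j = z $ j * p $ j"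
    using arg_cong[OF eq, of "\<lambda>x. x $ i"] arg_cong[OF eq, of "\<lambda>x. x $ j"] \<open>i \<noteq> j\<close>
    by (simp_all add: expand_nth)
  moreover from this have "z $ j * p $ i \<le> y $ i * p $ i" "y $ i * p $ j \<le> z $ j * p $ j"
    using assms(2)[of j] assms(3)[of i] by linarith+
  then have "z $ j \<le> y $ i" "y $ i \<le> z $ j"
    using open_simplex_pos[OF p] by (meson mult_right_le_imp_le)+
  ultimately show "y $ j = 0" "z $ i = 0" "y $ i = z $ j" by auto
qed

lemma expand_inject:
  assumes "p \<in> open_simplex"
  shows "expand p i y = expand p i z \<longleftrightarrow> y = z"
proof
  assume eq: "expand p i y = expand p i z"
  have "y $ i * p $ i = z $ i * p $ i" using arg_cong[OF eq, of "\<lambda>x. x $ i"] by (simp add: expand_nth)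
  then have i: "y $ i = z $ i" using open_simplex_pos[OF assms, of i] by simp
  have "y $ l = z $ l" for l
    using arg_cong[OF eq, of "\<lambda>x. x $ l"] i by (cases "l = i") (simp_all add: expand_nth)
  then show "y = z" by (simp add: vec_eq_iff)
qed simp

definition valid_splits :: "word set \<Rightarrow> (word \<Rightarrow> real ^ 3) \<Rightarrow> bool" where
  "valid_splits t P \<longleftrightarrow> (\<forall>u\<in>internal_nodes t. P u \<in> open_simplex)"

abbreviation shift :: "(word \<Rightarrow> real ^ 3) \<Rightarrow> 3 \<Rightarrow> word \<Rightarrow> real ^ 3" where
  "shift P i \<equiv> \<lambda>u. P (i # u)"

lemma valid_splits_graft:
  assumes "\<And>i. [] \<in> f i"
  shows "valid_splits (graft f) P \<longleftrightarrow> P [] \<in> open_simplex \<and> (\<forall>i. valid_splits (f i) (shift P i))"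
  unfolding valid_splits_def internal_nodes_graft[OF assms] by auto

text \<open>The cone over the boundary of the triangle: the sum of the coordinates is free, and the
  origin is included.\<close>

definition on_boundary :: "real ^ 3 \<Rightarrow> bool" where
  "on_boundary x \<longleftrightarrow> (\<forall>i. 0 \<le> x $ i) \<and> (\<exists>i. x $ i = 0)"

text \<open>
  The cone over the triangulation in barycentric coordinates. \<open>expand (P []) i\<close> maps the big triangle
  onto its subtriangle with label \<open>i\<close>.
\<close>
inductive skeleton :: "word set \<Rightarrow> (word \<Rightarrow> real ^ 3) \<Rightarrow> real ^ 3 \<Rightarrow> bool" where
  boundary: "on_boundary x \<Longrightarrow> skeleton t P x"
| inner: "[] \<in> internal_nodes t \<Longrightarrow> skeleton {u. i # u \<in> t} (shift P i) y \<Longrightarrow> skeleton t P (expand (P []) i y)"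

lemma skeleton_leaf: "skeleton {[]} P x \<longleftrightarrow> on_boundary x"
  by (subst skeleton.simps) auto

lemma skeleton_graft:
  assumes "\<And>i. [] \<in> f i"
  shows "skeleton (graft f) P x \<longleftrightarrow>
    on_boundary x \<or> (\<exists>i y. x = expand (P []) i y \<and> skeleton (f i) (shift P i) y)"
  using assms by (subst skeleton.simps) (auto simp: Nil_in_internal_nodes_graft)

lemma skeleton_nonneg:
  assumes "finite_tree t" "valid_splits t P" "skeleton t P x"
  shows "0 \<le> x $ l"
  using assms
proof (induction t arbitrary: P x l rule: finite_tree_induct)
  case (node f)
  have N: "[] \<in> f i" for i using node.hyps by (rule finite_tree_Nil)
  have p: "P [] \<in> open_simplex" and v: "valid_splits (f i) (shift P i)" for i
    using node.prems(1) unfolding valid_splits_graft[OF N] by blast+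
  from node.prems(2) consider "on_boundary x" | i y where "x = expand (P []) i y" "skeleton (f i) (shift P i) y"
    unfolding skeleton_graft[OF N] by blast
  then show ?case
  proof cases
    case (2 i y)
    then have "0 \<le> y $ m" for m using node.IH v by blast
    then show ?thesis unfolding 2(1) expand_nth using open_simplex_pos[OF p] by (simp add: less_imp_le)
  qed (simp add: on_boundary_def)
qed (simp add: skeleton_leaf on_boundary_def)

lemma skeleton_scale:
  assumes "skeleton t P x" "0 < (c :: real)"
  shows "skeleton t P (c *\<^sub>R x)"
  using assms(1)
proof induction
  case (boundary x t P)
  then show ?case using assms(2) by (intro skeleton.boundary) (auto simp: on_boundary_def)
next
  case (inner t i P y)
  then have "skeleton t P (expand (P []) i (c *\<^sub>R y))" by (intro skeleton.inner)
  then show ?case by (simp add: linear_scale[OF linear_expand])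
qed

text \<open>A point of subtriangle \<open>i\<close> may also be reached through the outer boundary
  or through a neighbouring subtriangle, but then it lies on the boundary of subtriangle
  \<open>i\<close> anyway. Hence the skeleton of a branch can be read off the whole
  skeleton.\<close>

lemma skeleton_expand_iff:
  assumes ft: "\<And>i. finite_tree (f i)" and v: "valid_splits (graft f) P" and y: "\<And>l. 0 \<le> y $ l"
  shows "skeleton (graft f) P (expand (P []) i y) \<longleftrightarrow> skeleton (f i) (shift P i) y"
proof
  have N: "[] \<in> f i" for i using ft by (rule finite_tree_Nil)
  have p: "P [] \<in> open_simplex" and vi: "valid_splits (f i) (shift P i)" for i
    using v unfolding valid_splits_graft[OF N] by blast+
  assume "skeleton (graft f) P (expand (P []) i y)"
  then consider "on_boundary (expand (P []) i y)" |
      j z where "expand (P []) i y = expand (P []) j z" "skeleton (f j) (shift P j) z"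
    unfolding skeleton_graft[OF N] by blast
  then show "skeleton (f i) (shift P i) y"
  proof cases
    case 1
    then obtain l where "expand (P []) i y $ l = 0" by (auto simp: on_boundary_def)
    then have "y $ l = 0"
      using open_simplex_pos[OF p, of l] y[of l] mult_nonneg_nonneg[OF y[of i], of "P [] $ l"]
      by (auto simp: expand_nth add_nonneg_eq_0_iff split: if_splits)
    then show ?thesis using y by (intro skeleton.boundary) (auto simp: on_boundary_def)
  next
    case (2 j z)
    show ?thesis
    proof (cases "i = j")
      case True
      with 2 show ?thesis using expand_inject[OF p] by simp
    next
      case False
      have "\<And>l. 0 \<le> z $ l" using skeleton_nonneg[OF ft vi 2(2)] .
      from expand_collision[OF p y this 2(1) False] show ?thesis
        using y by (intro skeleton.boundary) (auto simp: on_boundary_def)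
    qed
  qed
next
  have N: "[] \<in> f i" for i using ft by (rule finite_tree_Nil)
  show "skeleton (f i) (shift P i) y \<Longrightarrow> skeleton (graft f) P (expand (P []) i y)"
    unfolding skeleton_graft[OF N] by blast
qed

text \<open>Inner edges do not accumulate at the relative interior of a side of the triangle.\<close>
lemma skeleton_avoids_side:
  assumes "finite_tree t" "valid_splits t P"
  shows "\<exists>e>0. \<forall>x. 0 < x $ i \<and> (\<forall>j. j \<noteq> i \<longrightarrow> x $ i < e * x $ j) \<longrightarrow> \<not> skeleton t P x"
  using assms
proof (induction t arbitrary: P rule: finite_tree_induct)
  case leaf
  have "\<not> on_boundary x" if *: "0 < x $ i" "\<forall>j. j \<noteq> i \<longrightarrow> x $ i < 1 * x $ j" for x :: "real ^ 3"
  proof -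
    have "x $ l \<noteq> 0" for l using * by (cases "l = i") force+
    then show ?thesis by (simp add: on_boundary_def)
  qed
  then show ?case unfolding skeleton_leaf by (intro exI[of _ 1]) auto
next
  case (node f)
  have N: "[] \<in> f i" for i using node.hyps by (rule finite_tree_Nil)
  define p where "p = P []"
  have p: "p \<in> open_simplex" and v: "valid_splits (f i) (shift P i)" for i
    using node.prems(1) unfolding valid_splits_graft[OF N] p_def by blast+
  obtain e where e: "0 < e"
    "\<And>x. 0 < x $ i \<Longrightarrow> (\<And>j. j \<noteq> i \<Longrightarrow> x $ i < e * x $ j) \<Longrightarrow> \<not> skeleton (f i) (shift P i) x"
    using node.IH[OF v] by blast
  \<comment> \<open>Two demands meet here. In subtriangle \<open>i\<close> the factor
    \<open>e / (1 + e)\<close> absorbs the shift \<open>y $ i * p $ j \<le> y $ i\<close>. In a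
    subtriangle \<open>k \<noteq> i\<close> one has \<open>y $ k * p $ i \<le> x $ i\<close> and
    \<open>x $ k \<le> y $ k\<close>, which \<open>e' < p $ i\<close> excludes.\<close>
  define e' where "e' = p $ i * e / (1 + e)"
  have pi: "0 < p $ i" using p by (rule open_simplex_pos)
  have e': "0 < e'" using e(1) pi by (simp add: e'_def)
  have e'_less: "e' < p $ i"
    using e(1) pi by (simp add: e'_def divide_less_eq)
  have "\<not> skeleton (graft f) P x" if x: "0 < x $ i" "\<And>j. j \<noteq> i \<Longrightarrow> x $ i < e' * x $ j" for x
  proof
    assume "skeleton (graft f) P x"
    then consider "on_boundary x" | k y where "x = expand p k y" "skeleton (f k) (shift P k) y"
      unfolding skeleton_graft[OF N] p_def by blast
    then show False
    proof cases
      case 1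
      then obtain l where l: "x $ l = 0" by (auto simp: on_boundary_def)
      then show False using x(1) x(2)[of l] by (cases "l = i") auto
    next
      case (2 k y)
      have y: "0 \<le> y $ l" for l using skeleton_nonneg[OF node.hyps v 2(2)] .
      show False
      proof (cases "k = i")
        case True
        have xi: "x $ i = y $ i * p $ i" using 2(1) True by (simp add: expand_nth)
        then have yi: "0 < y $ i" using x(1) pi by (simp add: zero_less_mult_iff)
        have "y $ i < e * y $ j" if j: "j \<noteq> i" for j
        proof -
          have "y $ i * p $ i < p $ i * e / (1 + e) * (y $ j + y $ i * p $ j)"
            using x(2)[OF j] 2(1) True j xi by (simp add: expand_nth e'_def)
          then have "y $ i * (1 + e) < e * (y $ j + y $ i * p $ j)"
          proof -
            have "p $ i * e / (1 + e) * (y $ j + y $ i * p $ j) = p $ i * (e * (y $ j + y $ i * p $ j) / (1 + e))"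
              by simp
            with \<open>y $ i * p $ i < _\<close> have "p $ i * y $ i < p $ i * (e * (y $ j + y $ i * p $ j) / (1 + e))"
              by (simp only: mult.commute)
            then have "y $ i < e * (y $ j + y $ i * p $ j) / (1 + e)"
              using pi by (simp only: mult_less_cancel_left_pos)
            then show ?thesis using e(1) by (simp add: less_divide_eq)
          qed
          also have "\<dots> \<le> e * (y $ j + y $ i)"
            using yi e(1) open_simplex_less_1[OF p, of j] by (simp add: mult_left_le)
          finally show ?thesis by (simp add: algebra_simps)
        qed
        with e(2)[of y] yi 2(2) True show False by simp
      next
        case False
        have "y $ k * p $ i \<le> x $ i" using 2(1) False y[of i] by (simp add: expand_nth)
        also have "\<dots> < e' * x $ k" using x(2) False by simp
        also have "\<dots> \<le> e' * y $ k"
          using 2(1) e' y[of k] open_simplex_less_1[OF p, of k] by (simp add: expand_nth mult_left_le)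
        also have "\<dots> \<le> p $ i * y $ k" using e'_less y[of k] by (intro mult_right_mono) auto
        finally show False by (simp add: mult.commute)
      qed
    qed
  qed
  then show ?case using e' by blast
qed

text \<open>
  If the root splits \<open>p\<close>, \<open>q\<close> differ, a side of one of the two coded triangulations crosses an edge
  of the other one: it can be read off the order of the ratios \<open>q\<^sub>l / p\<^sub>l\<close>.
\<close>
lemma root_splits_cross:
  assumes f: "\<And>i. finite_tree (f i)" "valid_splits (graft f) P"
    and g: "\<And>i. finite_tree (g i)" "valid_splits (graft g) Q"
    and eq: "\<And>x. skeleton (graft f) P x \<longleftrightarrow> skeleton (graft g) Q x"
    and d: "i \<noteq> j" "j \<noteq> k" "i \<noteq> k"
    and ij: "Q [] $ i / P [] $ i \<le> Q [] $ j / P [] $ j" and jk: "Q [] $ j / P [] $ j < Q [] $ k / P [] $ k"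
  shows False
proof -
  define p q where "p = P []" and "q = Q []"
  have Nf: "[] \<in> f i" and Ng: "[] \<in> g i" for i using f g finite_tree_Nil by blast+
  have p: "p \<in> open_simplex" and vf: "valid_splits (f i) (shift P i)" for i
    using f(2) unfolding valid_splits_graft[OF Nf] p_def by blast+
  have q: "q \<in> open_simplex"
    using g(2) unfolding valid_splits_graft[OF Ng] q_def by blast
  have pos: "0 < p $ l" "0 < q $ l" for l using p q open_simplex_pos by auto
  define r where "r = q $ j / p $ j"
  have r: "0 < r" "r * p $ j = q $ j" using pos[of j] by (auto simp: r_def)
  have ri: "0 \<le> r * p $ i - q $ i"
    using ij pos[of i] unfolding p_def[symmetric] q_def[symmetric] r_def[symmetric] by (simp add: divide_le_eq)
  have rk: "0 < q $ k - r * p $ k"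
    using jk pos[of k] unfolding p_def[symmetric] q_def[symmetric] r_def[symmetric] by (simp add: less_divide_eq)
  obtain e where e: "0 < e"
    "\<And>x. 0 < x $ i \<Longrightarrow> (\<And>l. l \<noteq> i \<Longrightarrow> x $ i < e * x $ l) \<Longrightarrow> \<not> skeleton (f j) (shift P j) x"
    using skeleton_avoids_side[OF f(1) vf] by blast
  define \<delta> where "\<delta> = min (e * r) (e * (q $ k - r * p $ k)) / 2"
  have "0 < min (e * r) (e * (q $ k - r * p $ k))" using e(1) r rk by simp
  then have \<delta>: "0 < \<delta>" "\<delta> < e * r" "\<delta> < e * (q $ k - r * p $ k)" by (auto simp: \<delta>_def)
  \<comment> \<open>\<open>expand q j z\<close> equals \<open>q + s *\<^sub>R axis i 1\<close>, on
    the edge of the second triangulation from \<open>q\<close> to corner \<open>i\<close> (up to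
    scaling). For \<open>\<delta> = 0\<close> this point would lie on the edge from \<open>p\<close>
    to corner \<open>k\<close> of the first one; a small \<open>\<delta> > 0\<close> moves it just
    past that edge into subtriangle \<open>j\<close>, where the first skeleton has no points. In the
    coordinates of that subtriangle it is \<open>y\<close>.\<close>
  define s where "s = r * p $ i - q $ i + \<delta>"
  define z :: "real ^ 3" where "z = axis j 1 + s *\<^sub>R axis i 1"
  define y :: "real ^ 3" where "y = (\<chi> l. if l = i then \<delta> else if l = j then r else q $ k - r * p $ k)"
  have "on_boundary z"
    unfolding on_boundary_def forall_3_distinct[OF d] using d ri \<delta>(1)
    by (auto simp: z_def s_def axis_def intro!: exI[of _ k])
  then have "skeleton (graft g) Q (expand q j z)"
    unfolding skeleton_graft[OF Ng] q_def by (blast intro: skeleton.boundary)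
  moreover have "expand q j z = expand p j y"
    unfolding vec_eq_iff forall_3_distinct[OF d] using d r(2)
    by (simp add: expand_nth z_def y_def axis_def s_def)
  ultimately have "skeleton (graft f) P (expand (P []) j y)" using eq p_def by simp
  moreover have "0 \<le> y $ l" for l using \<delta> r rk by (simp add: y_def)
  ultimately have "skeleton (f j) (shift P j) y" using skeleton_expand_iff[OF f] by blast
  moreover have "\<not> skeleton (f j) (shift P j) y" using \<delta> by (intro e(2)) (auto simp: y_def)
  ultimately show False by blast
qed

lemma sort_three:
  fixes r :: "3 \<Rightarrow> real"
  obtains i j k where "i \<noteq> j" "j \<noteq> k" "i \<noteq> k" "r i \<le> r j" "r j \<le> r k"
proof -
  have d: "(1::3) \<noteq> 2" "(2::3) \<noteq> 3" "(1::3) \<noteq> 3" by simp_all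
  then have d': "(2::3) \<noteq> 1" "(3::3) \<noteq> 2" "(3::3) \<noteq> 1" by metis+
  show ?thesis
    using that[of 1 2 3] that[of 1 3 2] that[of 2 1 3] that[of 2 3 1] that[of 3 1 2] that[of 3 2 1] d d'
    by (metis linear)
qed

text \<open>Order the ratios \<open>q $ l / p $ l\<close>. By \<open>root_splits_cross\<close> the
  middle one cannot be below the largest; exchanging the two triangulations inverts the ratios, so
  it cannot be above the smallest either. All three agree, and both splits sum to one.\<close>

lemma root_splits_unique:
  assumes f: "\<And>i. finite_tree (f i)" "valid_splits (graft f) P"
    and g: "\<And>i. finite_tree (g i)" "valid_splits (graft g) Q"
    and eq: "\<And>x. skeleton (graft f) P x \<longleftrightarrow> skeleton (graft g) Q x"
  shows "P [] = Q []"
proof -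
  define p q where "p = P []" and "q = Q []"
  have Nf: "[] \<in> f i" and Ng: "[] \<in> g i" for i using f g finite_tree_Nil by blast+
  have p: "p \<in> open_simplex" and q: "q \<in> open_simplex"
    using f(2) g(2) unfolding valid_splits_graft[OF Nf] valid_splits_graft[OF Ng] p_def q_def by blast+
  have pos: "0 < p $ l" "0 < q $ l" for l using p q open_simplex_pos by auto
  obtain i j k where d: "i \<noteq> j" "j \<noteq> k" "i \<noteq> k"
    and ij: "q $ i / p $ i \<le> q $ j / p $ j" and jk: "q $ j / p $ j \<le> q $ k / p $ k"
    using sort_three[of "\<lambda>l. q $ l / p $ l"] by blast
  have jk': "q $ j / p $ j = q $ k / p $ k"
    using root_splits_cross[OF f g eq d] ij jk unfolding p_def q_def by (meson less_eq_real_def)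
  have flip: "q $ l / p $ l = inverse (p $ l / q $ l)" for l by simp
  have "p $ k / q $ k = p $ j / q $ j" using jk' unfolding flip by (metis inverse_inverse_eq)
  moreover have "\<not> p $ j / q $ j < p $ i / q $ i"
    using root_splits_cross[OF g f eq[symmetric], of k j i] d calculation unfolding p_def q_def by auto
  then have "q $ j / p $ j \<le> q $ i / p $ i"
    unfolding flip using pos by (intro le_imp_inverse_le) auto
  then have ij': "q $ i / p $ i = q $ j / p $ j" using ij by simp
  define r where "r = q $ j / p $ j"
  have r: "q $ l = r * p $ l" for l
  proof -
    have "q $ l / p $ l = r" using ij' jk' UNIV_3_distinct[OF d] UNIV_I[of l] by (auto simp: r_def)
    then show ?thesis using pos(1)[of l] by (simp add: field_simps)
  qed
  have "1 = r * (\<Sum>l\<in>UNIV. p $ l)" using open_simplex_sum[OF q] unfolding r sum_distrib_left by simp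
  then have "r = 1" using open_simplex_sum[OF p] by simp
  then show ?thesis using r by (simp add: p_def q_def vec_eq_iff)
qed

text \<open>Once the root splits agree, \<open>skeleton_expand_iff\<close> passes the equality of
  skeletons to each branch. That lemma needs nonnegative coordinates, and other points belong to no
  skeleton.\<close>

lemma skeleton_unique:
  assumes "finite_tree t" "valid_splits t P" "finite_tree t'" "valid_splits t' Q"
    and "\<And>x. skeleton t P x \<longleftrightarrow> skeleton t' Q x"
  shows "t = t' \<and> (\<forall>u\<in>internal_nodes t. P u = Q u)"
  using assms
proof (induction t arbitrary: P t' Q rule: finite_tree_induct)
  case leaf
  then have t': "ternary_tree t'" by (simp add: finite_tree_def)
  then show ?case
  proof (cases rule: ternary_tree_cases)
    case (2 g)
    have N: "[] \<in> g i" for i using 2 by (intro Nil_in_ternary_tree)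
    have q: "Q [] \<in> open_simplex" using leaf(3) unfolding 2(1) valid_splits_graft[OF N] by blast
    \<comment> \<open>The root vertex is a corner of its own subtriangle, hence in the skeleton,
      although all its coordinates are positive; the skeleton of a leaf contains no such
      point.\<close>
    have "expand (Q []) 1 (axis 1 1) = Q []"
      by (simp add: expand_def axis_def vec_eq_iff)
    moreover have "on_boundary (axis 1 1)"
      unfolding on_boundary_def by (auto simp: axis_def intro!: exI[of _ 2])
    ultimately have "skeleton t' Q (Q [])"
      unfolding 2(1) skeleton_graft[OF N] by (metis skeleton.boundary)
    then have "on_boundary (Q [])" using leaf(4) skeleton_leaf by blast
    then show ?thesis using open_simplex_pos[OF q] unfolding on_boundary_def by (metis less_irrefl)
  qed simp
next
  case (node f)
  have N: "[] \<in> f i" for i using node.hyps by (rule finite_tree_Nil)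
  have p: "P [] \<in> open_simplex" and vf: "valid_splits (f i) (shift P i)" for i
    using node.prems(1) unfolding valid_splits_graft[OF N] by blast+
  have t': "ternary_tree t'" using node.prems by (simp add: finite_tree_def)
  then show ?case
  proof (cases rule: ternary_tree_cases)
    case 1
    have "expand (P []) 1 (axis 1 1) = P []"
      by (simp add: expand_def axis_def vec_eq_iff)
    moreover have "on_boundary (axis 1 1)"
      unfolding on_boundary_def by (auto simp: axis_def intro!: exI[of _ 2])
    ultimately have "skeleton (graft f) P (P [])"
      unfolding skeleton_graft[OF N] by (metis skeleton.boundary)
    then have "on_boundary (P [])" using node.prems(4) 1 skeleton_leaf by blast
    then show ?thesis using open_simplex_pos[OF p] unfolding on_boundary_def by (metis less_irrefl)
  next
    case (2 g)
    have Ng: "[] \<in> g i" for i using 2 by (intro Nil_in_ternary_tree)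
    have g: "finite_tree (g i)" for i
      using 2 node.prems(2) by (auto simp: finite_tree_def finite_graft)
    have vg: "valid_splits (g i) (shift Q i)" for i
      using node.prems(3) unfolding 2(1) valid_splits_graft[OF Ng] by blast
    have eq: "skeleton (graft f) P x \<longleftrightarrow> skeleton (graft g) Q x" for x
      using node.prems(4) 2 by simp
    have v: "valid_splits (graft f) P" "valid_splits (graft g) Q" using node.prems 2 by auto
    have PQ: "P [] = Q []" by (rule root_splits_unique[OF node.hyps v(1) g v(2) eq])
    have "skeleton (f i) (shift P i) y \<longleftrightarrow> skeleton (g i) (shift Q i) y" for i y
    proof (cases "\<forall>l. 0 \<le> y $ l")
      case True
      then show ?thesis
        using skeleton_expand_iff[OF node.hyps v(1), of y i] skeleton_expand_iff[OF g v(2), of y i] eq PQ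
        by simp
    next
      case False
      then show ?thesis
        using skeleton_nonneg[OF node.hyps vf] skeleton_nonneg[OF g vg] by blast
    qed
    then have *: "f i = g i \<and> (\<forall>u\<in>internal_nodes (f i). P (i # u) = Q (i # u))" for i
      using node.IH[OF vf g vg] by blast
    then have "f = g" by blast
    then show ?thesis unfolding 2(1) internal_nodes_graft[OF N] using * PQ by auto
  qed
qed

section \<open>Uniqueness of the coding of a triangulation\<close>

text \<open>Recursion on the first letter, to match \<open>graft\<close> and induction on trees.
  \<open>corners\<close> recurses on the last letter; \<open>corner_coords_snoc\<close> reconciles
  the two.\<close>

fun corner_coords :: "(word \<Rightarrow> real ^ 3) \<Rightarrow> word \<Rightarrow> 3 \<Rightarrow> real ^ 3" where
  "corner_coords P [] j = axis j 1"
| "corner_coords P (i # u) j = expand (P []) i (corner_coords (shift P i) u j)"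

definition vertex_coords :: "(word \<Rightarrow> real ^ 3) \<Rightarrow> word \<Rightarrow> real ^ 3" where
  "vertex_coords P u = (\<Sum>j\<in>UNIV. (P u $ j) *\<^sub>R corner_coords P u j)"

lemma sum_scaleR_axis: "(\<Sum>j\<in>UNIV. (x $ j) *\<^sub>R axis j 1) = (x :: real ^ 3)"
  by (simp add: vec_eq_iff axis_def if_distrib[of "\<lambda>y. _ * y"] cong: if_cong)

lemma vertex_coords_Nil [simp]: "vertex_coords P [] = P []"
  by (simp add: vertex_coords_def sum_scaleR_axis)

lemma vertex_coords_Cons [simp]: "vertex_coords P (i # u) = expand (P []) i (vertex_coords (shift P i) u)"
  by (simp add: vertex_coords_def linear_sum[OF linear_expand] linear_scale[OF linear_expand])

lemma expand_axis: "expand p i (axis j 1) = (if j = i then p else axis j 1)"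
  by (auto simp: expand_def axis_def vec_eq_iff)

lemma corner_coords_snoc: "corner_coords P (u @ [i]) = (corner_coords P u)(i := vertex_coords P u)"
proof (induction u arbitrary: P)
  case Nil
  show ?case by (rule ext) (simp add: expand_axis)
next
  case (Cons k u)
  show ?case by (rule ext) (simp add: Cons.IH)
qed

lemma linear_barycenter: "linear (\<lambda>x. barycenter x c)"
  by (rule linearI) (simp_all add: barycenter_def scaleR_left_distrib sum.distrib scaleR_sum_right)

lemma barycenter_axis: "barycenter (axis j 1) c = c j"
  by (simp add: barycenter_def axis_def if_distrib[of "\<lambda>y. y *\<^sub>R _"] cong: if_cong)

lemma corners_eq_barycenter: "corners P u = (\<lambda>j. barycenter (corner_coords P u j) base_corner)"
  and vertex_eq_barycenter: "vertex P u = barycenter (vertex_coords P u) base_corner"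
proof -
  have *: "vertex P u = barycenter (vertex_coords P u) base_corner"
    if "corners P u = (\<lambda>j. barycenter (corner_coords P u j) base_corner)" for u
  proof -
    have "vertex P u = (\<Sum>j\<in>UNIV. (P u $ j) *\<^sub>R barycenter (corner_coords P u j) base_corner)"
      unfolding vertex_def that barycenter_def[of "P u"] ..
    then show ?thesis
      by (simp add: vertex_coords_def linear_sum[OF linear_barycenter] linear_scale[OF linear_barycenter])
  qed
  show **: "corners P u = (\<lambda>j. barycenter (corner_coords P u j) base_corner)"
  proof (induction u rule: rev_induct)
    case Nil
    show ?case by (simp add: barycenter_axis)
  next
    case (snoc i u)
    have "corners P (u @ [i]) = (corners P u)(i := vertex P u)" by (simp add: vertex_def)
    also have "\<dots> = (\<lambda>j. barycenter (corner_coords P (u @ [i]) j) base_corner)"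
      using *[OF snoc] snoc by (auto simp: corner_coords_snoc)
    finally show ?case .
  qed
  show "vertex P u = barycenter (vertex_coords P u) base_corner" by (rule *[OF **])
qed

lemma base_corner_coords: "base_corner 1 = 0" "base_corner 2 = 1" "base_corner 3 = Complex (1 / 2) (sqrt 3 / 2)"
  by (simp_all add: base_corner_def cis.ctr cos_60 sin_60)

lemma inj_on_barycenter: "inj_on (\<lambda>x. barycenter x base_corner) {x. (\<Sum>i\<in>UNIV. x $ i) = 1}"
proof (rule inj_onI)
  fix x y :: "real ^ 3"
  assume "x \<in> {x. (\<Sum>i\<in>UNIV. x $ i) = 1}" "y \<in> {x. (\<Sum>i\<in>UNIV. x $ i) = 1}"
  then have s: "x $ 1 + x $ 2 + x $ 3 = 1" "y $ 1 + y $ 2 + y $ 3 = 1" by (auto simp: sum_3)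
  assume "barycenter x base_corner = barycenter y base_corner"
  then have "x $ 2 + x $ 3 / 2 = y $ 2 + y $ 3 / 2" "x $ 3 = y $ 3"
    unfolding barycenter_def sum_3 base_corner_coords by (simp_all add: complex_eq_iff)
  with s show "x = y" by (simp add: vec_eq_iff forall_3)
qed

text \<open>Skeletons are invariant under positive scaling, live in the nonnegative orthant and all
  contain the origin. The plane of coordinate sum one therefore sees everything.\<close>

lemma skeleton_determined_by_slice:
  assumes t: "finite_tree t" "valid_splits t P" and t': "finite_tree t'" "valid_splits t' Q"
    and eq: "\<And>x. (\<Sum>i\<in>UNIV. x $ i) = 1 \<Longrightarrow> skeleton t P x \<longleftrightarrow> skeleton t' Q x"
  shows "skeleton t P x \<longleftrightarrow> skeleton t' Q x"
proof (cases "\<forall>i. 0 \<le> x $ i")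
  case False
  then show ?thesis using skeleton_nonneg[OF t] skeleton_nonneg[OF t'] by blast
next
  case nonneg: True
  define s where "s = (\<Sum>i\<in>UNIV. x $ i)"
  show ?thesis
  proof (cases "s = 0")
    case True
    then have "x $ i = 0" for i
      using nonneg unfolding s_def by (subst (asm) sum_nonneg_eq_0_iff) auto
    then have "on_boundary x" by (simp add: on_boundary_def)
    then show ?thesis by (simp add: skeleton.boundary)
  next
    case False
    have "0 \<le> s" unfolding s_def using nonneg by (intro sum_nonneg) auto
    with False have s: "0 < s" by simp
    have 1: "(\<Sum>i\<in>UNIV. ((1 / s) *\<^sub>R x) $ i) = 1"
      using s by (simp add: s_def[symmetric] sum_divide_distrib[symmetric])
    have x: "x = s *\<^sub>R ((1 / s) *\<^sub>R x)" using s by simp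
    have "skeleton t P x \<longleftrightarrow> skeleton t P ((1 / s) *\<^sub>R x)" for t P
      using skeleton_scale[of t P x "1 / s"] skeleton_scale[of t P "(1 / s) *\<^sub>R x" s] s x by auto
    then show ?thesis using eq[OF 1] by blast
  qed
qed

lemma on_boundary_slice:
  "{x. (\<Sum>i\<in>UNIV. x $ i) = 1 \<and> on_boundary x} =
    closed_segment (axis 1 1) (axis 2 1) \<union> closed_segment (axis 2 1) (axis 3 1) \<union> closed_segment (axis 3 1) (axis 1 1)"
    (is "?L = ?R")
proof
  show "?L \<subseteq> ?R"
  proof
    fix x :: "real ^ 3" assume "x \<in> ?L"
    then have s: "x $ 1 + x $ 2 + x $ 3 = 1" and n: "0 \<le> x $ 1" "0 \<le> x $ 2" "0 \<le> x $ 3"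
      and "x $ 1 = 0 \<or> x $ 2 = 0 \<or> x $ 3 = 0"
      by (auto simp: sum_3 on_boundary_def) (metis exhaust_3)
    then consider "x $ 1 = 0" | "x $ 2 = 0" | "x $ 3 = 0" by blast
    then show "x \<in> ?R"
    proof cases
      case 1
      then have "x = (1 - x $ 3) *\<^sub>R axis 2 1 + (x $ 3) *\<^sub>R axis 3 1"
        using s by (simp add: vec_eq_iff forall_3 axis_def)
      moreover have "x $ 3 \<le> 1" using n s by simp
      ultimately show ?thesis using n unfolding closed_segment_def by blast
    next
      case 2
      then have "x = (1 - x $ 1) *\<^sub>R axis 3 1 + (x $ 1) *\<^sub>R axis 1 1"
        using s by (simp add: vec_eq_iff forall_3 axis_def)
      moreover have "x $ 1 \<le> 1" using n s by simp
      ultimately show ?thesis using n unfolding closed_segment_def by blast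
    next
      case 3
      then have "x = (1 - x $ 2) *\<^sub>R axis 1 1 + (x $ 2) *\<^sub>R axis 2 1"
        using s by (simp add: vec_eq_iff forall_3 axis_def)
      moreover have "x $ 2 \<le> 1" using n s by simp
      ultimately show ?thesis using n unfolding closed_segment_def by blast
    qed
  qed
  show "?R \<subseteq> ?L"
  proof -
    have "on_boundary ((1 - s) *\<^sub>R axis i 1 + s *\<^sub>R axis j 1)"
      "(\<Sum>l\<in>UNIV. ((1 - s) *\<^sub>R axis i 1 + s *\<^sub>R axis j 1 :: real ^ 3) $ l) = 1"
      if "0 \<le> s" "s \<le> 1" "i \<noteq> j" for s i j
    proof -
      obtain k where d: "i \<noteq> j" "j \<noteq> k" "i \<noteq> k" using third_index \<open>i \<noteq> j\<close> by blast
      show "on_boundary ((1 - s) *\<^sub>R axis i 1 + s *\<^sub>R axis j 1)"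
        unfolding on_boundary_def forall_3_distinct[OF d] using d that
        by (auto simp: axis_def intro!: exI[of _ k])
      show "(\<Sum>l\<in>UNIV. ((1 - s) *\<^sub>R axis i 1 + s *\<^sub>R axis j 1 :: real ^ 3) $ l) = 1"
        unfolding sum_3_distinct[OF d] using d by (simp add: axis_def)
    qed
    moreover have "(1::3) \<noteq> 2" "(2::3) \<noteq> 3" "(3::3) \<noteq> 1" by simp_all
    ultimately show ?thesis unfolding closed_segment_def by blast
  qed
qed

lemma sum_corner_coords:
  assumes "finite_tree t" "valid_splits t P" "u \<in> internal_nodes t"
  shows "(\<Sum>l\<in>UNIV. corner_coords P u j $ l) = 1 \<and> vertex_coords P u \<in> open_simplex"
  using assms
proof (induction t arbitrary: P u rule: finite_tree_induct)
  case (node f)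
  have N: "[] \<in> f i" for i using node.hyps by (rule finite_tree_Nil)
  have p: "P [] \<in> open_simplex" and v: "valid_splits (f i) (shift P i)" for i
    using node.prems(1) unfolding valid_splits_graft[OF N] by blast+
  show ?case
  proof (cases u)
    case Nil
    then show ?thesis using p by (simp add: axis_def sum.delta')
  next
    case (Cons i w)
    then have w: "w \<in> internal_nodes (f i)" using node.prems(2) by simp
    have IH: "(\<Sum>l\<in>UNIV. corner_coords (shift P i) w j $ l) = 1" "vertex_coords (shift P i) w \<in> open_simplex"
      using node.IH[OF v w] by auto
    have "0 < expand (P []) i (vertex_coords (shift P i) w) $ l" for l
      using open_simplex_pos[OF IH(2)] open_simplex_pos[OF p] by (simp add: expand_nth add_pos_pos)
    then show ?thesis
      using IH unfolding Cons open_simplex_def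
      by (simp add: sum_expand[OF open_simplex_sum[OF p]])
  qed
qed simp

text \<open>Matches the recursion by subtriangles with the union of edges: a side of a subtriangle
  is either a side of the big triangle or an edge at the root vertex.\<close>

lemma skeleton_slice:
  assumes "finite_tree t" "valid_splits t P"
  shows "{x. (\<Sum>i\<in>UNIV. x $ i) = 1 \<and> skeleton t P x} = {x. (\<Sum>i\<in>UNIV. x $ i) = 1 \<and> on_boundary x} \<union>
    (\<Union>u\<in>internal_nodes t. \<Union>j. closed_segment (corner_coords P u j) (vertex_coords P u))"
  using assms
proof (induction t arbitrary: P rule: finite_tree_induct)
  case leaf
  then show ?case by (simp add: skeleton_leaf)
next
  case (node f)
  have N: "[] \<in> f i" for i using node.hyps by (rule finite_tree_Nil)
  define p where "p = P []"
  have p: "p \<in> open_simplex" and v: "valid_splits (f i) (shift P i)" for i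
    using node.prems(1) unfolding valid_splits_graft[OF N] p_def by blast+
  note psum = open_simplex_sum[OF p]
  define edges where "edges = (\<lambda>t P. \<Union>u\<in>internal_nodes t. \<Union>j. closed_segment (corner_coords P u j) (vertex_coords P u))"
  have IH: "{x. (\<Sum>i\<in>UNIV. x $ i) = 1 \<and> skeleton (f i) (shift P i) x} =
    {x. (\<Sum>i\<in>UNIV. x $ i) = 1 \<and> on_boundary x} \<union> edges (f i) (shift P i)" for i
    using node.IH[OF v] unfolding edges_def .
  have segment: "expand p i ` closed_segment a b = closed_segment (expand p i a) (expand p i b)" for i a b
    by (rule closed_segment_linear_image[OF linear_expand, symmetric])
  have edges: "edges (graft f) P = (\<Union>j. closed_segment (axis j 1) p) \<union> (\<Union>i. expand p i ` edges (f i) (shift P i))"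
  proof -
    have "edges (graft f) P = (\<Union>j. closed_segment (corner_coords P [] j) (vertex_coords P [])) \<union>
      (\<Union>i. \<Union>w\<in>internal_nodes (f i). \<Union>j. closed_segment (corner_coords P (i # w) j) (vertex_coords P (i # w)))"
      unfolding edges_def internal_nodes_graft[OF N] by blast
    then show ?thesis
      by (simp only: corner_coords.simps vertex_coords_Nil vertex_coords_Cons p_def[symmetric] edges_def
          image_UN segment)
  qed
  \<comment> \<open>The coordinate that vanishes is some \<open>l \<noteq> i\<close>, so
    \<open>y\<close> is on the side joining slot \<open>i\<close>, occupied by \<open>p\<close>, to
    the third corner \<open>m\<close>.\<close>
  have root: "x \<in> (\<Union>j. closed_segment (axis j 1) p)" if
    x: "x = expand p i y" and bd: "on_boundary y" and sum: "(\<Sum>l\<in>UNIV. y $ l) = 1" and i: "y $ i \<noteq> 0" for x y i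
  proof -
    obtain l where l: "y $ l = 0" using bd by (auto simp: on_boundary_def)
    with i have "i \<noteq> l" by auto
    from third_index[OF this] obtain m where d: "i \<noteq> l" "l \<noteq> m" "i \<noteq> m" by blast
    have s: "y $ i + y $ m = 1" using sum l unfolding sum_3_distinct[OF d] by simp
    have n: "0 \<le> y $ i" "0 \<le> y $ m" using bd by (auto simp: on_boundary_def)
    have ym: "y $ m = 1 - y $ i" using s by simp
    have "x = (1 - y $ i) *\<^sub>R axis m 1 + (y $ i) *\<^sub>R p"
      unfolding x vec_eq_iff forall_3_distinct[OF d] using d l ym
      by (simp add: expand_nth axis_def)
    then show ?thesis using n s unfolding closed_segment_def by fastforce
  qed
  \<comment> \<open>Conversely the edge from corner \<open>m\<close> to \<open>p\<close> is a side
    of subtriangle \<open>i\<close> for any \<open>i \<noteq> m\<close>.\<close>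
  have root': "\<exists>i y. x = expand p i y \<and> on_boundary y" if x: "x \<in> closed_segment (axis m 1) p" for x m
  proof -
    obtain i l where d: "m \<noteq> i" "i \<noteq> l" "m \<noteq> l" by (rule two_other_indices)
    obtain s where s: "0 \<le> s" "s \<le> 1" "x = (1 - s) *\<^sub>R axis m 1 + s *\<^sub>R p"
      using x by (auto simp: closed_segment_def)
    define y :: "real ^ 3" where "y = (1 - s) *\<^sub>R axis m 1 + s *\<^sub>R axis i 1"
    have "x = expand p i y"
      unfolding s(3) y_def using d(1) linear_expand[of p i]
      by (simp add: linear_add linear_scale expand_axis)
    moreover have "on_boundary y"
      unfolding on_boundary_def forall_3_distinct[OF d] using d s
      by (auto simp: y_def axis_def intro!: exI[of _ l])
    ultimately show ?thesis by blast
  qed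
  have "{x. (\<Sum>i\<in>UNIV. x $ i) = 1 \<and> skeleton (graft f) P x} =
    {x. (\<Sum>i\<in>UNIV. x $ i) = 1 \<and> on_boundary x} \<union> edges (graft f) P"
  proof (intro subset_antisym subsetI)
    fix x assume "x \<in> {x. (\<Sum>i\<in>UNIV. x $ i) = 1 \<and> skeleton (graft f) P x}"
    then have x: "(\<Sum>i\<in>UNIV. x $ i) = 1" "skeleton (graft f) P x" by auto
    then consider "on_boundary x" | i y where "x = expand p i y" "skeleton (f i) (shift P i) y"
      unfolding skeleton_graft[OF N] p_def by blast
    then show "x \<in> {x. (\<Sum>i\<in>UNIV. x $ i) = 1 \<and> on_boundary x} \<union> edges (graft f) P"
    proof cases
      case (2 i y)
      have ys: "(\<Sum>l\<in>UNIV. y $ l) = 1" using x(1) unfolding 2(1) sum_expand[OF psum] .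
      with 2 consider "on_boundary y" | "y \<in> edges (f i) (shift P i)" using IH by blast
      then show ?thesis
      proof cases
        case 1
        show ?thesis
        proof (cases "y $ i = 0")
          case True
          then have "x = y" using 2(1) by (simp add: expand_def)
          then show ?thesis using 1 x by simp
        next
          case False
          from root[OF 2(1) 1 ys this] show ?thesis unfolding edges by blast
        qed
      next
        case e: 2
        then show ?thesis unfolding edges 2(1) by blast
      qed
    qed (use x in simp)
  next
    fix x assume "x \<in> {x. (\<Sum>i\<in>UNIV. x $ i) = 1 \<and> on_boundary x} \<union> edges (graft f) P"
    then consider "(\<Sum>i\<in>UNIV. x $ i) = 1" "on_boundary x" | m where "x \<in> closed_segment (axis m 1) p"
      | i y where "x = expand p i y" "y \<in> edges (f i) (shift P i)"
      unfolding edges by blast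
    then show "x \<in> {x. (\<Sum>i\<in>UNIV. x $ i) = 1 \<and> skeleton (graft f) P x}"
    proof cases
      case 1
      then show ?thesis by (simp add: skeleton.boundary)
    next
      case (2 m)
      obtain s where s: "x = (1 - s) *\<^sub>R axis m 1 + s *\<^sub>R p" using 2 by (auto simp: closed_segment_def)
      have "(\<Sum>i\<in>UNIV. x $ i) = 1"
        unfolding s by (simp add: sum.distrib sum_distrib_left[symmetric] psum axis_def)
      moreover have "skeleton (graft f) P x"
        unfolding skeleton_graft[OF N] p_def[symmetric] using root'[OF 2] by (blast intro: skeleton.boundary)
      ultimately show ?thesis by simp
    next
      case (3 i y)
      then have "(\<Sum>l\<in>UNIV. y $ l) = 1" "skeleton (f i) (shift P i) y" using IH by blast+
      then show ?thesis
        using 3(1) unfolding skeleton_graft[OF N] p_def[symmetric] by (auto simp: sum_expand[OF psum])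
    qed
  qed
  then show ?case unfolding edges_def .
qed

lemma triangulation_eq_skeleton:
  assumes "finite_tree t" "valid_splits t P"
  shows "triangulation t P =
    (\<lambda>x. barycenter x base_corner) ` {x. (\<Sum>i\<in>UNIV. x $ i) = 1 \<and> skeleton t P x}"
proof -
  have seg: "(\<lambda>x. barycenter x base_corner) ` closed_segment a b =
      closed_segment (barycenter a base_corner) (barycenter b base_corner)" for a b
    by (rule closed_segment_linear_image[OF linear_barycenter, symmetric])
  show ?thesis
    unfolding skeleton_slice[OF assms] on_boundary_slice triangulation_def triangle_boundary_def
    by (simp add: image_Un image_UN seg barycenter_axis corners_eq_barycenter vertex_eq_barycenter)
qed

text \<open>Makes \<open>internal_vertices\<close>, which ranges over all codings of a set,
  computable from any one coding. The equality of planar sets lifts to skeletons because barycentric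
  coordinates of sum one are unique.\<close>

lemma triangulation_coding_unique:
  assumes t: "finite_tree t" "valid_splits t P" and t': "finite_tree t'" "valid_splits t' Q"
    and eq: "triangulation t P = triangulation t' Q"
  shows "t = t' \<and> (\<forall>u\<in>internal_nodes t. P u = Q u)"
proof (rule skeleton_unique[OF t t'])
  have "{x. (\<Sum>i\<in>UNIV. x $ i) = 1 \<and> skeleton t P x} = {x. (\<Sum>i\<in>UNIV. x $ i) = 1 \<and> skeleton t' Q x}"
    using eq unfolding triangulation_eq_skeleton[OF t] triangulation_eq_skeleton[OF t']
    by (rule inj_on_image_eq_iff[OF inj_on_barycenter, THEN iffD1, rotated 2]) auto
  from this[unfolded set_eq_iff mem_Collect_eq]
  have "skeleton t P x \<longleftrightarrow> skeleton t' Q x" if "(\<Sum>i\<in>UNIV. x $ i) = 1" for x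
    using that by blast
  then show "skeleton t P x \<longleftrightarrow> skeleton t' Q x" for x
    by (rule skeleton_determined_by_slice[OF t t'])
qed

lemma corners_cong:
  assumes "\<And>w v. u = w @ v \<Longrightarrow> v \<noteq> [] \<Longrightarrow> P w = Q w"
  shows "corners P u = corners Q u"
  using assms
proof (induction u rule: rev_induct)
  case (snoc i u)
  have "corners P u = corners Q u" using snoc.prems by (intro snoc.IH) auto
  moreover have "P u = Q u" using snoc.prems[of u "[i]"] by simp
  ultimately show ?case by simp
qed simp

lemma prefix_in_internal_nodes:
  assumes "ternary_tree t" "w @ v \<in> internal_nodes t"
  shows "w \<in> internal_nodes t"
proof (cases v)
  case (Cons i v')
  have "w \<in> t" "w @ [i] \<in> t"
    using assms prefix_in_ternary_tree[OF assms(1), of w v] prefix_in_ternary_tree[OF assms(1), of "w @ [i]" v'] Cons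
    by (auto simp: internal_nodes_def)
  then show ?thesis using assms(1) unfolding ternary_tree_def internal_nodes_def by blast
qed (use assms in simp)

lemma vertex_cong_internal_nodes:
  assumes "ternary_tree t" "u \<in> internal_nodes t" "\<forall>w\<in>internal_nodes t. P w = Q w"
  shows "vertex P u = vertex Q u"
proof -
  have "corners P u = corners Q u"
    using assms prefix_in_internal_nodes[OF assms(1)] by (intro corners_cong) auto
  then show ?thesis using assms by (simp add: vertex_def)
qed

lemma internal_vertices_triangulation:
  assumes "finite_tree t" "valid_splits t P"
  shows "internal_vertices (triangulation t P) = vertex P ` internal_nodes t"
proof
  show "vertex P ` internal_nodes t \<subseteq> internal_vertices (triangulation t P)"
    using assms unfolding internal_vertices_def finite_tree_def valid_splits_def by blast
  show "internal_vertices (triangulation t P) \<subseteq> vertex P ` internal_nodes t"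
  proof
    fix x assume "x \<in> internal_vertices (triangulation t P)"
    then obtain t' Q u where *: "finite_tree t'" "valid_splits t' Q" "triangulation t P = triangulation t' Q"
      "u \<in> internal_nodes t'" "x = vertex Q u"
      unfolding internal_vertices_def finite_tree_def valid_splits_def by blast
    from triangulation_coding_unique[OF assms *(1,2,3)] have u: "u \<in> internal_nodes t"
      and "\<forall>w\<in>internal_nodes t. P w = Q w" using *(4) by auto
    then have "vertex P u = vertex Q u"
      using assms(1) by (intro vertex_cong_internal_nodes) (auto simp: finite_tree_def)
    then show "x \<in> vertex P ` internal_nodes t" using imageI[OF u, of "vertex P"] *(5) by auto
  qed
qed

text \<open>Ensures that \<open>n\<close> internal nodes give \<open>n\<close> different points, so
  that \<open>occupation_measure n\<close> has total mass one. Vertices are interior to their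
  subtriangles, and interiors of different subtriangles are disjoint by
  \<open>expand_collision\<close>.\<close>

lemma inj_on_vertex_coords:
  assumes "finite_tree t" "valid_splits t P"
  shows "inj_on (vertex_coords P) (internal_nodes t)"
  using assms
proof (induction t arbitrary: P rule: finite_tree_induct)
  case (node f)
  have N: "[] \<in> f i" for i using node.hyps by (rule finite_tree_Nil)
  define p where "p = P []"
  have p: "p \<in> open_simplex" and v: "valid_splits (f i) (shift P i)" for i
    using node.prems(1) unfolding valid_splits_graft[OF N] p_def by blast+
  have pos: "0 < vertex_coords (shift P i) w $ l" if "w \<in> internal_nodes (f i)" for i w l
    using sum_corner_coords[OF node.hyps v that] open_simplex_pos by blast
  \<comment> \<open>Coordinate \<open>i\<close> forces \<open>y $ i = 1\<close>, and then any other
    coordinate forces \<open>y $ j = 0\<close>.\<close>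
  have root: "p \<noteq> expand p i y" if "\<And>l. 0 < y $ l" for i y
  proof
    assume eq: "p = expand p i y"
    obtain j where j: "i \<noteq> j" using two_other_indices[of i] by blast
    have "p $ i = y $ i * p $ i" "p $ j = y $ j + y $ i * p $ j"
      using arg_cong[OF eq, of "\<lambda>x. x $ i"] arg_cong[OF eq, of "\<lambda>x. x $ j"] j by (simp_all add: expand_nth)
    then show False using open_simplex_pos[OF p, of i] that[of j] by simp
  qed
  show ?case
  proof (rule inj_onI)
    fix u u' assume u: "u \<in> internal_nodes (graft f)" and u': "u' \<in> internal_nodes (graft f)"
      and eq: "vertex_coords P u = vertex_coords P u'"
    show "u = u'"
    proof (cases u)
      case Nil
      show ?thesis
      proof (cases u')
        case (Cons i w)
        then show ?thesis using root[OF pos, of w i i] eq Nil u' by (simp add: p_def)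
      qed (use Nil in simp)
    next
      case u_eq: (Cons i w)
      show ?thesis
      proof (cases u')
        case Nil
        then show ?thesis using root[OF pos, of w i i] eq u u_eq by (simp add: p_def)
      next
        case u'_eq: (Cons j w')
        have w: "w \<in> internal_nodes (f i)" "w' \<in> internal_nodes (f j)" using u u' u_eq u'_eq by auto
        have e: "expand p i (vertex_coords (shift P i) w) = expand p j (vertex_coords (shift P j) w')"
          using eq u_eq u'_eq by (simp add: p_def)
        have "i = j"
        proof (rule ccontr)
          assume "i \<noteq> j"
          from expand_collision(1)[OF p _ _ e this] pos[OF w(1), of j] show False
            using less_imp_le[OF pos[OF w(1)]] less_imp_le[OF pos[OF w(2)]] by simp
        qed
        then show ?thesis
          using e w node.IH[OF v] u_eq u'_eq unfolding expand_inject[OF p] by (auto simp: inj_on_def expand_inject[OF p])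
      qed
    qed
  qed
qed simp

lemma inj_on_vertex:
  assumes "finite_tree t" "valid_splits t P"
  shows "inj_on (vertex P) (internal_nodes t)"
proof (rule inj_onI)
  fix u u' assume u: "u \<in> internal_nodes t" "u' \<in> internal_nodes t" and eq: "vertex P u = vertex P u'"
  have "vertex_coords P u = vertex_coords P u'"
    using sum_corner_coords[OF assms u(1)] sum_corner_coords[OF assms u(2)] eq open_simplex_sum
    unfolding vertex_eq_barycenter by (intro inj_onD[OF inj_on_barycenter]) auto
  then show "u = u'" using inj_onD[OF inj_on_vertex_coords[OF assms]] u by blast
qed

section \<open>Convex sets that contain the corners of a triangle\<close>

lemma barycenter_in_convex:
  assumes "p \<in> open_simplex" "convex S" "\<And>i. c i \<in> S"
  shows "barycenter p c \<in> S"
  unfolding barycenter_def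
  by (rule convex_sum[OF finite_class.finite_UNIV assms(2) open_simplex_sum[OF assms(1)]])
     (simp_all add: assms(3) less_imp_le[OF open_simplex_pos[OF assms(1)]])

lemma corners_append_in_convex:
  assumes "\<And>w. P w \<in> open_simplex" "convex S" "\<And>i. corners P v i \<in> S"
  shows "corners P (v @ w) i \<in> S"
proof (induction w arbitrary: i rule: rev_induct)
  case (snoc j w)
  then show ?case
    using barycenter_in_convex[OF assms(1,2), of "corners P (v @ w)" "v @ w"]
    unfolding append_assoc[symmetric] corners.simps by simp
qed (use assms in simp)

lemma vertex_append_in_convex:
  assumes "\<And>w. P w \<in> open_simplex" "convex S" "\<And>i. corners P v i \<in> S"
  shows "vertex P (v @ w) \<in> S"
  unfolding vertex_def
  by (intro barycenter_in_convex corners_append_in_convex assms)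

lemma corners_in_filled_triangle:
  assumes "\<And>w. P w \<in> open_simplex"
  shows "corners P u i \<in> filled_triangle"
  using corners_append_in_convex[where v = "[]" and S = filled_triangle, OF assms]
  by (simp add: filled_triangle_def convex_convex_hull hull_inc)

lemma vertex_in_filled_triangle:
  assumes "\<And>w. P w \<in> open_simplex"
  shows "vertex P u \<in> filled_triangle"
  unfolding vertex_def
  by (intro barycenter_in_convex assms corners_in_filled_triangle) (simp add: filled_triangle_def convex_convex_hull)

section \<open>Continuity in the splits and measurability of codings\<close>

lemma space_borel_of: "space (borel_of X) = topspace X"
  by (simp add: borel_of_def space_measure_of_conv)

lemma sets_borel_of: "sets (borel_of X) = sigma_sets (topspace X) {W. openin X W}"
  unfolding borel_of_def by (intro sets_measure_of) (auto dest: openin_subset)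

lemma openin_in_sets_borel_of: "openin X W \<Longrightarrow> W \<in> sets (borel_of X)"
  unfolding sets_borel_of by (auto intro: sigma_sets.Basic)

lemma closedin_in_sets_borel_of:
  assumes "closedin X C"
  shows "C \<in> sets (borel_of X)"
proof -
  have "topspace X - C \<in> sets (borel_of X)" using assms by (intro openin_in_sets_borel_of) (simp add: closedin_def)
  then have "space (borel_of X) - (topspace X - C) \<in> sets (borel_of X)" by (rule sets.compl_sets)
  moreover have "C \<subseteq> topspace X" using assms by (rule closedin_subset)
  then have "space (borel_of X) - (topspace X - C) = C" by (auto simp: space_borel_of)
  ultimately show ?thesis by simp
qed

lemma measurable_borel_of_I:
  assumes "f \<in> space M \<rightarrow> topspace X" "\<And>W. openin X W \<Longrightarrow> f -` W \<inter> space M \<in> sets M"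
  shows "f \<in> M \<rightarrow>\<^sub>M borel_of X"
  unfolding borel_of_def using assms by (intro measurable_measure_of) (auto dest: openin_subset)

lemma continuous_map_measurable_borel_of:
  assumes "continuous_map X Y f"
  shows "f \<in> borel_of X \<rightarrow>\<^sub>M borel_of Y"
proof (rule measurable_borel_of_I)
  show "f \<in> space (borel_of X) \<rightarrow> topspace Y" using assms by (auto simp: space_borel_of continuous_map_def)
  show "f -` W \<inter> space (borel_of X) \<in> sets (borel_of X)" if "openin Y W" for W
    using openin_continuous_map_preimage[OF assms that]
    by (intro openin_in_sets_borel_of) (simp add: space_borel_of vimage_def Int_def conj_commute)
qed

lemma continuous_map_measurable_restrict_space:
  assumes "continuous_map (top_of_set S) X g"
  shows "g \<in> restrict_space borel S \<rightarrow>\<^sub>M borel_of X"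
proof (rule measurable_borel_of_I)
  show "g \<in> space (restrict_space borel S) \<rightarrow> topspace X"
    using assms by (auto simp: space_restrict_space continuous_map_def)
  fix W assume "openin X W"
  from openin_continuous_map_preimage[OF assms this]
  obtain O' where O': "open O'" "{x \<in> S. g x \<in> W} = S \<inter> O'" by (auto simp: openin_open)
  then have "g -` W \<inter> space (restrict_space borel S) = S \<inter> O'" by (auto simp: space_restrict_space)
  then show "g -` W \<inter> space (restrict_space borel S) \<in> sets (restrict_space borel S)"
    using O'(1) by (auto simp: sets_restrict_space)
qed

section \<open>Continuous dependence of the triangulation on the splits\<close>

definition splits :: "(word \<Rightarrow> real ^ 3) set" where
  "splits = {P. \<forall>u. P u \<in> open_simplex}"

lemma splits_valid: "P \<in> splits \<Longrightarrow> valid_splits t P"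
  by (simp add: splits_def valid_splits_def)

lemma continuous_on_corners: "continuous_on UNIV (\<lambda>P. corners P u i)"
  and continuous_on_vertex: "continuous_on UNIV (\<lambda>P. vertex P u)"
proof -
  have *: "continuous_on UNIV (\<lambda>P. vertex P u)" if "\<And>i. continuous_on UNIV (\<lambda>P. corners P u i)" for u
    unfolding vertex_def barycenter_def by (intro continuous_intros that) simp
  show **: "continuous_on UNIV (\<lambda>P. corners P u i)" for u i
  proof (induction u arbitrary: i rule: rev_induct)
    case (snoc j u)
    then show ?case using *[of u] by (cases "i = j") (simp_all add: vertex_def)
  qed simp
  show "continuous_on UNIV (\<lambda>P. vertex P u)" by (rule *[OF **])
qed

lemma infdist_closed_segment_le:
  fixes a :: "'b::real_normed_vector"
  assumes "x \<in> closed_segment a b" "dist a a' \<le> r" "dist b b' \<le> r"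
  shows "infdist x (closed_segment a' b') \<le> r"
proof -
  obtain s where s: "0 \<le> s" "s \<le> 1" "x = (1 - s) *\<^sub>R a + s *\<^sub>R b" using assms(1) by (auto simp: closed_segment_def)
  define y where "y = (1 - s) *\<^sub>R a' + s *\<^sub>R b'"
  have "x - y = (1 - s) *\<^sub>R (a - a') + s *\<^sub>R (b - b')" by (simp add: s y_def algebra_simps)
  then have "norm (x - y) \<le> (1 - s) * norm (a - a') + s * norm (b - b')"
    using s norm_triangle_ineq[of "(1 - s) *\<^sub>R (a - a')" "s *\<^sub>R (b - b')"] by simp
  also have "\<dots> \<le> (1 - s) * r + s * r"
    using assms s by (intro add_mono mult_left_mono) (auto simp: dist_norm)
  finally have "dist x y \<le> r" by (simp add: dist_norm algebra_simps)
  moreover have "y \<in> closed_segment a' b'" using s by (auto simp: y_def closed_segment_def)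
  ultimately show ?thesis using infdist_le[of y "closed_segment a' b'" x] by linarith
qed

lemma compact_triangulation: "finite t \<Longrightarrow> compact (triangulation t P)"
  unfolding triangulation_def triangle_boundary_def
  by (intro compact_Un compact_UN compact_segment) (auto simp: internal_nodes_def)

lemma triangulation_nonempty: "triangulation t P \<noteq> {}"
  by (simp add: triangulation_def triangle_boundary_def)

lemma infdist_triangulation_le:
  assumes "finite t" "0 \<le> r"
    and "\<And>u i. u \<in> internal_nodes t \<Longrightarrow> dist (corners P u i) (corners Q u i) \<le> r"
    and "\<And>u. u \<in> internal_nodes t \<Longrightarrow> dist (vertex P u) (vertex Q u) \<le> r"
    and "x \<in> triangulation t P"
  shows "infdist x (triangulation t Q) \<le> r"
proof -
  from assms(5) consider "x \<in> triangle_boundary" |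
      u i where "u \<in> internal_nodes t" "x \<in> closed_segment (corners P u i) (vertex P u)"
    unfolding triangulation_def by blast
  then show ?thesis
  proof cases
    case 1
    then have "x \<in> triangulation t Q" by (simp add: triangulation_def)
    then show ?thesis using assms(2) by simp
  next
    case (2 u i)
    have "closed_segment (corners Q u i) (vertex Q u) \<subseteq> triangulation t Q"
      using 2(1) unfolding triangulation_def by blast
    then have "infdist x (triangulation t Q) \<le> infdist x (closed_segment (corners Q u i) (vertex Q u))"
      by (intro infdist_mono) auto
    also have "\<dots> \<le> r" using infdist_closed_segment_le[OF 2(2)] assms(3,4) 2(1) by blast
    finally show ?thesis .
  qed
qed

text \<open>A segment moves no farther than its end points, and a finite tree involves finitely many
  of these. Each depends continuously on \<open>P\<close> in the product topology, so finitely many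
  open conditions suffice.\<close>

lemma continuous_map_triangulation:
  assumes "finite t"
  shows "continuous_map euclidean hausdorff_topology (triangulation t)"
  unfolding hausdorff_topology_def Metric_space.continuous_map_to_metric[OF Metric_space_hausdorff_dist]
proof (intro ballI allI impI)
  fix P :: "word \<Rightarrow> real ^ 3" and \<epsilon> :: real assume "0 < \<epsilon>"
  let ?I = "internal_nodes t"
  have fin: "finite ?I" using assms by (simp add: internal_nodes_def)
  \<comment> \<open>Half of \<epsilon>, because \<open>hausdorff_dist_le\<close> gives only a weak
    inequality while the target ball is open.\<close>
  define A where "A = (\<Inter>u\<in>?I. (\<Inter>i. {Q. dist (corners P u i) (corners Q u i) < \<epsilon> / 2}) \<inter> {Q. dist (vertex P u) (vertex Q u) < \<epsilon> / 2})"
  have "open {Q. dist (corners P u i) (corners Q u i) < \<epsilon> / 2}" for u i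
    by (intro open_Collect_less continuous_intros continuous_on_corners)
  moreover have "open {Q. dist (vertex P u) (vertex Q u) < \<epsilon> / 2}" for u
    by (intro open_Collect_less continuous_intros continuous_on_vertex)
  ultimately have "open A"
    unfolding A_def by (intro open_INT open_Int fin ballI finite_class.finite_UNIV)
  moreover have "P \<in> A" using \<open>0 < \<epsilon>\<close> by (simp add: A_def)
  moreover have "triangulation t Q \<in> Metric_space.mball {K. compact K \<and> K \<noteq> {}} hausdorff_dist (triangulation t P) \<epsilon>"
    if "Q \<in> A" for Q
  proof -
    have c: "dist (corners P u i) (corners Q u i) \<le> \<epsilon> / 2" and v: "dist (vertex P u) (vertex Q u) \<le> \<epsilon> / 2"
      if "u \<in> ?I" for u i
      using \<open>Q \<in> A\<close> that unfolding A_def by (auto intro: less_imp_le)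
    have "hausdorff_dist (triangulation t P) (triangulation t Q) \<le> \<epsilon> / 2"
    proof (rule hausdorff_dist_le)
      show "infdist x (triangulation t Q) \<le> \<epsilon> / 2" if "x \<in> triangulation t P" for x
        using \<open>0 < \<epsilon>\<close> by (intro infdist_triangulation_le[OF assms _ c v that]) auto
      show "infdist x (triangulation t P) \<le> \<epsilon> / 2" if "x \<in> triangulation t Q" for x
        using \<open>0 < \<epsilon>\<close> c v by (intro infdist_triangulation_le[OF assms _ _ _ that]) (auto simp: dist_commute)
    qed (auto simp: compact_triangulation assms triangulation_nonempty)
    then show ?thesis
      using \<open>0 < \<epsilon>\<close> compact_triangulation[OF assms] triangulation_nonempty
      by (auto simp: Metric_space.in_mball[OF Metric_space_hausdorff_dist])
  qed
  ultimately show "\<exists>U. openin euclidean U \<and> P \<in> U \<and>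
      (\<forall>Q\<in>U. triangulation t Q \<in> Metric_space.mball {K. compact K \<and> K \<noteq> {}} hausdorff_dist (triangulation t P) \<epsilon>)"
    by (intro exI[of _ A]) auto
qed

lemma triangulation_cong:
  assumes "ternary_tree t" "\<forall>u\<in>internal_nodes t. P u = Q u"
  shows "triangulation t P = triangulation t Q"
proof -
  have "corners P u = corners Q u" "vertex P u = vertex Q u" if "u \<in> internal_nodes t" for u
    using assms prefix_in_internal_nodes[OF assms(1)] that
    by (auto intro!: corners_cong vertex_cong_internal_nodes)
  then show ?thesis unfolding triangulation_def by simp
qed

section \<open>Compact boxes of codes\<close>

definition uniform_point :: "real ^ 3" where
  "uniform_point = (\<chi> i. 1 / 3)"

lemma uniform_point: "uniform_point \<in> open_simplex"
  by (simp add: uniform_point_def open_simplex_def)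

text \<open>A compact exhaustion of the open simplex.\<close>

definition simplex_core :: "nat \<Rightarrow> (real ^ 3) set" where
  "simplex_core j = {x. (\<forall>i. inverse (real (Suc j)) \<le> x $ i) \<and> (\<Sum>i\<in>UNIV. x $ i) = 1}"

lemma simplex_core_subset: "simplex_core j \<subseteq> open_simplex"
proof
  fix x assume x: "x \<in> simplex_core j"
  have "0 < inverse (real (Suc j))" by simp
  then have "0 < x $ i" for i using x unfolding simplex_core_def by (blast intro: less_le_trans)
  then show "x \<in> open_simplex" using x by (simp add: simplex_core_def open_simplex_def)
qed

lemma compact_simplex_core: "compact (simplex_core j)"
proof -
  have "simplex_core j \<subseteq> cbox 0 1"
    using simplex_core_subset open_simplex_pos open_simplex_less_1
    by (auto simp: mem_box_cart less_imp_le subset_eq)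
  then have "bounded (simplex_core j)" using bounded_cbox bounded_subset by blast
  moreover have "closed (simplex_core j)"
    unfolding simplex_core_def
    by (intro closed_Collect_conj closed_Collect_all closed_Collect_le closed_Collect_eq continuous_intros)
  ultimately show ?thesis by (simp add: compact_eq_bounded_closed)
qed

lemma eventually_simplex_core:
  assumes "x \<in> open_simplex"
  shows "\<forall>\<^sub>F j in sequentially. x \<in> simplex_core j"
proof -
  have "\<forall>\<^sub>F j in sequentially. inverse (real (Suc j)) < x $ i" for i
    using LIMSEQ_inverse_real_of_nat open_simplex_pos[OF assms] by (rule order_tendstoD)
  then have "\<forall>\<^sub>F j in sequentially. \<forall>i. inverse (real (Suc j)) < x $ i"
    by (intro eventually_all_finite) auto
  then show ?thesis
    by eventually_elim (use assms in \<open>auto simp: simplex_core_def open_simplex_sum intro: less_imp_le\<close>)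
qed

text \<open>Splits away from the internal nodes do not affect the triangulation. Freezing them at
  one point makes the box a product of compact sets.\<close>

definition code_box :: "word set \<Rightarrow> nat \<Rightarrow> (word \<Rightarrow> real ^ 3) set" where
  "code_box t j = {P. \<forall>u. if u \<in> internal_nodes t then P u \<in> simplex_core j else P u = uniform_point}"

lemma code_box_subset: "code_box t j \<subseteq> splits"
proof
  fix P assume "P \<in> code_box t j"
  then have "P u \<in> open_simplex" for u
    using simplex_core_subset[of j] uniform_point by (cases "u \<in> internal_nodes t") (auto simp: code_box_def)
  then show "P \<in> splits" by (simp add: splits_def)
qed

lemma compact_code_box: "compact (code_box t j)"
proof -
  have "code_box t j = PiE UNIV (\<lambda>u. if u \<in> internal_nodes t then simplex_core j else {uniform_point})"
    unfolding code_box_def PiE_UNIV_domain Pi_def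
    by (intro Collect_cong all_cong) auto
  moreover have "compactin (product_topology (\<lambda>i. euclidean) UNIV)
      (PiE UNIV (\<lambda>u. if u \<in> internal_nodes t then simplex_core j else {uniform_point}))"
    unfolding compactin_PiE by (auto simp: compact_simplex_core)
  ultimately show ?thesis unfolding euclidean_product_topology by simp
qed

lemma triangulation_in_code_box:
  assumes "finite_tree t" "valid_splits t P"
  obtains j Q where "Q \<in> code_box t j" "triangulation t Q = triangulation t P"
proof -
  define Q where "Q = (\<lambda>u. if u \<in> internal_nodes t then P u else uniform_point)"
  have "\<forall>\<^sub>F j in sequentially. \<forall>u\<in>internal_nodes t. P u \<in> simplex_core j"
    using assms by (intro eventually_ball_finite finite_internal_nodes ballI eventually_simplex_core)
      (auto simp: valid_splits_def)
  then obtain j where "\<forall>u\<in>internal_nodes t. P u \<in> simplex_core j"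
    unfolding eventually_sequentially by blast
  then have "Q \<in> code_box t j" by (simp add: Q_def code_box_def)
  moreover have "triangulation t Q = triangulation t P"
    using assms by (intro triangulation_cong) (auto simp: Q_def finite_tree_def)
  ultimately show ?thesis using that by blast
qed

lemma compact_triangulations_iff:
  "m \<in> compact_triangulations n \<longleftrightarrow> (\<exists>t\<in>ternary_trees n. \<exists>j. m \<in> triangulation t ` code_box t j)"
proof
  assume "m \<in> compact_triangulations n"
  then obtain t P where *: "m = triangulation t P" "t \<in> ternary_trees n" "valid_splits t P"
    unfolding compact_triangulations_def valid_splits_def by blast
  have "finite_tree t" using *(2) by (simp add: mem_ternary_trees)
  from triangulation_in_code_box[OF this *(3)]
  obtain j Q where "Q \<in> code_box t j" "triangulation t Q = triangulation t P" by blast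
  then show "\<exists>t\<in>ternary_trees n. \<exists>j. m \<in> triangulation t ` code_box t j"
    using * by (metis imageI)
next
  assume "\<exists>t\<in>ternary_trees n. \<exists>j. m \<in> triangulation t ` code_box t j"
  then show "m \<in> compact_triangulations n"
    using code_box_subset unfolding compact_triangulations_def splits_def by blast
qed

lemma triangulation_in_compact_triangulations:
  "t \<in> ternary_trees n \<Longrightarrow> P \<in> splits \<Longrightarrow> triangulation t P \<in> compact_triangulations n"
  unfolding compact_triangulations_def splits_def by blast

lemma topspace_hausdorff: "topspace hausdorff_topology = {K :: complex set. compact K \<and> K \<noteq> {}}"
  unfolding hausdorff_topology_def by (rule Metric_space.topspace_mtopology[OF Metric_space_hausdorff_dist])

lemma compact_triangulations_subset: "compact_triangulations n \<subseteq> topspace hausdorff_topology"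
  unfolding compact_triangulations_def topspace_hausdorff
  by (auto simp: compact_triangulation triangulation_nonempty ternary_trees_def)

lemma space_triangulation_space: "space (triangulation_space n) = compact_triangulations n"
  unfolding triangulation_space_def space_borel_of using compact_triangulations_subset by auto

text \<open>
  A set of triangulations whose codes form a closed set is \<open>\<sigma>\<close>-compact, because the space of codes is
  \<open>\<sigma>\<close>-compact. This replaces the Lusin--Souslin theorem.
\<close>
lemma measurable_on_triangulation_space:
  assumes cont: "\<And>t. t \<in> ternary_trees n \<Longrightarrow> continuous_map (top_of_set splits) X (g t)"
    and G: "\<And>t P. t \<in> ternary_trees n \<Longrightarrow> P \<in> splits \<Longrightarrow> G (triangulation t P) = g t P"
  shows "G \<in> triangulation_space n \<rightarrow>\<^sub>M borel_of X"
proof (rule measurable_borel_of_I)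
  have gX: "g t P \<in> topspace X" if "t \<in> ternary_trees n" "P \<in> splits" for t P
    using cont[OF that(1)] that(2) by (auto simp: continuous_map_def)
  have code: "\<exists>t\<in>ternary_trees n. \<exists>j. \<exists>P\<in>code_box t j. m = triangulation t P" if "m \<in> compact_triangulations n" for m
    using that unfolding compact_triangulations_iff by blast
  show "G \<in> space (triangulation_space n) \<rightarrow> topspace X"
  proof
    fix m assume "m \<in> space (triangulation_space n)"
    then obtain t j P where *: "t \<in> ternary_trees n" "P \<in> code_box t j" "m = triangulation t P"
      using code unfolding space_triangulation_space by blast
    then have "P \<in> splits" using code_box_subset by blast
    then show "G m \<in> topspace X" using G gX * by simp
  qed
  fix W assume W: "openin X W"
  \<comment> \<open>Codes of the triangulations sent outside \<open>W\<close>. The complement is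
    taken because a closed set of codes meets each compact box in a compact set.\<close>
  define C where "C = (\<lambda>t. {P \<in> splits. g t P \<in> topspace X - W})"
  have C: "closedin (top_of_set splits) (C t)" if "t \<in> ternary_trees n" for t
    using closedin_continuous_map_preimage[OF cont[OF that], of "topspace X - W"] W
    by (auto simp: C_def)
  let ?H = "subtopology hausdorff_topology (compact_triangulations n)"
  have "triangulation t ` (code_box t j \<inter> C t) \<in> sets (triangulation_space n)" if t: "t \<in> ternary_trees n" for t j
  proof -
    obtain D where D: "closed D" "C t = splits \<inter> D" using C[OF t] by (auto simp: closedin_closed)
    then have "code_box t j \<inter> C t = code_box t j \<inter> D" using code_box_subset by blast
    then have "compact (code_box t j \<inter> C t)" using D compact_code_box by (simp add: compact_Int_closed)
    then have "compactin hausdorff_topology (triangulation t ` (code_box t j \<inter> C t))"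
      using t by (intro image_compactin[OF _ continuous_map_triangulation]) (auto simp: ternary_trees_def)
    moreover have "triangulation t ` (code_box t j \<inter> C t) \<subseteq> compact_triangulations n"
      using triangulation_in_compact_triangulations[OF t] code_box_subset by blast
    ultimately have "compactin ?H (triangulation t ` (code_box t j \<inter> C t))"
      by (simp add: compactin_subtopology)
    moreover have "Hausdorff_space ?H"
      unfolding hausdorff_topology_def
      by (intro Hausdorff_space_subtopology Metric_space.Hausdorff_space_mtopology[OF Metric_space_hausdorff_dist])
    ultimately have "closedin ?H (triangulation t ` (code_box t j \<inter> C t))"
      by (intro compactin_imp_closedin)
    then show ?thesis unfolding triangulation_space_def by (rule closedin_in_sets_borel_of)
  qed
  then have "(\<Union>t\<in>ternary_trees n. \<Union>j. triangulation t ` (code_box t j \<inter> C t)) \<in> sets (triangulation_space n)"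
    by (intro sets.finite_UN sets.countable_UN finite_ternary_trees) auto
  then have "space (triangulation_space n) - (\<Union>t\<in>ternary_trees n. \<Union>j. triangulation t ` (code_box t j \<inter> C t))
      \<in> sets (triangulation_space n)"
    by (rule sets.compl_sets)
  also have "space (triangulation_space n) - (\<Union>t\<in>ternary_trees n. \<Union>j. triangulation t ` (code_box t j \<inter> C t)) =
    G -` W \<inter> space (triangulation_space n)" (is "?L = ?R")
  proof
    show "?L \<subseteq> ?R"
    proof
      fix m assume m: "m \<in> ?L"
      then have "m \<in> compact_triangulations n" unfolding space_triangulation_space by (rule DiffD1)
      from code[OF this] obtain t j P
        where P: "t \<in> ternary_trees n" "P \<in> code_box t j" "m = triangulation t P" by blast
      have "P \<notin> C t"
      proof
        assume "P \<in> C t"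
        then have "m \<in> (\<Union>t\<in>ternary_trees n. \<Union>j. triangulation t ` (code_box t j \<inter> C t))"
          using P by (intro UN_I[of t] UN_I[of j]) auto
        then show False using m by (rule DiffD2[rotated])
      qed
      moreover have PS: "P \<in> splits" using P code_box_subset by blast
      ultimately have "g t P \<in> W" using P gX unfolding C_def by blast
      then show "m \<in> ?R" using m P G PS by simp
    qed
    show "?R \<subseteq> ?L"
    proof
      fix m assume m: "m \<in> ?R"
      have "m \<noteq> triangulation t P" if "t \<in> ternary_trees n" "P \<in> code_box t j \<inter> C t" for t j P
        using m G[OF that(1), of P] that(2) unfolding C_def by auto
      then have "m \<notin> (\<Union>t\<in>ternary_trees n. \<Union>j. triangulation t ` (code_box t j \<inter> C t))" by blast
      then show "m \<in> ?L" using m by simp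
    qed
  qed
  finally show "G -` W \<inter> space (triangulation_space n) \<in> sets (triangulation_space n)" .
qed

section \<open>Measurability on the product space of splits\<close>

definition split_space :: "(real ^ 3) measure \<Rightarrow> (word \<Rightarrow> real ^ 3) measure" where
  "split_space \<nu> = (\<Pi>\<^sub>M u\<in>(UNIV :: word set). restrict_space \<nu> open_simplex)"

lemma space_split_space:
  assumes "sets \<nu> = sets borel"
  shows "space (split_space \<nu>) = splits"
proof -
  have "space \<nu> = UNIV" using sets_eq_imp_space_eq[OF assms] by simp
  then show ?thesis
    by (auto simp: split_space_def splits_def space_PiM space_restrict_space)
qed

text \<open>There are countably many words, so the product sigma-algebra of Borel algebras is the
  Borel algebra of the product topology. Continuity in the splits then gives measurability.\<close>

lemma measurable_split_space_borel:
  assumes "sets \<nu> = sets borel"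
  shows "(\<lambda>P. P) \<in> borel_measurable (split_space \<nu>)"
proof -
  have id: "(\<lambda>x. x) \<in> restrict_space \<nu> open_simplex \<rightarrow>\<^sub>M borel"
    using assms by (intro measurable_restrict_space1) (simp cong: measurable_cong_sets)
  have "(\<lambda>P. P u) \<in> split_space \<nu> \<rightarrow>\<^sub>M restrict_space \<nu> open_simplex" for u
    unfolding split_space_def by (rule measurable_component_singleton) simp
  from measurable_compose[OF this id] have "(\<lambda>P u. P u) \<in> split_space \<nu> \<rightarrow>\<^sub>M (\<Pi>\<^sub>M u\<in>UNIV. borel)"
    by (intro measurable_PiM_single') auto
  then show ?thesis by (simp cong: measurable_cong_sets add: sets_PiM_equal_borel)
qed

lemma continuous_map_measurable_split_space:
  assumes "sets \<nu> = sets borel" "continuous_map (top_of_set splits) X g"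
  shows "g \<in> split_space \<nu> \<rightarrow>\<^sub>M borel_of X"
proof (rule measurable_borel_of_I)
  show "g \<in> space (split_space \<nu>) \<rightarrow> topspace X"
    using assms(2) by (auto simp: space_split_space[OF assms(1)] continuous_map_def)
  fix W assume "openin X W"
  from openin_continuous_map_preimage[OF assms(2) this]
  obtain O' where O': "open O'" "{P \<in> splits. g P \<in> W} = splits \<inter> O'" by (auto simp: openin_open)
  have "(\<lambda>P. P) -` O' \<inter> space (split_space \<nu>) \<in> sets (split_space \<nu>)"
    by (rule measurable_sets[OF measurable_split_space_borel[OF assms(1)]]) (simp add: O')
  also have "(\<lambda>P. P) -` O' \<inter> space (split_space \<nu>) = g -` W \<inter> space (split_space \<nu>)"
    using O'(2) by (auto simp: space_split_space[OF assms(1)])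
  finally show "g -` W \<inter> space (split_space \<nu>) \<in> sets (split_space \<nu>)" .
qed

lemma borel_of_euclidean: "borel_of euclidean = borel"
  by (simp add: borel_of_def borel_def)

lemma continuous_measurable_split_space:
  fixes g :: "(word \<Rightarrow> real ^ 3) \<Rightarrow> 'b::topological_space"
  assumes "sets \<nu> = sets borel" "continuous_on splits g"
  shows "g \<in> borel_measurable (split_space \<nu>)"
  using continuous_map_measurable_split_space[OF assms(1), of euclidean g] assms(2)
  by (simp add: borel_of_euclidean)

lemma measurable_triangulation:
  assumes "sets \<nu> = sets borel"
  shows "(\<lambda>(t, P). triangulation t P) \<in>
    uniform_count_measure (ternary_trees n) \<Otimes>\<^sub>M split_space \<nu> \<rightarrow>\<^sub>M triangulation_space n"
proof -
  have "(\<lambda>(t, P). triangulation t P) \<in> count_space (ternary_trees n) \<Otimes>\<^sub>M split_space \<nu> \<rightarrow>\<^sub>M triangulation_space n"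
  proof (rule measurable_pair_measure_countable1)
    show "countable (ternary_trees n)" using finite_ternary_trees by (rule countable_finite)
    fix t assume t: "t \<in> ternary_trees n"
    have "continuous_map (top_of_set splits) hausdorff_topology (triangulation t)"
      using continuous_map_triangulation[of t] t
      by (auto simp: ternary_trees_def intro: continuous_map_from_subtopology)
    then have "continuous_map (top_of_set splits) (subtopology hausdorff_topology (compact_triangulations n)) (triangulation t)"
      using triangulation_in_compact_triangulations[OF t] by (auto simp: continuous_map_in_subtopology)
    from continuous_map_measurable_split_space[OF assms this]
    show "(\<lambda>P. case (t, P) of (t, P) \<Rightarrow> triangulation t P) \<in> split_space \<nu> \<rightarrow>\<^sub>M triangulation_space n"
      by (simp add: triangulation_space_def)
  qed
  then show ?thesis
    by (simp cong: measurable_cong_sets add: sets_pair_measure_cong[OF sets_uniform_count_measure_count_space refl])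
qed

section \<open>Uniform descent into the subtriangles\<close>

definition words :: "nat \<Rightarrow> word set" where
  "words k = {u. length u = k}"

lemma finite_words: "finite (words k)"
  and card_words: "card (words k) = 3 ^ k"
  using finite_lists_length_eq[of "UNIV :: 3 set" k] card_lists_length_eq[of "UNIV :: 3 set" k]
  by (simp_all add: words_def)

lemma words_0: "words 0 = {[]}"
  by (auto simp: words_def)

lemma sum_words_Suc:
  fixes h :: "word \<Rightarrow> real"
  shows "(\<Sum>u\<in>words (Suc k). h u) = (\<Sum>u\<in>words k. \<Sum>i\<in>UNIV. h (u @ [i]))"
proof -
  have "words (Suc k) = (\<lambda>(u, i). u @ [i]) ` (words k \<times> UNIV)"
  proof (intro set_eqI iffI)
    fix v assume "v \<in> words (Suc k)"
    then show "v \<in> (\<lambda>(u, i). u @ [i]) ` (words k \<times> UNIV)"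
      by (cases v rule: rev_cases) (auto simp: words_def)
  qed (auto simp: words_def)
  moreover have inj: "inj_on (\<lambda>(u, i). u @ [i]) (words k \<times> (UNIV :: 3 set))" by (auto simp: inj_on_def)
  ultimately have "(\<Sum>u\<in>words (Suc k). h u) = sum (h \<circ> (\<lambda>(u, i). u @ [i])) (words k \<times> UNIV)"
    by (simp only: sum.reindex[OF inj])
  also have "\<dots> = (\<Sum>(u, i)\<in>words k \<times> UNIV. h (u @ [i]))" by (intro sum.cong) auto
  finally show ?thesis by (simp add: sum.cartesian_product)
qed

text \<open>The measure of size of a triangle: it bounds all distances between corners, as the
  diameter would, but it is a sum of sides and hence suits expectations.\<close>

definition perimeter :: "(3 \<Rightarrow> 'b::metric_space) \<Rightarrow> real" where
  "perimeter c = dist (c 1) (c 2) + dist (c 2) (c 3) + dist (c 3) (c 1)"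

lemma perimeter_nonneg: "0 \<le> perimeter c"
  by (simp add: perimeter_def)

lemma dist_le_perimeter: "dist (c i) (c j) \<le> perimeter c"
proof -
  have "dist (c 1) (c 2) \<le> perimeter c" "dist (c 2) (c 3) \<le> perimeter c" "dist (c 3) (c 1) \<le> perimeter c"
    by (simp_all add: perimeter_def)
  then have "\<forall>i j. dist (c i) (c j) \<le> perimeter c"
    unfolding forall_3 by (simp add: perimeter_nonneg dist_commute)
  then show ?thesis by blast
qed

lemma sum_dist_corners: "(\<Sum>i\<in>UNIV. \<Sum>j\<in>UNIV. dist (c i) (c j)) = 2 * perimeter c"
  unfolding sum_3 perimeter_def by (simp add: dist_commute)

lemma dist_barycenter_le:
  assumes "p \<in> open_simplex"
  shows "dist a (barycenter p c) \<le> (\<Sum>k\<in>UNIV. p $ k * dist a (c k))"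
proof -
  have "a = (\<Sum>k\<in>UNIV. (p $ k) *\<^sub>R a)"
    unfolding scaleR_sum_left[symmetric] open_simplex_sum[OF assms] by simp
  then have "a - barycenter p c = (\<Sum>k\<in>UNIV. (p $ k) *\<^sub>R (a - c k))"
    unfolding barycenter_def scaleR_diff_right sum_subtractf by metis
  then have "dist a (barycenter p c) \<le> (\<Sum>k\<in>UNIV. norm ((p $ k) *\<^sub>R (a - c k)))"
    unfolding dist_norm by (simp only: norm_sum)
  also have "\<dots> = (\<Sum>k\<in>UNIV. p $ k * dist a (c k))"
    using open_simplex_pos[OF assms] by (intro sum.cong) (auto simp: dist_norm less_imp_le abs_of_pos)
  finally show ?thesis .
qed

text \<open>Each old side belongs to exactly one child and each new edge to two; the new edges are
  then bounded by convexity of the distance.\<close>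

lemma sum_perimeter_children_le:
  assumes "p \<in> open_simplex"
  shows "(\<Sum>i\<in>UNIV. perimeter (c(i := barycenter p c))) \<le>
    perimeter c + 2 * (\<Sum>i\<in>UNIV. \<Sum>k\<in>UNIV. p $ k * dist (c i) (c k))"
proof -
  have "(\<Sum>i\<in>UNIV. perimeter (c(i := barycenter p c))) = perimeter c + 2 * (\<Sum>i\<in>UNIV. dist (c i) (barycenter p c))"
  proof -
    let ?M = "barycenter p c"
    have "perimeter (c(1 := ?M)) = dist (c 2) ?M + dist (c 2) (c 3) + dist (c 3) ?M"
      "perimeter (c(2 := ?M)) = dist (c 1) ?M + dist (c 3) ?M + dist (c 3) (c 1)"
      "perimeter (c(3 := ?M)) = dist (c 1) (c 2) + dist (c 2) ?M + dist (c 1) ?M"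
      by (simp_all add: perimeter_def dist_commute)
    then show ?thesis unfolding sum_3 by (simp add: perimeter_def)
  qed
  also have "\<dots> \<le> perimeter c + 2 * (\<Sum>i\<in>UNIV. \<Sum>k\<in>UNIV. p $ k * dist (c i) (c k))"
    by (intro add_left_mono mult_left_mono sum_mono dist_barycenter_le assms) simp
  finally show ?thesis .
qed

lemma bounded_filled_triangle: "bounded filled_triangle"
  and compact_filled_triangle: "compact filled_triangle"
proof -
  have "compact (range base_corner)" by (intro finite_imp_compact) simp
  then show "compact filled_triangle" unfolding filled_triangle_def by (rule compact_convex_hull)
  then show "bounded filled_triangle" by (rule compact_imp_bounded)
qed

lemma dist_filled_triangle_le: "x \<in> filled_triangle \<Longrightarrow> y \<in> filled_triangle \<Longrightarrow> dist x y \<le> diameter filled_triangle"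
  by (rule diameter_bounded_bound[OF bounded_filled_triangle])

section \<open>Expectations under a splitting law\<close>

locale splitting =
  fixes \<nu> :: "(real ^ 3) measure"
  assumes splitting_law: "splitting_law \<nu>"
begin

abbreviation \<rho> :: "(real ^ 3) measure" where "\<rho> \<equiv> restrict_space \<nu> open_simplex"
abbreviation Q :: "(word \<Rightarrow> real ^ 3) measure" where "Q \<equiv> split_space \<nu>"

lemma sets_nu: "sets \<nu> = sets borel"
  and prob_space_nu: "prob_space \<nu>"
  using splitting_law by (auto simp: splitting_law_def)

lemma space_nu: "space \<nu> = UNIV"
  using sets_eq_imp_space_eq[OF sets_nu] by simp

lemma AE_open_simplex: "AE x in \<nu>. x \<in> open_simplex"
proof -
  have "AE x in \<nu>. \<forall>i\<in>(UNIV :: 3 set). x $ i > 0"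
    using splitting_law by (intro AE_finite_allI) (auto simp: splitting_law_def)
  moreover have "AE x in \<nu>. (\<Sum>i\<in>UNIV. x $ i) = 1"
    using splitting_law by (auto simp: splitting_law_def)
  ultimately show ?thesis by eventually_elim (simp add: open_simplex_def)
qed

lemma measurable_nu: "borel_measurable \<nu> = borel_measurable borel"
  by (intro measurable_cong_sets sets_nu refl)

lemma open_simplex_borel: "open_simplex \<in> sets borel"
proof -
  have "open_simplex = (\<Inter>i. {x. 0 < x $ i}) \<inter> {x. (\<Sum>i\<in>UNIV. x $ i) = 1}" by (auto simp: open_simplex_def)
  also have "\<dots> \<in> sets borel"
    by (intro sets.Int sets.finite_INT borel_open borel_closed open_Collect_less closed_Collect_eq
        continuous_intros) auto
  finally show ?thesis .
qed

lemma open_simplex_sets: "open_simplex \<in> sets \<nu>"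
  using open_simplex_borel by (simp add: sets_nu)

lemma prob_space_rho: "prob_space \<rho>"
proof -
  interpret prob_space \<nu> by (rule prob_space_nu)
  have "prob open_simplex = 1"
    using AE_open_simplex by (subst prob_eq_1) (auto simp: open_simplex_sets)
  then have "emeasure \<nu> open_simplex = 1" by (simp add: emeasure_eq_measure)
  then show ?thesis by (intro prob_space_restrict_space) (auto simp: open_simplex_sets)
qed

lemma integrable_coordinate: "integrable \<nu> (\<lambda>x. x $ i)"
proof -
  interpret prob_space \<nu> by (rule prob_space_nu)
  show ?thesis
  proof (rule integrable_const_bound[where B = 1])
    show "AE x in \<nu>. norm (x $ i) \<le> 1"
      using AE_open_simplex
      by eventually_elim (simp add: open_simplex_pos[THEN less_imp_le] open_simplex_less_1[THEN less_imp_le])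
  qed (simp add: measurable_nu)
qed

text \<open>Transpositions of coordinates preserve \<nu>, so the three means agree, and they add up
  to one.\<close>

lemma integral_coordinate: "(\<integral>x. x $ i \<partial>\<nu>) = 1 / 3"
proof -
  interpret prob_space \<nu> by (rule prob_space_nu)
  have sym: "(\<integral>x. x $ i \<partial>\<nu>) = (\<integral>x. x $ j \<partial>\<nu>)" for i j
  proof -
    let ?\<sigma> = "Transposition.transpose i j"
    have \<sigma>: "?\<sigma> permutes UNIV" by (rule permutes_swap_id) auto
    then have d: "distr \<nu> borel (\<lambda>x. \<chi> i. x $ ?\<sigma> i) = \<nu>" using splitting_law by (auto simp: splitting_law_def)
    have "(\<lambda>x :: real ^ 3. \<chi> i. x $ ?\<sigma> i) \<in> borel_measurable borel"
      by (intro borel_measurable_continuous_onI continuous_intros)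
    then have "(\<lambda>x :: real ^ 3. \<chi> i. x $ ?\<sigma> i) \<in> \<nu> \<rightarrow>\<^sub>M borel" by (simp add: measurable_nu)
    from integral_distr[OF this, of "\<lambda>x. x $ i"]
    show ?thesis unfolding d by simp
  qed
  have "(\<integral>x. (\<Sum>i\<in>UNIV. x $ i) \<partial>\<nu>) = (\<integral>x. 1 \<partial>\<nu>)"
    by (rule integral_cong_AE)
       (use AE_open_simplex in \<open>auto simp: measurable_nu elim!: eventually_mono dest: open_simplex_sum\<close>)
  then have "(\<Sum>i\<in>(UNIV :: 3 set). (\<integral>x. x $ i \<partial>\<nu>)) = 1"
    using prob_space by (simp add: integrable_coordinate)
  moreover have "(\<Sum>j\<in>(UNIV :: 3 set). (\<integral>x. x $ j \<partial>\<nu>)) = (\<Sum>j\<in>(UNIV :: 3 set). (\<integral>x. x $ i \<partial>\<nu>))"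
    by (intro sum.cong refl sym)
  ultimately show ?thesis by simp
qed

lemma integral_coordinate_rho: "(\<integral>x. x $ i \<partial>\<rho>) = 1 / 3"
proof -
  have "(\<integral>x. x $ i \<partial>\<rho>) = (\<integral>x. indicator open_simplex x *\<^sub>R x $ i \<partial>\<nu>)"
    by (rule integral_restrict_space) (use open_simplex_sets in auto)
  also have "\<dots> = (\<integral>x. x $ i \<partial>\<nu>)"
    by (rule integral_cong_AE)
       (use AE_open_simplex open_simplex_borel in \<open>auto simp: measurable_nu elim!: eventually_mono\<close>)
  finally show ?thesis by (simp add: integral_coordinate)
qed

lemma space_rho: "space \<rho> = open_simplex"
  by (simp add: space_restrict_space space_nu)

lemma measurable_rho: "f \<in> borel_measurable borel \<Longrightarrow> f \<in> borel_measurable \<rho>"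
  by (intro measurable_restrict_space1) (simp add: measurable_nu)

lemma integrable_coordinate_rho: "integrable \<rho> (\<lambda>x. x $ i)"
proof -
  interpret prob_space \<rho> by (rule prob_space_rho)
  show ?thesis
    by (rule integrable_const_bound[where B = 1])
       (auto simp: space_rho measurable_rho open_simplex_pos[THEN less_imp_le] open_simplex_less_1[THEN less_imp_le])
qed

lemma prob_space_Q: "prob_space Q"
  unfolding split_space_def by (rule prob_space_PiM) (rule prob_space_rho)

lemma space_Q: "space Q = splits"
  by (rule space_split_space[OF sets_nu])

lemma continuous_measurable_Q:
  "continuous_on UNIV g \<Longrightarrow> (g :: (word \<Rightarrow> real ^ 3) \<Rightarrow> 'b::topological_space) \<in> borel_measurable Q"
  by (rule continuous_measurable_split_space[OF sets_nu]) (auto intro: continuous_on_subset)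

lemma corners_measurable [measurable]: "(\<lambda>P. corners P u i) \<in> borel_measurable Q"
  by (intro continuous_measurable_Q continuous_on_corners)

lemma perimeter_measurable [measurable]: "(\<lambda>P. perimeter (corners P u)) \<in> borel_measurable Q"
  unfolding perimeter_def by measurable

lemma corners_filled: "P \<in> splits \<Longrightarrow> corners P u i \<in> filled_triangle"
  by (rule corners_in_filled_triangle) (simp add: splits_def)

lemma dist_corners_bound: "P \<in> splits \<Longrightarrow> dist (corners P u i) (corners P u j) \<le> diameter filled_triangle"
  by (intro dist_filled_triangle_le corners_filled)

lemma perimeter_bound: "P \<in> splits \<Longrightarrow> perimeter (corners P u) \<le> 3 * diameter filled_triangle"
  unfolding perimeter_def
  using dist_corners_bound[of P u 1 2] dist_corners_bound[of P u 2 3] dist_corners_bound[of P u 3 1] by linarith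

lemma integrable_Q:
  fixes f :: "_ \<Rightarrow> real"
  assumes "f \<in> borel_measurable Q" "\<And>P. P \<in> splits \<Longrightarrow> \<bar>f P\<bar> \<le> B"
  shows "integrable Q f"
proof -
  interpret prob_space Q by (rule prob_space_Q)
  show ?thesis by (rule integrable_const_bound[where B = B]) (use assms in \<open>auto simp: space_Q\<close>)
qed

lemma integrable_perimeter: "integrable Q (\<lambda>P. perimeter (corners P u))"
  by (rule integrable_Q[where B = "3 * diameter filled_triangle"])
     (auto simp: perimeter_bound perimeter_nonneg abs_of_nonneg)

text \<open>Replacing the split at \<open>u\<close> by an independent copy keeps the law. The
  corners at \<open>u\<close> depend on proper prefixes of \<open>u\<close> only, so Fubini can
  average over this one split with the triangle held fixed.\<close>

lemma resample_split: "distr (\<rho> \<Otimes>\<^sub>M Q) Q (\<lambda>(x, P). P(u := x)) = Q"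
  using distr_pair_PiM_eq_PiM[of UNIV "\<lambda>_. \<rho>" u] prob_space_rho
  by (simp add: split_space_def)

lemma corners_resample:
  "corners (P(u := x)) u = corners P u"
  "corners (P(u := x)) (u @ [i]) = (corners P u)(i := barycenter x (corners P u))"
proof -
  show *: "corners (P(u := x)) u = corners P u" by (rule corners_cong) auto
  show "corners (P(u := x)) (u @ [i]) = (corners P u)(i := barycenter x (corners P u))"
    by (simp add: *)
qed

text \<open>After averaging, every weight in \<open>sum_perimeter_children_le\<close> is
  \<open>1/3\<close>, and the nine distances between corners sum to twice the perimeter:
  \<open>1 + 2 * (1/3) * 2 = 7/3\<close>.\<close>

lemma perimeter_contraction:
  "(\<Sum>i\<in>UNIV. \<integral>P. perimeter (corners P (u @ [i])) \<partial>Q) \<le> 7 / 3 * (\<integral>P. perimeter (corners P u) \<partial>Q)"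
proof -
  interpret Q: prob_space Q by (rule prob_space_Q)
  interpret R: prob_space \<rho> by (rule prob_space_rho)
  interpret RQ: pair_prob_space \<rho> Q ..
  define h where "h = (\<lambda>P. \<Sum>i\<in>UNIV. perimeter (corners P (u @ [i])))"
  define b where "b = (\<lambda>P x. perimeter (corners P u)
    + 2 * (\<Sum>i\<in>UNIV. \<Sum>k\<in>UNIV. x $ k * dist (corners P u i) (corners P u k)))"
  have resample[measurable]: "(\<lambda>(x, P). P(u := x)) \<in> \<rho> \<Otimes>\<^sub>M Q \<rightarrow>\<^sub>M Q"
    unfolding split_space_def case_prod_beta
    by (rule measurable_fun_upd[where J = UNIV]) auto
  have h[measurable]: "h \<in> borel_measurable Q" unfolding h_def by measurable
  have coord[measurable]: "(\<lambda>x. x $ k) \<in> borel_measurable \<rho>" for k by (rule measurable_rho) simp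
  have b_meas: "(\<lambda>(x, P). b P x) \<in> borel_measurable (\<rho> \<Otimes>\<^sub>M Q)" unfolding b_def by measurable
  have b_bound: "\<bar>b P x\<bar> \<le> 3 * diameter filled_triangle + 2 * (9 * diameter filled_triangle)"
    if "P \<in> splits" "x \<in> open_simplex" for P x
  proof -
    have "x $ k * dist (corners P u i) (corners P u k) \<le> 1 * diameter filled_triangle" for i k
      using that open_simplex_less_1[of x k] open_simplex_pos[of x k] dist_corners_bound[of P u i k]
      by (intro mult_mono) auto
    then have "(\<Sum>i\<in>UNIV. \<Sum>k\<in>UNIV. x $ k * dist (corners P u i) (corners P u k)) \<le>
        (\<Sum>i\<in>(UNIV :: 3 set). \<Sum>k\<in>(UNIV :: 3 set). 1 * diameter filled_triangle)"
      by (intro sum_mono)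
    moreover have "0 \<le> (\<Sum>i\<in>UNIV. \<Sum>k\<in>UNIV. x $ k * dist (corners P u i) (corners P u k))"
      using that open_simplex_pos[of x] by (intro sum_nonneg mult_nonneg_nonneg) (auto intro: less_imp_le)
    ultimately show ?thesis
      using perimeter_bound[of P u] perimeter_nonneg[of "corners P u"] that unfolding b_def by simp
  qed
  have sp: "space (\<rho> \<Otimes>\<^sub>M Q) = open_simplex \<times> splits" by (simp add: space_pair_measure space_rho space_Q)
  have b_int: "integrable (\<rho> \<Otimes>\<^sub>M Q) (\<lambda>(x, P). b P x)"
    by (rule RQ.integrable_const_bound[where B = "3 * diameter filled_triangle + 2 * (9 * diameter filled_triangle)"])
       (use b_bound in \<open>auto simp: sp b_meas\<close>)
  have h_le: "h (P(u := x)) \<le> b P x" if "x \<in> open_simplex" for P x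
    unfolding h_def b_def corners_resample by (rule sum_perimeter_children_le[OF that])
  have h_int: "integrable (\<rho> \<Otimes>\<^sub>M Q) (\<lambda>(x, P). h (P(u := x)))"
  proof (rule Bochner_Integration.integrable_bound[OF b_int])
    show "(\<lambda>(x, P). h (P(u := x))) \<in> borel_measurable (\<rho> \<Otimes>\<^sub>M Q)"
      using measurable_compose[OF resample h] by (simp add: case_prod_beta)
    show "AE z in \<rho> \<Otimes>\<^sub>M Q. norm (case z of (x, P) \<Rightarrow> h (P(u := x))) \<le> norm (case z of (x, P) \<Rightarrow> b P x)"
    proof (rule AE_I2, clarsimp simp: sp)
      fix x P assume "x \<in> open_simplex"
      from h_le[OF this, of P] have "h (P(u := x)) \<le> b P x" .
      moreover have "0 \<le> h (P(u := x))" unfolding h_def by (intro sum_nonneg perimeter_nonneg)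
      ultimately show "\<bar>h (P(u := x))\<bar> \<le> \<bar>b P x\<bar>" by simp
    qed
  qed
  have "(\<Sum>i\<in>UNIV. \<integral>P. perimeter (corners P (u @ [i])) \<partial>Q) = (\<integral>P. h P \<partial>Q)"
    unfolding h_def by (intro Bochner_Integration.integral_sum[symmetric] integrable_perimeter)
  also have "\<dots> = (\<integral>P. h P \<partial>distr (\<rho> \<Otimes>\<^sub>M Q) Q (\<lambda>(x, P). P(u := x)))"
    by (simp only: resample_split)
  also have "\<dots> = (\<integral>z. h (case z of (x, P) \<Rightarrow> P(u := x)) \<partial>(\<rho> \<Otimes>\<^sub>M Q))"
    by (rule integral_distr[OF resample h])
  also have "\<dots> \<le> (\<integral>z. (case z of (x, P) \<Rightarrow> b P x) \<partial>(\<rho> \<Otimes>\<^sub>M Q))"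
    using h_int b_int h_le unfolding case_prod_beta by (intro integral_mono) (auto simp: sp)
  also have "\<dots> = (\<integral>P. \<integral>x. b P x \<partial>\<rho> \<partial>Q)"
    using RQ.integral_snd[of "\<lambda>x P. b P x"] b_int by simp
  also have "(\<lambda>P. \<integral>x. b P x \<partial>\<rho>) = (\<lambda>P. 7 / 3 * perimeter (corners P u))"
  proof
    fix P
    have "(\<integral>x. b P x \<partial>\<rho>) = perimeter (corners P u)
      + 2 * (\<Sum>i\<in>UNIV. \<Sum>k\<in>UNIV. (\<integral>x. x $ k \<partial>\<rho>) * dist (corners P u i) (corners P u k))"
      unfolding b_def using R.prob_space by (simp add: integrable_coordinate_rho)
    also have "\<dots> = perimeter (corners P u) + 2 / 3 * (\<Sum>i\<in>UNIV. \<Sum>k\<in>UNIV. dist (corners P u i) (corners P u k))"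
      by (simp add: integral_coordinate_rho sum_distrib_left)
    also have "\<dots> = 7 / 3 * perimeter (corners P u)" by (simp add: sum_dist_corners)
    finally show "(\<integral>x. b P x \<partial>\<rho>) = 7 / 3 * perimeter (corners P u)" .
  qed
  also have "(\<integral>P. 7 / 3 * perimeter (corners P u) \<partial>Q) = 7 / 3 * (\<integral>P. perimeter (corners P u) \<partial>Q)" by simp
  finally show ?thesis .
qed

text \<open>The expectation of \<open>h\<close> at a uniform word of length \<open>k\<close>
  independent of the splits.\<close>

definition mean :: "nat \<Rightarrow> (word \<Rightarrow> (word \<Rightarrow> real ^ 3) \<Rightarrow> real) \<Rightarrow> real" where
  "mean k h = (\<Sum>u\<in>words k. \<integral>P. h u P \<partial>Q) / 3 ^ k"

text \<open>The factor \<open>7/3\<close> is for the sum over three children; choosing one of them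
  uniformly divides it by 3.\<close>

lemma mean_perimeter_le:
  "mean k (\<lambda>u P. perimeter (corners P u)) \<le> (7 / 9) ^ k * perimeter base_corner"
proof (induction k)
  case 0
  interpret prob_space Q by (rule prob_space_Q)
  show ?case using prob_space by (simp add: mean_def words_0)
next
  case (Suc k)
  have "(\<Sum>u\<in>words (Suc k). \<integral>P. perimeter (corners P u) \<partial>Q) \<le>
      (\<Sum>u\<in>words k. 7 / 3 * (\<integral>P. perimeter (corners P u) \<partial>Q))"
    unfolding sum_words_Suc by (intro sum_mono perimeter_contraction)
  then have "mean (Suc k) (\<lambda>u P. perimeter (corners P u)) \<le> 7 / 9 * mean k (\<lambda>u P. perimeter (corners P u))"
    unfolding mean_def sum_distrib_left[symmetric] by (simp add: divide_simps)
  with Suc show ?case by simp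
qed

lemma mean_perimeter_tendsto: "(\<lambda>k. mean k (\<lambda>u P. perimeter (corners P u))) \<longlonglongrightarrow> 0"
proof (rule tendsto_sandwich[OF _ _ tendsto_const])
  show "(\<lambda>k. (7 / 9) ^ k * perimeter base_corner) \<longlonglongrightarrow> 0"
    by (intro tendsto_mult_left_zero LIMSEQ_power_zero) simp
  show "\<forall>\<^sub>F k in sequentially. 0 \<le> mean k (\<lambda>u P. perimeter (corners P u))"
    unfolding mean_def by (intro always_eventually allI divide_nonneg_nonneg sum_nonneg integral_nonneg_AE)
      (auto simp: perimeter_nonneg)
qed (simp add: mean_perimeter_le)

lemma measure_large_triangle_le:
  assumes "0 < \<eta>"
  shows "(\<Sum>u\<in>words k. measure Q {P \<in> space Q. \<eta> \<le> perimeter (corners P u)}) / 3 ^ k \<le>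
    mean k (\<lambda>u P. perimeter (corners P u)) / \<eta>"
proof -
  interpret prob_space Q by (rule prob_space_Q)
  have "measure Q {P \<in> space Q. \<eta> \<le> perimeter (corners P u)} \<le> (\<integral>P. perimeter (corners P u) \<partial>Q) / \<eta>" for u
    using integral_Markov_inequality_measure[OF integrable_perimeter sets.empty_sets _ assms, of u]
    by (auto simp: perimeter_nonneg)
  then have "(\<Sum>u\<in>words k. measure Q {P \<in> space Q. \<eta> \<le> perimeter (corners P u)}) \<le>
      (\<Sum>u\<in>words k. (\<integral>P. perimeter (corners P u) \<partial>Q) / \<eta>)"
    by (rule sum_mono)
  then show ?thesis
  proof -
    assume le: "(\<Sum>u\<in>words k. measure Q {P \<in> space Q. \<eta> \<le> perimeter (corners P u)}) \<le>
      (\<Sum>u\<in>words k. (\<integral>P. perimeter (corners P u) \<partial>Q) / \<eta>)"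
    have "mean k (\<lambda>u P. perimeter (corners P u)) / \<eta> = (\<Sum>u\<in>words k. (\<integral>P. perimeter (corners P u) \<partial>Q) / \<eta>) / 3 ^ k"
      unfolding mean_def sum_divide_distrib[symmetric] by simp
    then show ?thesis using divide_right_mono[OF le, of "3 ^ k"] by simp
  qed
qed

end

section \<open>The limit point\<close>

text \<open>A ball is convex: once it holds the corners at \<open>v\<close>, it holds everything
  below \<open>v\<close>.\<close>

lemma cball_corners:
  assumes "\<And>w. P w \<in> open_simplex"
  shows "corners P (v @ w) i \<in> cball (corners P v j) (perimeter (corners P v))"
    and "vertex P (v @ w) \<in> cball (corners P v j) (perimeter (corners P v))"
proof -
  have "corners P v i \<in> cball (corners P v j) (perimeter (corners P v))" for i
    by (simp add: dist_le_perimeter)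
  then show "corners P (v @ w) i \<in> cball (corners P v j) (perimeter (corners P v))"
    "vertex P (v @ w) \<in> cball (corners P v j) (perimeter (corners P v))"
    by (rule corners_append_in_convex[where P = P, OF assms convex_cball],
        rule vertex_append_in_convex[where P = P, OF assms convex_cball])
qed

context splitting
begin

section \<open>Descent along an infinite sequence of uniform letters\<close>

abbreviation letters :: "(nat \<Rightarrow> 3) measure" where
  "letters \<equiv> \<Pi>\<^sub>M i\<in>(UNIV :: nat set). measure_pmf (pmf_of_set (UNIV :: 3 set))"

lemma prob_space_letters: "prob_space letters"
  by (rule prob_space_PiM) (rule measure_pmf.prob_space_axioms)

lemma space_letters: "space letters = UNIV"
  by (simp add: space_PiM)

lemma prefix_event:
  assumes "u \<in> words k"
  shows "{s. map s [0..<k] = u} \<in> sets letters" "measure letters {s. map s [0..<k] = u} = 1 / 3 ^ k"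
proof -
  interpret product_prob_space "\<lambda>_ :: nat. measure_pmf (pmf_of_set (UNIV :: 3 set))" UNIV
    by unfold_locales
  interpret prob_space letters by (rule prob_space_letters)
  have eq: "{s. map s [0..<k] = u} = {s \<in> space letters. \<forall>i\<in>{..<k}. s i \<in> {u ! i}}"
    using assms unfolding space_letters by (auto simp: words_def list_eq_iff_nth_eq)
  have "emeasure letters {s \<in> space letters. \<forall>i\<in>{..<k}. s i \<in> {u ! i}} =
      (\<Prod>i\<in>{..<k}. emeasure (measure_pmf (pmf_of_set UNIV)) {u ! i})"
    by (rule emeasure_PiM_Collect) auto
  also have "\<dots> = (\<Prod>i\<in>{..<k}. ennreal (1 / 3))"
    by (simp add: emeasure_pmf_single)
  also have "\<dots> = ennreal (1 / 3 ^ k)"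
    by (simp add: ennreal_power power_one_over)
  finally have "measure letters {s \<in> space letters. \<forall>i\<in>{..<k}. s i \<in> {u ! i}} = 1 / 3 ^ k"
    unfolding measure_def by (simp del: ennreal_numeral)
  then show "measure letters {s. map s [0..<k] = u} = 1 / 3 ^ k" unfolding eq .
  show "{s. map s [0..<k] = u} \<in> sets letters" unfolding eq by measurable
qed

lemma measurable_prefix [measurable]: "(\<lambda>s. map s [0..<k]) \<in> letters \<rightarrow>\<^sub>M count_space UNIV"
proof -
  have "(\<lambda>s. map s [0..<k]) -` {u} \<inter> space letters \<in> sets letters" for u
  proof (cases "u \<in> words k")
    case True
    then show ?thesis using prefix_event(1)[OF True] by (simp add: space_letters vimage_def)
  next
    case False
    then have "(\<lambda>s. map s [0..<k]) -` {u} \<inter> space letters = {}" by (auto simp: words_def)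
    then show ?thesis by simp
  qed
  then show ?thesis by (subst measurable_count_space_eq2_countable) auto
qed

lemma measurable_descent:
  fixes h :: "word \<Rightarrow> (word \<Rightarrow> real ^ 3) \<Rightarrow> 'b::topological_space"
  assumes "\<And>u. h u \<in> borel_measurable Q"
  shows "(\<lambda>z. h (map (snd z) [0..<k]) (fst z)) \<in> borel_measurable (Q \<Otimes>\<^sub>M letters)"
proof (rule measurable_compose_countable)
  show "(\<lambda>z. h u (fst z)) \<in> borel_measurable (Q \<Otimes>\<^sub>M letters)" for u
    by (rule measurable_compose[OF measurable_fst assms])
  show "(\<lambda>z. map (snd z) [0..<k]) \<in> Q \<Otimes>\<^sub>M letters \<rightarrow>\<^sub>M count_space UNIV"
    by (rule measurable_compose[OF measurable_snd measurable_prefix])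
qed

text \<open>The prefix of length \<open>k\<close> takes \<open>3 ^ k\<close> values, each with
  probability \<open>1 / 3 ^ k\<close> and independently of the splits, so the integral splits over
  indicators of prefixes.\<close>

lemma integral_descent:
  assumes meas: "\<And>u. h u \<in> borel_measurable Q" and bound: "\<And>u P. P \<in> splits \<Longrightarrow> \<bar>h u P\<bar> \<le> (B :: real)"
  shows "integrable (Q \<Otimes>\<^sub>M letters) (\<lambda>z. h (map (snd z) [0..<k]) (fst z))"
    and "(\<integral>z. h (map (snd z) [0..<k]) (fst z) \<partial>(Q \<Otimes>\<^sub>M letters)) = mean k h"
proof -
  interpret Q: prob_space Q by (rule prob_space_Q)
  interpret L: prob_space letters by (rule prob_space_letters)
  interpret QL: pair_prob_space Q letters ..
  have sp: "space (Q \<Otimes>\<^sub>M letters) = splits \<times> UNIV" by (simp add: space_pair_measure space_Q space_letters)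
  show "integrable (Q \<Otimes>\<^sub>M letters) (\<lambda>z. h (map (snd z) [0..<k]) (fst z))"
    by (rule QL.integrable_const_bound[where B = B])
       (use measurable_descent[OF meas] bound in \<open>auto simp: sp\<close>)
  define E where "E = (\<lambda>u. {s :: nat \<Rightarrow> 3. map s [0..<k] = u})"
  have int: "integrable (Q \<Otimes>\<^sub>M letters) (\<lambda>(P, s). h u P * indicator (E u) s)"
    and val: "(\<integral>z. (case z of (P, s) \<Rightarrow> h u P * indicator (E u) s) \<partial>(Q \<Otimes>\<^sub>M letters)) = (\<integral>P. h u P \<partial>Q) / 3 ^ k"
    if u: "u \<in> words k" for u
  proof -
    have E[measurable]: "E u \<in> sets letters" and m: "measure letters (E u) = 1 / 3 ^ k"
      using prefix_event[OF u] by (simp_all add: E_def)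
    note [measurable] = meas[of u]
    have B: "0 \<le> B" using bound[of "\<lambda>_. uniform_point" u] uniform_point by (auto simp: splits_def)
    show int: "integrable (Q \<Otimes>\<^sub>M letters) (\<lambda>(P, s). h u P * indicator (E u) s)"
    proof (rule QL.integrable_const_bound[where B = B])
      show "(\<lambda>(P, s). h u P * indicator (E u) s) \<in> borel_measurable (Q \<Otimes>\<^sub>M letters)" by measurable
      show "AE z in Q \<Otimes>\<^sub>M letters. norm (case z of (P, s) \<Rightarrow> h u P * indicator (E u) s) \<le> B"
        using bound B by (intro AE_I2) (auto simp: sp indicator_def)
    qed
    have "(\<integral>z. (case z of (P, s) \<Rightarrow> h u P * indicator (E u) s) \<partial>(Q \<Otimes>\<^sub>M letters)) =
        (\<integral>P. \<integral>s. h u P * indicator (E u) s \<partial>letters \<partial>Q)"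
      using QL.integral_fst'[OF int] by simp
    also have "\<dots> = (\<integral>P. h u P * (1 / 3 ^ k) \<partial>Q)"
      using m by (simp add: L.emeasure_eq_measure)
    finally show "(\<integral>z. (case z of (P, s) \<Rightarrow> h u P * indicator (E u) s) \<partial>(Q \<Otimes>\<^sub>M letters)) = (\<integral>P. h u P \<partial>Q) / 3 ^ k"
      by simp
  qed
  have "h (map (snd z) [0..<k]) (fst z) = (\<Sum>u\<in>words k. case z of (P, s) \<Rightarrow> h u P * indicator (E u) s)" for z
  proof (cases z)
    case (Pair P s)
    have "map s [0..<k] \<in> words k" by (simp add: words_def)
    then have "(\<Sum>u\<in>words k. h u P * indicator (E u) s) = h (map s [0..<k]) P"
      using finite_words by (subst sum.remove[of _ "map s [0..<k]"]) (auto simp: E_def intro!: sum.neutral)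
    then show ?thesis by (simp add: Pair)
  qed
  then have "(\<integral>z. h (map (snd z) [0..<k]) (fst z) \<partial>(Q \<Otimes>\<^sub>M letters)) =
      (\<Sum>u\<in>words k. \<integral>z. (case z of (P, s) \<Rightarrow> h u P * indicator (E u) s) \<partial>(Q \<Otimes>\<^sub>M letters))"
    using int by simp
  also have "\<dots> = mean k h" unfolding mean_def sum_divide_distrib by (intro sum.cong refl val)
  finally show "(\<integral>z. h (map (snd z) [0..<k]) (fst z) \<partial>(Q \<Otimes>\<^sub>M letters)) = mean k h" .
qed

text \<open>Convergence of the perimeters to zero in L1 yields almost sure convergence along a
  subsequence only. That is enough: the triangles are nested, so one small perimeter controls all
  later corners.\<close>

lemma AE_descent_converges:
  "AE z in Q \<Otimes>\<^sub>M letters. convergent (\<lambda>k. corners (fst z) (map (snd z) [0..<k]) 1)"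
proof -
  define W where "W = (\<lambda>k z. perimeter (corners (fst z) (map (snd z) [0..<k])))"
  have bound: "\<bar>perimeter (corners P u)\<bar> \<le> 3 * diameter filled_triangle" if "P \<in> splits" for P u
    unfolding abs_of_nonneg[OF perimeter_nonneg] by (rule perimeter_bound[OF that])
  have "integrable (Q \<Otimes>\<^sub>M letters) (W k)" for k
    unfolding W_def using bound by (intro integral_descent(1)[where h = "\<lambda>u P. perimeter (corners P u)"]) auto
  moreover have "(\<integral>z. norm (W k z) \<partial>(Q \<Otimes>\<^sub>M letters)) = mean k (\<lambda>u P. perimeter (corners P u))" for k
  proof -
    have "norm (W k z) = W k z" for z by (simp add: W_def perimeter_nonneg)
    then show ?thesis
      unfolding W_def
      using integral_descent(2)[where h = "\<lambda>u P. perimeter (corners P u)", OF perimeter_measurable bound] by simp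
  qed
  then have "(\<lambda>k. \<integral>z. norm (W k z) \<partial>(Q \<Otimes>\<^sub>M letters)) \<longlonglongrightarrow> 0"
    using mean_perimeter_tendsto by simp
  ultimately obtain r :: "nat \<Rightarrow> nat" where r: "AE z in Q \<Otimes>\<^sub>M letters. (\<lambda>n. W (r n) z) \<longlonglongrightarrow> 0"
    using tendsto_L1_AE_subseq[of "Q \<Otimes>\<^sub>M letters" W] by blast
  moreover have "AE z in Q \<Otimes>\<^sub>M letters. fst z \<in> splits"
    by (intro AE_I2) (auto simp: space_pair_measure space_Q)
  ultimately show ?thesis
  proof eventually_elim
    case (elim z)
    obtain P s where z: "z = (P, s)" by (cases z)
    have P: "P w \<in> open_simplex" for w using elim(2) by (simp add: z splits_def)
    let ?Z = "\<lambda>k. corners P (map s [0..<k]) 1"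
    have close: "dist (?Z k) (?Z j) \<le> W k z" if "k \<le> j" for k j
    proof -
      have "map s [0..<j] = map s [0..<k] @ map s [k..<j]"
        using that upt_add_eq_append[of 0 k "j - k"] by simp
      then show ?thesis using cball_corners(1)[where P = P and v = "map s [0..<k]" and w = "map s [k..<j]" and i = 1 and j = 1, OF P] by (simp add: W_def z)
    qed
    have "Cauchy ?Z"
    proof (rule metric_CauchyI)
      fix e :: real assume "0 < e"
      then have "\<forall>\<^sub>F n in sequentially. W (r n) z < e / 2" using elim(1) by (intro order_tendstoD) auto
      then obtain n where n: "W (r n) z < e / 2" by (auto simp: eventually_sequentially)
      show "\<exists>M. \<forall>i\<ge>M. \<forall>j\<ge>M. dist (?Z i) (?Z j) < e"
      proof (intro exI allI impI)
        fix i j assume "r n \<le> i" "r n \<le> j"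
        then show "dist (?Z i) (?Z j) < e"
          using close[of "r n" i] close[of "r n" j] n dist_triangle[of "?Z i" "?Z j" "?Z (r n)"]
          by (simp add: dist_commute)
      qed
    qed
    then show ?case by (simp add: z Cauchy_convergent)
  qed
qed

text \<open>\<open>N\<close> is the law of the limit of corner \<open>1\<close> along the descent;
  the corners share their limit when the perimeters vanish. Dominated convergence carries the almost
  sure limit over to expectations of continuous functions.\<close>

lemma limit_point_exists:
  "\<exists>N. prob_space N \<and> sets N = sets (restrict_space borel filled_triangle) \<and>
    (\<forall>g :: complex \<Rightarrow> real. continuous_on filled_triangle g \<longrightarrow>
      (\<lambda>k. mean k (\<lambda>u P. g (corners P u 1))) \<longlonglongrightarrow> (\<integral>x. g x \<partial>N))"
proof -
  let ?M = "Q \<Otimes>\<^sub>M letters" and ?R = "restrict_space borel filled_triangle"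
  interpret Q: prob_space Q by (rule prob_space_Q)
  interpret L: prob_space letters by (rule prob_space_letters)
  interpret QL: pair_prob_space Q letters ..
  define Z where "Z = (\<lambda>k z. corners (fst z) (map (snd z) [0..<k]) 1)"
  have Z[measurable]: "Z k \<in> borel_measurable ?M" for k
    unfolding Z_def by (rule measurable_descent[where h = "\<lambda>u P. corners P u 1"]) measurable
  have closed[measurable]: "closed filled_triangle" using compact_filled_triangle by (rule compact_imp_closed)
  have tri[measurable]: "filled_triangle \<in> sets borel" using closed by simp
  have zero: "0 \<in> filled_triangle"
    using hull_inc[of "base_corner 1" "range base_corner" convex] by (simp add: filled_triangle_def base_corner_def)
  have Z_tri: "Z k z \<in> filled_triangle" if "z \<in> space ?M" for k z
    using that corners_filled[of "fst z"] by (auto simp: Z_def space_pair_measure space_Q)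
  \<comment> \<open>The default \<open>0\<close> is a corner of the triangle; it keeps
    \<open>Y\<close> in the triangle everywhere. Almost surely the limit exists, and it is in the
    triangle because the triangle is closed.\<close>
  define Y where "Y = (\<lambda>z. if lim (\<lambda>k. Z k z) \<in> filled_triangle then lim (\<lambda>k. Z k z) else 0)"
  have "Y \<in> borel_measurable ?M" unfolding Y_def by measurable
  then have Y: "Y \<in> ?M \<rightarrow>\<^sub>M ?R"
    using zero by (intro measurable_restrict_space2) (auto simp: Y_def)
  have lim: "AE z in ?M. (\<lambda>k. Z k z) \<longlonglongrightarrow> Y z"
    using AE_descent_converges AE_space
  proof eventually_elim
    case (elim z)
    have l: "(\<lambda>k. Z k z) \<longlonglongrightarrow> lim (\<lambda>k. Z k z)"
      using elim(1) unfolding Z_def convergent_LIMSEQ_iff .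
    then have "lim (\<lambda>k. Z k z) \<in> filled_triangle"
      by (rule closed_sequentially[OF closed Z_tri[OF elim(2)]])
    with l show ?case by (simp add: Y_def)
  qed
  have "(\<lambda>k. mean k (\<lambda>u P. g (corners P u 1))) \<longlonglongrightarrow> (\<integral>x. g x \<partial>distr ?M ?R Y)"
    if g: "continuous_on filled_triangle g" for g :: "complex \<Rightarrow> real"
  proof -
    obtain B where B: "\<And>x. x \<in> filled_triangle \<Longrightarrow> \<bar>g x\<bar> \<le> B"
      using compact_imp_bounded[OF compact_continuous_image[OF g compact_filled_triangle]]
      by (auto simp: bounded_iff)
    have gR: "g \<in> borel_measurable ?R" using g by (rule borel_measurable_continuous_on_restrict)
    have gc: "(\<lambda>P. g (corners P u 1)) \<in> borel_measurable Q" for u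
    proof (rule continuous_measurable_split_space[OF sets_nu])
      show "continuous_on splits (\<lambda>P. g (corners P u 1))"
        using corners_filled by (intro continuous_on_compose2[OF g] continuous_on_subset[OF continuous_on_corners]) auto
    qed
    have gZ: "(\<lambda>z. g (Z k z)) \<in> borel_measurable ?M" for k
      unfolding Z_def by (rule measurable_descent[where h = "\<lambda>u P. g (corners P u 1)", OF gc])
    have "(\<lambda>k. \<integral>z. g (Z k z) \<partial>?M) \<longlonglongrightarrow> (\<integral>z. g (Y z) \<partial>?M)"
    proof (rule integral_dominated_convergence[where w = "\<lambda>_. B"])
      show "(\<lambda>z. g (Y z)) \<in> borel_measurable ?M" by (rule measurable_compose[OF Y gR])
      show "AE z in ?M. (\<lambda>k. g (Z k z)) \<longlonglongrightarrow> g (Y z)"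
        using lim AE_space
      proof eventually_elim
        case (elim z)
        have "Y z \<in> filled_triangle" using zero by (simp add: Y_def)
        then show ?case
          using elim Z_tri[OF elim(2)] by (intro continuous_on_tendsto_compose[OF g]) auto
      qed
      show "AE z in ?M. norm (g (Z k z)) \<le> B" for k using B Z_tri by (intro AE_I2) auto
    qed (auto simp: gZ)
    moreover have "(\<integral>z. g (Z k z) \<partial>?M) = mean k (\<lambda>u P. g (corners P u 1))" for k
      unfolding Z_def using B corners_filled
      by (intro integral_descent(2)[where h = "\<lambda>u P. g (corners P u 1)" and B = B] gc) auto
    ultimately show ?thesis using integral_distr[OF Y gR] by simp
  qed
  moreover have "prob_space (distr ?M ?R Y)" by (rule QL.prob_space_distr[OF Y])
  ultimately show ?thesis by (intro exI[of _ "distr ?M ?R Y"]) auto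
qed

end

section \<open>The weak topology and occupation measures\<close>

lemma topspace_weak_topology: "topspace (weak_topology S) = space (prob_algebra (restrict_space borel S))"
proof -
  have "space (prob_algebra (restrict_space borel S)) \<in>
    {{\<mu> \<in> space (prob_algebra (restrict_space borel S)). (\<integral>x. f x \<partial>\<mu>) \<in> W} | (f :: 'a \<Rightarrow> real) W.
        continuous_on S f \<and> bounded (f ` S) \<and> open W}"
    by (intro CollectI exI[of _ "\<lambda>_. 0"] exI[of _ UNIV]) (auto simp: bounded_iff)
  then show ?thesis
    unfolding weak_topology_def topology_generated_by_topspace by (intro subset_antisym Union_upper) auto
qed

lemma continuous_map_into_weak_topology:
  assumes "\<And>x. x \<in> topspace X \<Longrightarrow> \<mu> x \<in> space (prob_algebra (restrict_space borel S))"
    and "\<And>f :: _ \<Rightarrow> real. continuous_on S f \<Longrightarrow> bounded (f ` S) \<Longrightarrow>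
      continuous_map X euclideanreal (\<lambda>x. \<integral>y. f y \<partial>\<mu> x)"
  shows "continuous_map X (weak_topology S) \<mu>"
  unfolding weak_topology_def
proof (rule continuous_on_generated_topo)
  fix U assume "U \<in> {{\<mu> \<in> space (prob_algebra (restrict_space borel S)). (\<integral>x. f x \<partial>\<mu>) \<in> W} | (f :: _ \<Rightarrow> real) W.
        continuous_on S f \<and> bounded (f ` S) \<and> open W}"
  then obtain f :: "_ \<Rightarrow> real" and W where f: "continuous_on S f" "bounded (f ` S)" "open W"
    and U: "U = {\<mu> \<in> space (prob_algebra (restrict_space borel S)). (\<integral>x. f x \<partial>\<mu>) \<in> W}"
    by blast
  have "openin X {x \<in> topspace X. (\<integral>y. f y \<partial>\<mu> x) \<in> W}"
    using openin_continuous_map_preimage[OF assms(2)[OF f(1,2)], of W] f(3) by simp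
  also have "{x \<in> topspace X. (\<integral>y. f y \<partial>\<mu> x) \<in> W} = \<mu> -` U \<inter> topspace X"
    using assms(1) by (auto simp: U)
  finally show "openin X (\<mu> -` U \<inter> topspace X)" .
next
  show "\<mu> ` topspace X \<subseteq> \<Union> {{\<mu> \<in> space (prob_algebra (restrict_space borel S)). (\<integral>x. f x \<partial>\<mu>) \<in> W} | (f :: _ \<Rightarrow> real) W.
        continuous_on S f \<and> bounded (f ` S) \<and> open W}"
    using assms(1) topspace_weak_topology[of S] unfolding weak_topology_def by auto
qed

lemma continuous_map_integral_weak_topology:
  fixes f :: "'a::topological_space \<Rightarrow> real"
  assumes "continuous_on S f" "bounded (f ` S)"
  shows "continuous_map (weak_topology S) euclideanreal (\<lambda>\<mu>. \<integral>x. f x \<partial>\<mu>)"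
proof -
  have "openin (weak_topology S) {\<mu> \<in> topspace (weak_topology S). (\<integral>x. f x \<partial>\<mu>) \<in> W}" if "open W" for W
    unfolding topspace_weak_topology unfolding weak_topology_def
    using assms that by (intro topology_generated_by_Basis) blast
  then show ?thesis by (auto simp: continuous_map_def)
qed

lemma limitin_weak_topology:
  fixes S :: "'a::topological_space set"
  assumes \<mu>: "\<mu> \<in> space (prob_algebra (restrict_space borel S))"
    and \<mu>s: "\<And>n. \<mu>s n \<in> space (prob_algebra (restrict_space borel S))"
    and lim: "\<And>f :: 'a \<Rightarrow> real. continuous_on S f \<Longrightarrow> bounded (f ` S) \<Longrightarrow>
      (\<lambda>n. \<integral>x. f x \<partial>\<mu>s n) \<longlonglongrightarrow> (\<integral>x. f x \<partial>\<mu>)"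
  shows "limitin (weak_topology S) \<mu>s \<mu> sequentially"
proof -
  let ?B = "{{\<mu> \<in> space (prob_algebra (restrict_space borel S)). (\<integral>x. f x \<partial>\<mu>) \<in> W} | (f :: 'a \<Rightarrow> real) W.
        continuous_on S f \<and> bounded (f ` S) \<and> open W}"
  have "\<forall>\<^sub>F n in sequentially. \<mu>s n \<in> U" if "generate_topology_on ?B U" "\<mu> \<in> U" for U
    using that
  proof induction
    case (Int a b)
    then show ?case by (auto intro: eventually_conj)
  next
    case (UN K)
    then obtain k where "k \<in> K" "\<mu> \<in> k" by blast
    with UN.IH have "\<forall>\<^sub>F n in sequentially. \<mu>s n \<in> k" by blast
    then show ?case by (rule eventually_mono) (use \<open>k \<in> K\<close> in blast)
  next
    case (Basis U)
    then obtain f :: "'a \<Rightarrow> real" and W where f: "continuous_on S f" "bounded (f ` S)" "open W"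
      and U: "U = {\<mu> \<in> space (prob_algebra (restrict_space borel S)). (\<integral>x. f x \<partial>\<mu>) \<in> W}"
      by blast
    have "(\<integral>x. f x \<partial>\<mu>) \<in> W" using Basis.prems by (simp add: U)
    then have "\<forall>\<^sub>F n in sequentially. (\<integral>x. f x \<partial>\<mu>s n) \<in> W"
      by (rule topological_tendstoD[OF lim[OF f(1,2)] f(3)])
    then show ?case by (rule eventually_mono) (use \<mu>s in \<open>simp add: U\<close>)
  qed simp
  then show ?thesis
    using \<mu> unfolding limitin_def topspace_weak_topology
    by (auto simp: weak_topology_def dest: openin_topology_generated_by)
qed

section \<open>Dirac measures and concentrated measures on the filled triangle\<close>

abbreviation triangle_borel :: "complex measure" where
  "triangle_borel \<equiv> restrict_space borel filled_triangle"

lemma space_triangle_borel: "space triangle_borel = filled_triangle"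
  by (simp add: space_restrict_space)

lemma bounded_on_triangle:
  fixes f :: "complex \<Rightarrow> real"
  assumes "continuous_on filled_triangle f"
  obtains B where "0 \<le> B" "\<And>x. x \<in> filled_triangle \<Longrightarrow> \<bar>f x\<bar> \<le> B"
proof -
  have "bounded (f ` filled_triangle)"
    by (intro compact_imp_bounded compact_continuous_image assms compact_filled_triangle)
  then obtain B where "\<forall>x\<in>filled_triangle. \<bar>f x\<bar> \<le> B" by (auto simp: bounded_iff)
  then show ?thesis using that[of "max B 0"] by fastforce
qed

lemma return_in_prob_algebra:
  "x \<in> filled_triangle \<Longrightarrow> return triangle_borel x \<in> space (prob_algebra triangle_borel)"
  by (simp add: space_prob_algebra prob_space_return space_triangle_borel)

lemma integral_return_triangle:
  fixes f :: "complex \<Rightarrow> real"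
  assumes "x \<in> filled_triangle" "continuous_on filled_triangle f"
  shows "(\<integral>y. f y \<partial>return triangle_borel x) = f x"
  using assms by (intro integral_return) (auto simp: space_triangle_borel borel_measurable_continuous_on_restrict)

lemma continuous_map_return:
  "continuous_map (top_of_set filled_triangle) (weak_topology filled_triangle) (return triangle_borel)"
proof (rule continuous_map_into_weak_topology)
  show "return triangle_borel x \<in> space (prob_algebra triangle_borel)"
    if "x \<in> topspace (top_of_set filled_triangle)" for x
    using that by (simp add: return_in_prob_algebra)
  fix f :: "complex \<Rightarrow> real" assume f: "continuous_on filled_triangle f"
  then have "continuous_map (top_of_set filled_triangle) euclideanreal f" by simp
  then show "continuous_map (top_of_set filled_triangle) euclideanreal (\<lambda>x. \<integral>y. f y \<partial>return triangle_borel x)"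
    by (rule continuous_map_eq) (simp add: integral_return_triangle f)
qed

text \<open>On the ball the integrand deviates by at most \<open>d\<close>; off the ball it deviates
  by at most \<open>2 * B\<close> on mass at most \<eta>.\<close>

lemma integral_near_point:
  fixes f :: "complex \<Rightarrow> real"
  assumes \<mu>: "\<mu> \<in> space (prob_algebra triangle_borel)" and f: "continuous_on filled_triangle f"
    and B: "\<And>y. y \<in> filled_triangle \<Longrightarrow> \<bar>f y\<bar> \<le> B" and x: "x \<in> filled_triangle"
    and near: "\<And>y. y \<in> filled_triangle \<Longrightarrow> dist x y \<le> \<eta> \<Longrightarrow> \<bar>f y - f x\<bar> \<le> d"
    and mass: "1 - \<eta> \<le> measure \<mu> (cball x \<eta> \<inter> filled_triangle)" and d: "0 \<le> d"
  shows "\<bar>(\<integral>y. f y \<partial>\<mu>) - f x\<bar> \<le> d + 2 * B * \<eta>"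
proof -
  interpret prob_space \<mu> using \<mu> by (simp add: space_prob_algebra)
  have sets: "sets \<mu> = sets triangle_borel" using \<mu> by (simp add: space_prob_algebra)
  have space: "space \<mu> = filled_triangle" using sets_eq_imp_space_eq[OF sets] by (simp add: space_triangle_borel)
  let ?A = "cball x \<eta> \<inter> filled_triangle"
  have A: "?A \<in> sets \<mu>" unfolding sets sets_restrict_space by auto
  have fm: "f \<in> borel_measurable \<mu>"
    using borel_measurable_continuous_on_restrict[OF f] by (simp cong: measurable_cong_sets add: sets)
  have fi: "integrable \<mu> f" by (rule integrable_const_bound[where B = B]) (use B fm in \<open>auto simp: space\<close>)
  have B0: "0 \<le> B" using B[OF x] by simp
  have "\<bar>(\<integral>y. f y \<partial>\<mu>) - f x\<bar> = \<bar>\<integral>y. f y - f x \<partial>\<mu>\<bar>"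
    using fi prob_space by simp
  also have "\<dots> \<le> (\<integral>y. \<bar>f y - f x\<bar> \<partial>\<mu>)" by (rule integral_abs_bound)
  also have "\<dots> \<le> (\<integral>y. d + 2 * B * indicator (space \<mu> - ?A) y \<partial>\<mu>)"
  proof (rule integral_mono)
    show "integrable \<mu> (\<lambda>y. \<bar>f y - f x\<bar>)" using fi by simp
    show "integrable \<mu> (\<lambda>y. d + 2 * B * indicator (space \<mu> - ?A) y)"
    proof (rule integrable_const_bound[where B = "\<bar>d\<bar> + \<bar>2 * B\<bar>"])
      show "(\<lambda>y. d + 2 * B * indicator (space \<mu> - ?A) y) \<in> borel_measurable \<mu>" using A by measurable
    qed (auto simp: indicator_def)
    fix y assume y: "y \<in> space \<mu>"
    show "\<bar>f y - f x\<bar> \<le> d + 2 * B * indicator (space \<mu> - ?A) y"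
    proof (cases "y \<in> ?A")
      case True
      then show ?thesis using near[of y] y by (simp add: space)
    next
      case False
      then show ?thesis using B[of y] B[OF x] y d by (simp add: space)
    qed
  qed
  also have "\<dots> = d + 2 * B * measure \<mu> (space \<mu> - ?A)"
    using A prob_space by (simp add: emeasure_eq_measure)
  also have "\<dots> \<le> d + 2 * B * \<eta>"
    using mass B0 by (intro add_left_mono mult_left_mono) (auto simp: prob_compl[OF A])
  finally show ?thesis .
qed

text \<open>By compactness, continuity of \<open>F\<close> at the Dirac measures is uniform in the base point.\<close>
lemma continuous_near_return:
  assumes F: "continuous_map (weak_topology filled_triangle) euclideanreal F" and "0 < (e :: real)"
  shows "\<exists>\<eta>>0. \<forall>\<mu>\<in>space (prob_algebra triangle_borel). \<forall>x\<in>filled_triangle.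
    1 - \<eta> \<le> measure \<mu> (cball x \<eta> \<inter> filled_triangle) \<longrightarrow> \<bar>F \<mu> - F (return triangle_borel x)\<bar> < e"
proof (rule ccontr)
  assume contra: "\<not> ?thesis"
  define \<eta> where "\<eta> = (\<lambda>k. inverse (real (Suc k)))"
  have \<eta>: "0 < \<eta> k" for k by (simp add: \<eta>_def)
  have "\<exists>\<mu> x. \<mu> \<in> space (prob_algebra triangle_borel) \<and> x \<in> filled_triangle \<and>
      1 - \<eta> k \<le> measure \<mu> (cball x (\<eta> k) \<inter> filled_triangle) \<and> e \<le> \<bar>F \<mu> - F (return triangle_borel x)\<bar>" for k
    using contra \<eta>[of k] by (meson not_less)
  then obtain \<mu> x where \<mu>: "\<And>k. \<mu> k \<in> space (prob_algebra triangle_borel)" and x: "\<And>k. x k \<in> filled_triangle"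
    and mass: "\<And>k. 1 - \<eta> k \<le> measure (\<mu> k) (cball (x k) (\<eta> k) \<inter> filled_triangle)"
    and far: "\<And>k. e \<le> \<bar>F (\<mu> k) - F (return triangle_borel (x k))\<bar>"
    by metis
  \<comment> \<open>Along this subsequence the Dirac measures at \<open>x k\<close> and the measures
    \<open>\<mu> k\<close> both tend to the Dirac measure at \<open>l\<close>, the latter because
    their mass concentrates on shrinking balls. Continuity of \<open>F\<close> then contradicts
    \<open>far\<close>.\<close>
  obtain l r where l: "l \<in> filled_triangle" and r: "strict_mono r" and xl: "(x \<circ> r) \<longlonglongrightarrow> l"
    using compact_filled_triangle x unfolding compact_def by blast
  have \<eta>r: "(\<lambda>k. \<eta> (r k)) \<longlonglongrightarrow> 0"
    using LIMSEQ_subseq_LIMSEQ[OF LIMSEQ_inverse_real_of_nat r] by (simp add: \<eta>_def comp_def)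
  have fx: "(\<lambda>k. f (x (r k))) \<longlonglongrightarrow> f l" if "continuous_on filled_triangle f" for f :: "complex \<Rightarrow> real"
    using xl x l by (intro continuous_on_tendsto_compose[OF that]) (auto simp: comp_def)
  have "limitin (weak_topology filled_triangle) (\<lambda>k. return triangle_borel (x (r k))) (return triangle_borel l) sequentially"
    using fx x l by (intro limitin_weak_topology return_in_prob_algebra) (simp_all add: integral_return_triangle)
  from continuous_map_limit[OF F this]
  have 1: "(\<lambda>k. F (return triangle_borel (x (r k)))) \<longlonglongrightarrow> F (return triangle_borel l)"
    by (simp add: comp_def)
  have "limitin (weak_topology filled_triangle) (\<lambda>k. \<mu> (r k)) (return triangle_borel l) sequentially"
  proof (intro limitin_weak_topology return_in_prob_algebra l \<mu>)
    fix f :: "complex \<Rightarrow> real" assume f: "continuous_on filled_triangle f"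
    obtain B where B: "0 \<le> B" "\<And>y. y \<in> filled_triangle \<Longrightarrow> \<bar>f y\<bar> \<le> B"
      using bounded_on_triangle[OF f] by blast
    have "(\<lambda>k. (\<integral>y. f y \<partial>\<mu> (r k)) - f (x (r k))) \<longlonglongrightarrow> 0"
    proof (rule metric_LIMSEQ_I)
      fix d :: real assume d: "0 < d"
      have "uniformly_continuous_on filled_triangle f"
        by (rule compact_uniformly_continuous[OF f compact_filled_triangle])
      then obtain \<delta> where \<delta>: "0 < \<delta>"
        "\<And>y z. y \<in> filled_triangle \<Longrightarrow> z \<in> filled_triangle \<Longrightarrow> dist y z < \<delta> \<Longrightarrow> \<bar>f y - f z\<bar> < d / 2"
        using d unfolding uniformly_continuous_on_def by (metis dist_real_def half_gt_zero)
      have "(\<lambda>k. 2 * B * \<eta> (r k)) \<longlonglongrightarrow> 2 * B * 0" by (intro tendsto_intros \<eta>r)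
      then have "\<forall>\<^sub>F k in sequentially. 2 * B * \<eta> (r k) < d / 2" using d by (intro order_tendstoD) auto
      moreover have "\<forall>\<^sub>F k in sequentially. \<eta> (r k) < \<delta>" using \<eta>r \<delta>(1) by (rule order_tendstoD)
      ultimately have "\<forall>\<^sub>F k in sequentially. dist ((\<integral>y. f y \<partial>\<mu> (r k)) - f (x (r k))) 0 < d"
      proof eventually_elim
        case (elim k)
        have "\<bar>(\<integral>y. f y \<partial>\<mu> (r k)) - f (x (r k))\<bar> \<le> d / 2 + 2 * B * \<eta> (r k)"
        proof (rule integral_near_point[OF \<mu> f B(2) x _ mass])
          fix y assume "y \<in> filled_triangle" "dist (x (r k)) y \<le> \<eta> (r k)"
          then have "\<bar>f y - f (x (r k))\<bar> < d / 2" using elim by (intro \<delta>(2) x) (auto simp: dist_commute)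
          then show "\<bar>f y - f (x (r k))\<bar> \<le> d / 2" by simp
        qed (use d in auto)
        then show ?case using elim(1) by simp
      qed
      then show "\<exists>N. \<forall>k\<ge>N. dist ((\<integral>y. f y \<partial>\<mu> (r k)) - f (x (r k))) 0 < d"
        by (simp add: eventually_sequentially)
    qed
    from tendsto_add[OF this fx[OF f]]
    show "(\<lambda>k. \<integral>y. f y \<partial>\<mu> (r k)) \<longlonglongrightarrow> (\<integral>y. f y \<partial>return triangle_borel l)"
      by (simp add: integral_return_triangle[OF l f])
  qed
  from continuous_map_limit[OF F this] have 2: "(\<lambda>k. F (\<mu> (r k))) \<longlonglongrightarrow> F (return triangle_borel l)"
    by (simp add: comp_def)
  have "(\<lambda>k. \<bar>F (\<mu> (r k)) - F (return triangle_borel (x (r k)))\<bar>) \<longlonglongrightarrow> \<bar>F (return triangle_borel l) - F (return triangle_borel l)\<bar>"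
    by (intro tendsto_intros 1 2)
  then have "e \<le> \<bar>F (return triangle_borel l) - F (return triangle_borel l)\<bar>"
    by (rule LIMSEQ_le_const) (use far in blast)
  with \<open>0 < e\<close> show False by simp
qed

text \<open>Uniqueness of the coding and injectivity of \<open>vertex P\<close> turn the sum over
  the vertex set into one over nodes. For a fixed tree its integrals are then visibly continuous in
  the splits.\<close>

lemma occupation_measure_triangulation:
  assumes "n \<ge> 1" "t \<in> ternary_trees n" "P \<in> splits"
  shows "occupation_measure n (triangulation t P) =
    distr (uniform_count_measure (internal_nodes t)) triangle_borel (vertex P)"
proof -
  let ?I = "internal_nodes t"
  let ?D = "distr (uniform_count_measure ?I) triangle_borel (vertex P)"
  have t: "finite_tree t" "card ?I = n" using assms(2) by (auto simp: mem_ternary_trees)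
  have fin: "finite ?I" using t(1) by (rule finite_internal_nodes)
  have v: "valid_splits t P" using assms(3) by (rule splits_valid)
  have vert: "vertex P \<in> uniform_count_measure ?I \<rightarrow>\<^sub>M triangle_borel"
    using assms(3) by (auto simp: measurable_def space_triangle_borel sets_uniform_count_measure
        space_uniform_count_measure splits_def intro!: vertex_in_filled_triangle)
  have "1 / of_nat n * (\<Sum>x\<in>internal_vertices (triangulation t P). emeasure (return triangle_borel x) B) = emeasure ?D B"
    if B: "B \<in> sets triangle_borel" for B
  proof -
    have "(\<Sum>x\<in>internal_vertices (triangulation t P). emeasure (return triangle_borel x) B) =
        (\<Sum>u\<in>?I. indicator B (vertex P u))"
      unfolding internal_vertices_triangulation[OF t(1) v]
      using B by (subst sum.reindex[OF inj_on_vertex[OF t(1) v]]) simp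
    also have "\<dots> = of_nat (card {u \<in> ?I. vertex P u \<in> B})"
      using fin by (simp add: indicator_def sum.If_cases Int_def conj_commute)
    finally have L: "1 / of_nat n * (\<Sum>x\<in>internal_vertices (triangulation t P). emeasure (return triangle_borel x) B) =
      1 / of_nat n * of_nat (card {u \<in> ?I. vertex P u \<in> B})" by simp
    have "emeasure ?D B = emeasure (uniform_count_measure ?I) {u \<in> ?I. vertex P u \<in> B}"
      by (subst emeasure_distr[OF vert B]) (simp add: space_uniform_count_measure vimage_def Int_def conj_commute)
    also have "\<dots> = ennreal (card {u \<in> ?I. vertex P u \<in> B} / n)"
      using t fin by (subst emeasure_uniform_count_measure) auto
    also have "\<dots> = 1 / of_nat n * of_nat (card {u \<in> ?I. vertex P u \<in> B})"
    proof -
      have "1 / of_nat n = ennreal (1 / n)"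
        using assms(1) by (simp add: divide_ennreal[symmetric] ennreal_of_nat_eq_real_of_nat)
      then show ?thesis
        by (simp add: ennreal_of_nat_eq_real_of_nat ennreal_mult[symmetric] mult.commute)
    qed
    finally show ?thesis using L by simp
  qed
  then have "occupation_measure n (triangulation t P) = measure_of filled_triangle (sets triangle_borel) (emeasure ?D)"
    unfolding occupation_measure_def
    using sets.space_closed[of triangle_borel] sets.sigma_sets_eq[of triangle_borel]
    unfolding space_triangle_borel by (intro measure_of_eq) simp_all
  also have "\<dots> = ?D"
    using measure_of_of_measure[of ?D] by (simp add: space_triangle_borel)
  finally show ?thesis .
qed

lemma
  assumes "n \<ge> 1" "t \<in> ternary_trees n" "P \<in> splits"
  shows occupation_measure_prob: "occupation_measure n (triangulation t P) \<in> space (prob_algebra triangle_borel)"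
    and integral_occupation_measure: "continuous_on filled_triangle (f :: complex \<Rightarrow> real) \<Longrightarrow>
      (\<integral>x. f x \<partial>occupation_measure n (triangulation t P)) = (\<Sum>u\<in>internal_nodes t. f (vertex P u)) / n"
    and measure_occupation_measure: "A \<in> sets triangle_borel \<Longrightarrow>
      measure (occupation_measure n (triangulation t P)) A = card {u \<in> internal_nodes t. vertex P u \<in> A} / n"
proof -
  let ?I = "internal_nodes t"
  have t: "finite_tree t" "card ?I = n" using assms(2) by (auto simp: mem_ternary_trees)
  have fin: "finite ?I" using t(1) by (rule finite_internal_nodes)
  have vert: "vertex P \<in> uniform_count_measure ?I \<rightarrow>\<^sub>M triangle_borel"
    using assms(3) by (auto simp: measurable_def space_triangle_borel sets_uniform_count_measure
        space_uniform_count_measure splits_def intro!: vertex_in_filled_triangle)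
  have "?I \<noteq> {}" using t assms(1) by auto
  then have "prob_space (uniform_count_measure ?I)" by (intro prob_space_uniform_count_measure fin)
  from prob_space.prob_space_distr[OF this vert]
  show "occupation_measure n (triangulation t P) \<in> space (prob_algebra triangle_borel)"
    unfolding occupation_measure_triangulation[OF assms] by (simp add: space_prob_algebra)
  show "(\<integral>x. f x \<partial>occupation_measure n (triangulation t P)) = (\<Sum>u\<in>?I. f (vertex P u)) / n"
    if "continuous_on filled_triangle f"
    unfolding occupation_measure_triangulation[OF assms]
      integral_distr[OF vert borel_measurable_continuous_on_restrict[OF that]]
      integral_uniform_count_measure[OF fin] t(2) ..
  show "measure (occupation_measure n (triangulation t P)) A = card {u \<in> ?I. vertex P u \<in> A} / n"
    if "A \<in> sets triangle_borel"
    unfolding occupation_measure_triangulation[OF assms] measure_distr[OF vert that]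
    using fin t(2) by (subst measure_uniform_count_measure)
      (auto simp: space_uniform_count_measure vimage_def Int_def conj_commute)
qed

lemma continuous_on_vertex_compose:
  fixes f :: "complex \<Rightarrow> real"
  assumes "continuous_on filled_triangle f"
  shows "continuous_on splits (\<lambda>P. f (vertex P u))"
  using vertex_in_filled_triangle
  by (intro continuous_on_compose2[OF assms] continuous_on_subset[OF continuous_on_vertex]) (auto simp: splits_def)

lemma continuous_map_occupation_measure:
  assumes "n \<ge> 1" "t \<in> ternary_trees n"
  shows "continuous_map (top_of_set splits) (weak_topology filled_triangle) (\<lambda>P. occupation_measure n (triangulation t P))"
proof (rule continuous_map_into_weak_topology)
  show "occupation_measure n (triangulation t P) \<in> space (prob_algebra triangle_borel)"
    if "P \<in> topspace (top_of_set splits)" for P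
    using occupation_measure_prob[OF assms] that by simp
  fix f :: "complex \<Rightarrow> real" assume f: "continuous_on filled_triangle f"
  have "continuous_on splits (\<lambda>P. (\<Sum>u\<in>internal_nodes t. f (vertex P u)) / n)"
    using assms(1) by (intro continuous_intros continuous_on_vertex_compose f) auto
  then have "continuous_map (top_of_set splits) euclideanreal (\<lambda>P. (\<Sum>u\<in>internal_nodes t. f (vertex P u)) / n)"
    by simp
  then show "continuous_map (top_of_set splits) euclideanreal (\<lambda>P. \<integral>x. f x \<partial>occupation_measure n (triangulation t P))"
    by (rule continuous_map_eq) (simp add: integral_occupation_measure[OF assms _ f])
qed

lemma measurable_occupation_measure:
  assumes "n \<ge> 1"
  shows "occupation_measure n \<in> triangulation_space n \<rightarrow>\<^sub>M borel_of (weak_topology filled_triangle)"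
  by (rule measurable_on_triangulation_space[OF continuous_map_occupation_measure[OF assms]]) auto

section \<open>Convergence\<close>

lemma concentrated_mono: "K \<le> K' \<Longrightarrow> concentrated n v K \<subseteq> concentrated n v K'"
  by (auto simp: concentrated_def)

lemma finite_concentrated: "finite (concentrated n v K)"
  by (rule finite_subset[OF _ finite_ternary_trees]) (auto simp: concentrated_def)

context splitting
begin

section \<open>Limits of functionals of the occupation measure\<close>

lemma integrable_continuous_Q:
  fixes f :: "(word \<Rightarrow> real ^ 3) \<Rightarrow> real"
  assumes "continuous_on splits f" "\<And>P. P \<in> splits \<Longrightarrow> \<bar>f P\<bar> \<le> B"
  shows "integrable Q f"
  using assms by (intro integrable_Q continuous_measurable_split_space[OF sets_nu])

lemma continuous_on_return_corner:
  assumes "continuous_map (weak_topology filled_triangle) euclideanreal F"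
  shows "continuous_on splits (\<lambda>P. F (return triangle_borel (corners P u 1)))"
proof -
  have "continuous_map (top_of_set splits) (top_of_set filled_triangle) (\<lambda>P. corners P u 1)"
    using corners_filled continuous_on_subset[OF continuous_on_corners] by (auto simp: continuous_map_in_subtopology)
  from continuous_map_compose[OF continuous_map_compose[OF this continuous_map_return] assms]
  show ?thesis by (simp add: comp_def)
qed

lemma continuous_on_occupation_measure:
  assumes "continuous_map (weak_topology filled_triangle) euclideanreal F" "n \<ge> 1" "t \<in> ternary_trees n"
  shows "continuous_on splits (\<lambda>P. F (occupation_measure n (triangulation t P)))"
  using continuous_map_compose[OF continuous_map_occupation_measure[OF assms(2,3)] assms(1)] by (simp add: comp_def)

lemma condensation_lower_bound:
  assumes F: "continuous_map (weak_topology filled_triangle) euclideanreal F"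
    and F0: "\<And>\<mu>. \<mu> \<in> space (prob_algebra triangle_borel) \<Longrightarrow> 0 \<le> F \<mu>"
    and FB: "\<And>\<mu>. \<mu> \<in> space (prob_algebra triangle_borel) \<Longrightarrow> F \<mu> \<le> B"
    and I: "(\<lambda>k. mean k (\<lambda>u P. F (return triangle_borel (corners P u 1)))) \<longlonglongrightarrow> I"
    and "0 < (e :: real)"
  shows "\<forall>\<^sub>F n in sequentially.
    I - e \<le> (\<Sum>t\<in>ternary_trees n. \<integral>P. F (occupation_measure n (triangulation t P)) \<partial>Q) / tree_count n"
proof -
  interpret Q: prob_space Q by (rule prob_space_Q)
  define g where "g = (\<lambda>u P. F (return triangle_borel (corners P u 1)))"
  have B0: "0 \<le> B"
    using F0 FB return_in_prob_algebra corners_filled[of "\<lambda>_. uniform_point" "[]" 1] uniform_point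
    by (fastforce simp: splits_def intro: order_trans)
  obtain \<eta> where \<eta>: "0 < \<eta>"
    "\<And>\<mu> x. \<mu> \<in> space (prob_algebra triangle_borel) \<Longrightarrow> x \<in> filled_triangle \<Longrightarrow>
      1 - \<eta> \<le> measure \<mu> (cball x \<eta> \<inter> filled_triangle) \<Longrightarrow> \<bar>F \<mu> - F (return triangle_borel x)\<bar> < e / 4"
    using continuous_near_return[OF F, of "e / 4"] \<open>0 < e\<close> by auto
  define q where "q = (\<lambda>u. measure Q {P \<in> space Q. \<eta> \<le> perimeter (corners P u)})"
  have "(\<lambda>k. B * (mean k (\<lambda>u P. perimeter (corners P u)) / \<eta>)) \<longlonglongrightarrow> B * (0 / \<eta>)"
    using \<eta>(1) by (intro tendsto_intros mean_perimeter_tendsto) simp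
  then have "\<forall>\<^sub>F k in sequentially. B * (mean k (\<lambda>u P. perimeter (corners P u)) / \<eta>) < e / 4"
    using \<open>0 < e\<close> by (intro order_tendstoD) auto
  moreover have "\<forall>\<^sub>F k in sequentially. I - e / 4 < mean k g"
    using I \<open>0 < e\<close> unfolding g_def by (intro order_tendstoD) auto
  ultimately have "\<forall>\<^sub>F k in sequentially. B * (mean k (\<lambda>u P. perimeter (corners P u)) / \<eta>) < e / 4 \<and> I - e / 4 < mean k g"
    by (rule eventually_conj)
  then obtain k where k: "B * (mean k (\<lambda>u P. perimeter (corners P u)) / \<eta>) < e / 4" "I - e / 4 < mean k g"
    by (auto simp: eventually_sequentially)
  \<comment> \<open>The average over \<open>v\<close> of the bounds \<open>R v\<close> introduced
    below: \<open>e / 4\<close> pays for the continuity of \<open>F\<close> near Dirac measures, the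
    last term for words whose triangle is still large.\<close>
  define Y where "Y = mean k g - e / 4 - B * ((\<Sum>u\<in>words k. q u) / 3 ^ k)"
  have "B * ((\<Sum>u\<in>words k. q u) / 3 ^ k) \<le> B * (mean k (\<lambda>u P. perimeter (corners P u)) / \<eta>)"
    unfolding q_def by (intro mult_left_mono measure_large_triangle_le \<eta>(1) B0)
  then have Y: "I - 3 * e / 4 \<le> Y" using k unfolding Y_def by linarith
  have g_bounds: "0 \<le> g u P" "g u P \<le> B" if "P \<in> splits" for u P
    using F0 FB return_in_prob_algebra corners_filled[OF that] by (simp_all add: g_def)
  have g_int: "integrable Q (g u)" for u
    using g_bounds unfolding g_def
    by (intro integrable_continuous_Q[where B = B] continuous_on_return_corner F) auto
  have q_sets: "{P \<in> space Q. \<eta> \<le> perimeter (corners P u)} \<in> sets Q" for u by measurable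
  have "mean k g \<le> B"
  proof -
    have "(\<integral>P. g u P \<partial>Q) \<le> (\<integral>P. B \<partial>Q)" for u
      using g_int g_bounds by (intro integral_mono) (auto simp: space_Q)
    then have "(\<Sum>u\<in>words k. \<integral>P. g u P \<partial>Q) \<le> (\<Sum>u\<in>words k. B)"
      using Q.prob_space by (intro sum_mono) simp
    then show ?thesis by (simp add: mean_def card_words divide_le_eq mult.commute)
  qed
  moreover have "0 \<le> B * ((\<Sum>u\<in>words k. q u) / 3 ^ k)"
    using B0 by (intro mult_nonneg_nonneg divide_nonneg_nonneg sum_nonneg) (auto simp: q_def)
  ultimately have YB: "Y \<le> B" using \<open>0 < e\<close> by (simp add: Y_def)
  \<comment> \<open>The relative loss allowed in each proportion, costing at most
    \<open>e / 4\<close> in total; \<open>B + 1\<close> avoids division by zero, and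
    \<open>1 / 2\<close> keeps \<open>1 - \<theta>\<close> positive.\<close>
  define \<theta> where "\<theta> = min (1 / 2) (e / (4 * (B + 1)))"
  have \<theta>: "0 < \<theta>" "\<theta> < 1" using \<open>0 < e\<close> B0 by (auto simp: \<theta>_def)
  have "\<theta> * B \<le> e / (4 * (B + 1)) * B" using B0 by (intro mult_right_mono) (auto simp: \<theta>_def)
  also have "\<dots> \<le> e / 4" using B0 \<open>0 < e\<close> by (simp add: divide_simps)
  finally have \<theta>B: "\<theta> * B \<le> e / 4" .
  define c where "c = (1 - \<theta>) / 3 ^ k"
  have c: "0 \<le> c" "c < (1 / 3) ^ k" using \<theta> by (auto simp: c_def power_one_over divide_strict_right_mono)
  have "\<forall>v\<in>words k. \<exists>K. \<forall>\<^sub>F n in sequentially. c * tree_count n \<le> real (card (concentrated n v K))"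
    using concentrated_proportion c by (simp add: words_def)
  then obtain Kv where Kv: "\<forall>v\<in>words k. \<forall>\<^sub>F n in sequentially. c * tree_count n \<le> real (card (concentrated n v (Kv v)))"
    by metis
  \<comment> \<open>One constant for all words of length \<open>k\<close>; the sum is merely a
    convenient upper bound.\<close>
  define K where "K = (\<Sum>v\<in>words k. Kv v)"
  have KvK: "Kv v \<le> K" if "v \<in> words k" for v
    unfolding K_def using that finite_words by (intro member_le_sum) auto
  have "\<forall>\<^sub>F n in sequentially. \<forall>v\<in>words k. c * tree_count n \<le> real (card (concentrated n v K))"
  proof (intro eventually_ball_finite finite_words ballI)
    fix v assume v: "v \<in> words k"
    from Kv v have "\<forall>\<^sub>F n in sequentially. c * tree_count n \<le> real (card (concentrated n v (Kv v)))" by blast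
    then show "\<forall>\<^sub>F n in sequentially. c * tree_count n \<le> real (card (concentrated n v K))"
    proof eventually_elim
      case (elim n)
      have "card (concentrated n v (Kv v)) \<le> card (concentrated n v K)"
        by (intro card_mono finite_concentrated concentrated_mono KvK v)
      with elim show ?case by linarith
    qed
  qed
  \<comment> \<open>This makes the classes disjoint; the next condition makes the \<open>K\<close>
    exceptional nodes at most a fraction \<eta> of all.\<close>
  moreover have "\<forall>\<^sub>F n in sequentially. 2 * K < n \<and> 1 \<le> n"
    using eventually_gt_at_top[of "2 * K"] by eventually_elim auto
  moreover have "\<forall>\<^sub>F n in sequentially. real K / \<eta> \<le> real n"
    using filterlim_real_sequentially unfolding filterlim_at_top by blast
  ultimately show ?thesis
  proof eventually_elim
    case (elim n)
    define h where "h = (\<lambda>t P. F (occupation_measure n (triangulation t P)))"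
    define R where "R = (\<lambda>v. (\<integral>P. g v P \<partial>Q) - e / 4 - B * q v)"
    have n: "1 \<le> n" "0 < real n" using elim by auto
    have h_bounds: "0 \<le> h t P" "h t P \<le> B" if "t \<in> ternary_trees n" "P \<in> splits" for t P
      using F0 FB occupation_measure_prob[OF n(1) that] by (simp_all add: h_def)
    have h_int: "integrable Q (h t)" if t: "t \<in> ternary_trees n" for t
      using h_bounds[OF t] unfolding h_def
      by (intro integrable_continuous_Q[where B = B] continuous_on_occupation_measure[OF F n(1) t]) auto
    \<comment> \<open>For a large triangle the indicator makes the bound trivial, as
      \<open>g v P \<le> B\<close> and \<open>0 \<le> h t P\<close>. For a small one, at least
      \<open>n - K\<close> vertices are within \<eta> of corner \<open>1\<close> at
      \<open>v\<close>.\<close>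
    have pointwise: "g v P - e / 4 - B * indicator {P \<in> space Q. \<eta> \<le> perimeter (corners P v)} P \<le> h t P"
      if t: "t \<in> concentrated n v K" and P: "P \<in> splits" for t v P
    proof (cases "\<eta> \<le> perimeter (corners P v)")
      case True
      have "t \<in> ternary_trees n" using t by (simp add: concentrated_def)
      then show ?thesis
        using True P g_bounds[OF P, of v] h_bounds[of t P] \<open>0 < e\<close> by (simp add: space_Q)
    next
      case False
      have t': "t \<in> ternary_trees n" and cardt: "n \<le> card {w. v @ w \<in> internal_nodes t} + K"
        using t by (auto simp: concentrated_def)
      have fin: "finite (internal_nodes t)" using t' by (auto simp: mem_ternary_trees finite_internal_nodes)
      let ?x = "corners P v 1"
      let ?A = "cball ?x \<eta> \<inter> filled_triangle"
      have Pw: "P w \<in> open_simplex" for w using P by (simp add: splits_def)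
      have "vertex P (v @ w) \<in> ?A" for w
        using cball_corners(2)[where P = P and v = v and w = w and j = 1, OF Pw]
          vertex_in_filled_triangle[where P = P, OF Pw] False by auto
      then have "(@) v ` {w. v @ w \<in> internal_nodes t} \<subseteq> {u \<in> internal_nodes t. vertex P u \<in> ?A}" by auto
      then have "card ((@) v ` {w. v @ w \<in> internal_nodes t}) \<le> card {u \<in> internal_nodes t. vertex P u \<in> ?A}"
        using fin by (intro card_mono) auto
      moreover have "card ((@) v ` {w. v @ w \<in> internal_nodes t}) = card {w. v @ w \<in> internal_nodes t}"
        by (simp add: card_image inj_on_def)
      ultimately have "real n - real K \<le> real (card {u \<in> internal_nodes t. vertex P u \<in> ?A})"
        using cardt by linarith
      moreover have "real K \<le> \<eta> * real n" using elim(3) \<eta>(1) by (simp add: divide_le_eq mult.commute)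
      ultimately have "(1 - \<eta>) * real n \<le> real (card {u \<in> internal_nodes t. vertex P u \<in> ?A})"
        by (simp add: algebra_simps)
      then have "1 - \<eta> \<le> real (card {u \<in> internal_nodes t. vertex P u \<in> ?A}) / real n"
        using n by (simp add: le_divide_eq)
      moreover have "?A \<in> sets triangle_borel"
        unfolding sets_restrict_space by (rule image_eqI[of _ _ "cball ?x \<eta>"]) (simp_all add: Int_commute)
      ultimately have "1 - \<eta> \<le> measure (occupation_measure n (triangulation t P)) ?A"
        by (simp add: measure_occupation_measure[OF n(1) t' P])
      then have "\<bar>h t P - g v P\<bar> < e / 4"
        unfolding h_def g_def by (intro \<eta>(2) occupation_measure_prob[OF n(1) t' P] corners_filled[OF P])
      then have "g v P - e / 4 \<le> h t P" by linarith
      then show ?thesis using False by simp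
    qed
    have lower: "R v \<le> (\<integral>P. h t P \<partial>Q)" if t: "t \<in> concentrated n v K" for t v
    proof -
      have ind: "integrable Q (indicator {P \<in> space Q. \<eta> \<le> perimeter (corners P v)} :: _ \<Rightarrow> real)"
        using q_sets by (intro integrable_real_indicator) (auto simp: Q.emeasure_eq_measure)
      have "R v = (\<integral>P. g v P - e / 4 - B * indicator {P \<in> space Q. \<eta> \<le> perimeter (corners P v)} P \<partial>Q)"
        using g_int[of v] ind q_sets[of v] Q.prob_space by (simp add: R_def q_def)
      also have "\<dots> \<le> (\<integral>P. h t P \<partial>Q)"
        using g_int[of v] ind h_int[of t] pointwise[OF t] t
        by (intro integral_mono) (auto simp: space_Q concentrated_def)
      finally show ?thesis .
    qed
    have nonneg: "0 \<le> (\<integral>P. h t P \<partial>Q)" if "t \<in> ternary_trees n" for t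
      using h_bounds[OF that] by (intro integral_nonneg_AE AE_I2) (simp add: space_Q)
    have sub: "(\<Union>v\<in>words k. concentrated n v K) \<subseteq> ternary_trees n" by (auto simp: concentrated_def)
    \<comment> \<open>\<open>R v\<close> may be negative, while the class sizes are bounded only
      from below. The positive part allows the replacement, and nonnegativity of the integrals keeps
      it a lower bound for them.\<close>
    have "c * tree_count n * (\<Sum>v\<in>words k. R v) \<le> (\<Sum>v\<in>words k. c * tree_count n * max 0 (R v))"
      unfolding sum_distrib_left using c(1) tree_count_nonneg[of n]
      by (intro sum_mono mult_left_mono mult_nonneg_nonneg) auto
    also have "\<dots> \<le> (\<Sum>v\<in>words k. real (card (concentrated n v K)) * max 0 (R v))"
      using elim(1) by (intro sum_mono mult_right_mono) auto
    also have "\<dots> = (\<Sum>v\<in>words k. \<Sum>t\<in>concentrated n v K. max 0 (R v))" by simp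
    also have "\<dots> \<le> (\<Sum>v\<in>words k. \<Sum>t\<in>concentrated n v K. \<integral>P. h t P \<partial>Q)"
      using lower nonneg by (intro sum_mono) (auto simp: concentrated_def)
    also have "\<dots> = (\<Sum>t\<in>(\<Union>v\<in>words k. concentrated n v K). \<integral>P. h t P \<partial>Q)"
    proof (rule sum.UNION_disjoint[symmetric])
      show "\<forall>v\<in>words k. \<forall>w\<in>words k. v \<noteq> w \<longrightarrow> concentrated n v K \<inter> concentrated n w K = {}"
        using elim(2) disjoint_concentrated[of _ _ K n] by (simp add: words_def)
    qed (auto simp: finite_words finite_concentrated)
    also have "\<dots> \<le> (\<Sum>t\<in>ternary_trees n. \<integral>P. h t P \<partial>Q)"
      using nonneg by (intro sum_mono2 finite_ternary_trees sub) auto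
    finally have main: "c * tree_count n * (\<Sum>v\<in>words k. R v) \<le> (\<Sum>t\<in>ternary_trees n. \<integral>P. h t P \<partial>Q)" .
    have "(\<Sum>v\<in>words k. R v) = (\<Sum>v\<in>words k. \<integral>P. g v P \<partial>Q) - 3 ^ k * (e / 4) - B * (\<Sum>v\<in>words k. q v)"
      by (simp add: R_def sum_subtractf card_words sum_distrib_left)
    also have "\<dots> = 3 ^ k * Y" by (simp add: Y_def mean_def right_diff_distrib)
    finally have "c * (\<Sum>v\<in>words k. R v) = (1 - \<theta>) * Y" by (simp add: c_def)
    moreover have "c * tree_count n * (\<Sum>v\<in>words k. R v) = c * (\<Sum>v\<in>words k. R v) * tree_count n" by simp
    ultimately have "(1 - \<theta>) * Y * tree_count n \<le> (\<Sum>t\<in>ternary_trees n. \<integral>P. h t P \<partial>Q)"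
      using main by (simp only:)
    then have "(1 - \<theta>) * Y \<le> (\<Sum>t\<in>ternary_trees n. \<integral>P. h t P \<partial>Q) / tree_count n"
      using tree_count_pos[of n] by (simp add: le_divide_eq)
    \<comment> \<open>The losses add up: \<open>3 * e / 4\<close> is already in \<open>Y\<close>,
      and \<open>\<theta> * Y \<le> \<theta> * B \<le> e / 4\<close>.\<close>
    moreover have "I - e \<le> (1 - \<theta>) * Y"
    proof -
      have "\<theta> * Y \<le> \<theta> * B" using \<theta> YB by (intro mult_left_mono) auto
      then show ?thesis using Y \<theta>B by (simp add: algebra_simps)
    qed
    ultimately show ?case by (simp add: h_def)
  qed
qed

text \<open>The lower bound applied to \<open>B + F\<close> and to \<open>B - F\<close>, both with
  values between \<open>0\<close> and \<open>2 * B\<close>, bounds the averages of \<open>F\<close>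
  from both sides.\<close>

lemma condensation:
  assumes F: "continuous_map (weak_topology filled_triangle) euclideanreal F"
    and B: "\<And>\<mu>. \<mu> \<in> space (prob_algebra triangle_borel) \<Longrightarrow> \<bar>F \<mu>\<bar> \<le> B"
    and I: "(\<lambda>k. mean k (\<lambda>u P. F (return triangle_borel (corners P u 1)))) \<longlonglongrightarrow> I"
  shows "(\<lambda>n. (\<Sum>t\<in>ternary_trees n. \<integral>P. F (occupation_measure n (triangulation t P)) \<partial>Q) / tree_count n) \<longlonglongrightarrow> I"
proof -
  interpret Q: prob_space Q by (rule prob_space_Q)
  define A where "A = (\<lambda>n. (\<Sum>t\<in>ternary_trees n. \<integral>P. F (occupation_measure n (triangulation t P)) \<partial>Q) / tree_count n)"
  have gi: "integrable Q (\<lambda>P. F (return triangle_borel (corners P u 1)))" for u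
    using B[OF return_in_prob_algebra[OF corners_filled]]
    by (intro integrable_continuous_Q[where B = B] continuous_on_return_corner F)
  have hi: "integrable Q (\<lambda>P. F (occupation_measure n (triangulation t P)))" if "n \<ge> 1" "t \<in> ternary_trees n" for n t
    using B[OF occupation_measure_prob[OF that]]
    by (intro integrable_continuous_Q[where B = B] continuous_on_occupation_measure[OF F that])
  have lower: "\<forall>\<^sub>F n in sequentially. s * I - e \<le> s * A n" if s: "s \<in> {- 1, 1}" and e: "0 < e" for s e :: real
  proof -
    have mean_eq: "mean k (\<lambda>u P. B + s * F (return triangle_borel (corners P u 1))) =
        B + s * mean k (\<lambda>u P. F (return triangle_borel (corners P u 1)))" for k
      using gi Q.prob_space
      by (simp add: mean_def sum.distrib card_words sum_distrib_left[symmetric] add_divide_distrib)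
    have "\<forall>\<^sub>F n in sequentially. B + s * I - e \<le>
      (\<Sum>t\<in>ternary_trees n. \<integral>P. B + s * F (occupation_measure n (triangulation t P)) \<partial>Q) / tree_count n"
    proof (rule condensation_lower_bound[where B = "2 * B"])
      show "continuous_map (weak_topology filled_triangle) euclideanreal (\<lambda>\<mu>. B + s * F \<mu>)"
        by (intro continuous_map_add continuous_map_real_mult_left F) simp
      show "0 \<le> B + s * F \<mu>" "B + s * F \<mu> \<le> 2 * B" if "\<mu> \<in> space (prob_algebra triangle_borel)" for \<mu>
        using B[OF that] s by auto
      show "(\<lambda>k. mean k (\<lambda>u P. B + s * F (return triangle_borel (corners P u 1)))) \<longlonglongrightarrow> B + s * I"
        unfolding mean_eq by (intro tendsto_intros I)
    qed (rule e)
    moreover have "\<forall>\<^sub>F n :: nat in sequentially. 1 \<le> n" by (rule eventually_ge_at_top)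
    ultimately show ?thesis
    proof eventually_elim
      case (elim n)
      have "(\<Sum>t\<in>ternary_trees n. \<integral>P. B + s * F (occupation_measure n (triangulation t P)) \<partial>Q) =
          tree_count n * B + s * (\<Sum>t\<in>ternary_trees n. \<integral>P. F (occupation_measure n (triangulation t P)) \<partial>Q)"
        using hi[OF elim(2)] Q.prob_space
        by (simp add: sum.distrib sum_distrib_left tree_count_def)
      then have "(\<Sum>t\<in>ternary_trees n. \<integral>P. B + s * F (occupation_measure n (triangulation t P)) \<partial>Q) / tree_count n =
          B + s * A n"
        using tree_count_pos[of n] by (simp add: A_def add_divide_distrib)
      with elim(1) show ?case by simp
    qed
  qed
  have "A \<longlonglongrightarrow> I"
  proof (rule tendstoI)
    fix e :: real assume e: "0 < e"
    then have "\<forall>\<^sub>F n in sequentially. 1 * I - e / 2 \<le> 1 * A n" "\<forall>\<^sub>F n in sequentially. - 1 * I - e / 2 \<le> - 1 * A n"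
      by (intro lower; simp)+
    then show "\<forall>\<^sub>F n in sequentially. dist (A n) I < e"
    proof eventually_elim
      case (elim n)
      then show ?case using e unfolding dist_real_def by linarith
    qed
  qed
  then show ?thesis by (simp only: A_def)
qed

section \<open>From codes to the laws of triangulations and of uniform vertices\<close>

lemma prob_space_uniform_trees: "prob_space (uniform_count_measure (ternary_trees n))"
  using tree_count_pos[of n] finite_ternary_trees[of n]
  by (intro prob_space_uniform_count_measure) (auto simp: tree_count_def)

lemma integral_triangulation_law:
  assumes G: "G \<in> borel_measurable (triangulation_space n)"
    and B: "\<And>t P. t \<in> ternary_trees n \<Longrightarrow> P \<in> splits \<Longrightarrow> \<bar>G (triangulation t P)\<bar> \<le> (B :: real)"
  shows "(\<integral>x. G x \<partial>triangulation_law \<nu> n) = (\<Sum>t\<in>ternary_trees n. \<integral>P. G (triangulation t P) \<partial>Q) / tree_count n"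
proof -
  interpret Q: prob_space Q by (rule prob_space_Q)
  interpret T: prob_space "uniform_count_measure (ternary_trees n)" by (rule prob_space_uniform_trees)
  interpret TQ: pair_prob_space "uniform_count_measure (ternary_trees n)" Q ..
  let ?M = "uniform_count_measure (ternary_trees n) \<Otimes>\<^sub>M Q"
  note tri = measurable_triangulation[OF sets_nu, of n]
  have sp: "space ?M = ternary_trees n \<times> splits"
    by (simp add: space_pair_measure space_Q space_uniform_count_measure)
  have "(\<integral>x. G x \<partial>triangulation_law \<nu> n) = (\<integral>z. G (case z of (t, P) \<Rightarrow> triangulation t P) \<partial>?M)"
    unfolding triangulation_law_def split_space_def[symmetric] by (rule integral_distr[OF tri G])
  also have "\<dots> = (\<integral>t. \<integral>P. G (case (t, P) of (t, P) \<Rightarrow> triangulation t P) \<partial>Q \<partial>uniform_count_measure (ternary_trees n))"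
    by (rule TQ.integral_fst'[symmetric], rule TQ.integrable_const_bound[where B = B])
       (use measurable_compose[OF tri G] B in \<open>auto simp: sp\<close>)
  also have "\<dots> = (\<Sum>t\<in>ternary_trees n. \<integral>P. G (triangulation t P) \<partial>Q) / tree_count n"
    by (simp add: integral_uniform_count_measure[OF finite_ternary_trees] tree_count_def)
  finally show ?thesis .
qed

end

text \<open>The link between the two assertions: the mean of \<open>f\<close> at a uniform vertex is
  an integral against the occupation measure, since there are exactly \<open>n\<close>
  vertices.\<close>

lemma internal_vertices_average:
  fixes f :: "complex \<Rightarrow> real"
  assumes "m \<in> compact_triangulations n" "n \<ge> 1"
  shows "finite (internal_vertices m)" "internal_vertices m \<noteq> {}"
    and "continuous_on filled_triangle f \<Longrightarrow>
      (\<Sum>x\<in>internal_vertices m. f x) / card (internal_vertices m) = (\<integral>x. f x \<partial>occupation_measure n m)"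
proof -
  obtain t j P where t: "t \<in> ternary_trees n" and "P \<in> code_box t j" and m: "m = triangulation t P"
    using assms(1) unfolding compact_triangulations_iff by blast
  then have P: "P \<in> splits" using code_box_subset by blast
  have ft: "finite_tree t" and card: "card (internal_nodes t) = n" using t by (auto simp: mem_ternary_trees)
  note V = internal_vertices_triangulation[OF ft splits_valid[OF P]] and inj = inj_on_vertex[OF ft splits_valid[OF P]]
  have cV: "card (internal_vertices m) = n" unfolding m V card_image[OF inj] by (rule card)
  show "finite (internal_vertices m)" unfolding m V using finite_internal_nodes[OF ft] by simp
  show "internal_vertices m \<noteq> {}" using cV assms(2) by auto
  assume f: "continuous_on filled_triangle f"
  show "(\<Sum>x\<in>internal_vertices m. f x) / card (internal_vertices m) = (\<integral>x. f x \<partial>occupation_measure n m)"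
    unfolding cV unfolding m V integral_occupation_measure[OF assms(2) t P f] by (simp add: sum.reindex[OF inj])
qed

text \<open>
  The conditional law is only known for one Borel set at a time, up to null sets, so \<open>f\<close> is
  approximated by functions with finitely many values.
\<close>
lemma conditionally_uniform_expectation:
  fixes f :: "'b::topological_space \<Rightarrow> real"
  assumes "prob_space \<Omega>" and X: "X \<in> \<Omega> \<rightarrow>\<^sub>M R"
    and cu: "conditionally_uniform \<Omega> R X V U"
    and V: "\<And>\<omega>. \<omega> \<in> space \<Omega> \<Longrightarrow> finite (V (X \<omega>)) \<and> V (X \<omega>) \<noteq> {}"
    and f: "f \<in> borel_measurable borel" and bound: "\<And>x. \<bar>f x\<bar> \<le> B"
    and avg: "(\<lambda>\<omega>. (\<Sum>x\<in>V (X \<omega>). f x) / card (V (X \<omega>))) \<in> borel_measurable \<Omega>"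
  shows "(\<integral>\<omega>. f (U \<omega>) \<partial>\<Omega>) = (\<integral>\<omega>. (\<Sum>x\<in>V (X \<omega>). f x) / card (V (X \<omega>)) \<partial>\<Omega>)"
proof -
  interpret prob_space \<Omega> by fact
  let ?G = "vimage_algebra (space \<Omega>) X R"
  have "subalgebra \<Omega> ?G"
    unfolding subalgebra_def using X
    by (auto simp: sets_vimage_algebra2 measurable_space measurable_sets)
  then interpret finite_measure_subalgebra \<Omega> ?G
    by unfold_locales
  have U: "U \<in> borel_measurable \<Omega>" using cu by (simp add: conditionally_uniform_def)
  let ?avg = "\<lambda>f \<omega>. (\<Sum>x\<in>V (X \<omega>). f x) / card (V (X \<omega>))"
  have fU: "integrable \<Omega> (\<lambda>\<omega>. f (U \<omega>))"
    using measurable_compose[OF U f] bound by (intro integrable_const_bound[where B = B]) auto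
  have avg_le: "\<bar>?avg f1 \<omega> - ?avg f2 \<omega>\<bar> \<le> d" if "\<omega> \<in> space \<Omega>" "\<And>x. \<bar>f1 x - f2 x\<bar> \<le> d" for f1 f2 :: "'b \<Rightarrow> real" and \<omega> d
  proof -
    have c: "0 < real (card (V (X \<omega>)))" using V[OF that(1)] by (simp add: card_gt_0_iff)
    have "\<bar>(\<Sum>x\<in>V (X \<omega>). f1 x) - (\<Sum>x\<in>V (X \<omega>). f2 x)\<bar> \<le> (\<Sum>x\<in>V (X \<omega>). \<bar>f1 x - f2 x\<bar>)"
      unfolding sum_subtractf[symmetric] by (rule sum_abs)
    also have "\<dots> \<le> (\<Sum>x\<in>V (X \<omega>). d)" by (intro sum_mono that)
    finally have "\<bar>(\<Sum>x\<in>V (X \<omega>). f1 x) - (\<Sum>x\<in>V (X \<omega>). f2 x)\<bar> \<le> d * card (V (X \<omega>))"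
      by (simp add: mult.commute)
    then show ?thesis using c by (simp add: diff_divide_distrib[symmetric] abs_divide divide_le_eq)
  qed
  have avg_int: "integrable \<Omega> (?avg f)"
    using avg avg_le[of _ f "\<lambda>_. 0" B] bound by (intro integrable_const_bound[where B = B]) auto
  have "\<bar>(\<integral>\<omega>. f (U \<omega>) \<partial>\<Omega>) - (\<integral>\<omega>. ?avg f \<omega> \<partial>\<Omega>)\<bar> \<le> 2 * inverse (real (Suc N))" for N
  proof -
    define M where "M = real (Suc N)"
    have M: "0 < M" by (simp add: M_def)
    define J where "J = {\<lfloor>- M * B\<rfloor>..\<lfloor>M * B\<rfloor>}"
    define A where "A = (\<lambda>j :: int. {x. \<lfloor>M * f x\<rfloor> = j})"
    \<comment> \<open>\<open>f\<close> rounded down to multiples of \<open>1 / M\<close>. Its level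
      sets are the \<open>A j\<close>, and since \<open>f\<close> is bounded by \<open>B\<close>
      only the finitely many \<open>j\<close> in \<open>J\<close> occur; so finitely many null sets
      arise. Rounding costs at most \<open>1 / M\<close> for \<open>f (U \<omega>)\<close> and again
      for the averages.\<close>
    define a where "a = (\<lambda>x. of_int \<lfloor>M * f x\<rfloor> / M)"
    define r where "r = (\<lambda>j. real_cond_exp \<Omega> ?G (indicator (U -` A j)))"
    have A: "A j \<in> sets borel" for j
    proof -
      have "(\<lambda>x. \<lfloor>M * f x\<rfloor>) \<in> borel \<rightarrow>\<^sub>M count_space UNIV" using f by measurable
      from measurable_sets[OF this, of "{j}"] show ?thesis by (simp add: A_def vimage_def)
    qed
    have a_f: "\<bar>a x - f x\<bar> \<le> inverse M" for x
    proof -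
      have "\<bar>of_int \<lfloor>M * f x\<rfloor> - M * f x\<bar> \<le> 1" by linarith
      then have "\<bar>of_int \<lfloor>M * f x\<rfloor> - M * f x\<bar> / M \<le> 1 / M" using M by (intro divide_right_mono) auto
      moreover have "a x - f x = (of_int \<lfloor>M * f x\<rfloor> - M * f x) / M" using M by (simp add: a_def field_simps)
      ultimately show ?thesis using M by (simp add: abs_divide inverse_eq_divide)
    qed
    have in_J: "\<lfloor>M * f x\<rfloor> \<in> J" for x
    proof -
      have "- B \<le> f x" "f x \<le> B" using bound[of x] by linarith+
      then have "M * (- B) \<le> M * f x" "M * f x \<le> M * B"
        using M by (simp_all only: mult_le_cancel_left_pos)
      then have "- M * B \<le> M * f x" "M * f x \<le> M * B" by simp_all
      then show ?thesis unfolding J_def atLeastAtMost_iff by (intro conjI floor_mono)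
    qed
    have a_sum: "a x = (\<Sum>j\<in>J. of_int j / M * indicator (A j) x)" for x
    proof -
      have "(\<Sum>j\<in>J. of_int j / M * indicator (A j) x) = (\<Sum>j\<in>J. if j = \<lfloor>M * f x\<rfloor> then of_int j / M else 0)"
        by (intro sum.cong) (auto simp: A_def indicator_def)
      also have "\<dots> = a x" using in_J[of x] by (simp add: J_def a_def sum.delta)
      finally show ?thesis by simp
    qed
    have ind_int: "integrable \<Omega> (indicator (U -` A j) :: _ \<Rightarrow> real)" for j
    proof (rule integrable_const_bound[where B = 1])
      show "(indicator (U -` A j) :: _ \<Rightarrow> real) \<in> borel_measurable \<Omega>"
        unfolding borel_measurable_indicator_iff by (rule measurable_sets[OF U A])
    qed (auto simp: indicator_def)
    note r_int = real_cond_exp_int(1)[OF ind_int] and r_eq = real_cond_exp_int(2)[OF ind_int]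
    have r_ae: "AE \<omega> in \<Omega>. \<forall>j\<in>J. r j \<omega> = measure_pmf.prob (pmf_of_set (V (X \<omega>))) (A j)"
      unfolding r_def using cu A by (intro AE_finite_allI) (auto simp: conditionally_uniform_def J_def)
    have r_avg: "AE \<omega> in \<Omega>. (\<Sum>j\<in>J. of_int j / M * r j \<omega>) = ?avg a \<omega>"
      using r_ae AE_space
    proof eventually_elim
      case (elim \<omega>)
      have V\<omega>: "finite (V (X \<omega>))" "V (X \<omega>) \<noteq> {}" using V elim(2) by auto
      have "r j \<omega> = (\<Sum>x\<in>V (X \<omega>). indicator (A j) x) / card (V (X \<omega>))" if "j \<in> J" for j
      proof -
        have "(\<Sum>x\<in>V (X \<omega>). indicator (A j) x :: real) = card (V (X \<omega>) \<inter> A j)"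
          unfolding indicator_def of_bool_def using V\<omega>(1) by (simp add: sum.If_cases)
        moreover have "r j \<omega> = card (V (X \<omega>) \<inter> A j) / card (V (X \<omega>))"
          using elim(1) that by (simp add: measure_pmf_of_set[OF V\<omega>(2,1)])
        ultimately show ?thesis by simp
      qed
      then have "(\<Sum>j\<in>J. of_int j / M * r j \<omega>) =
          (\<Sum>j\<in>J. \<Sum>x\<in>V (X \<omega>). of_int j / M * indicator (A j) x) / card (V (X \<omega>))"
        by (simp add: sum_divide_distrib sum_distrib_left)
      also have "\<dots> = ?avg a \<omega>" unfolding a_sum by (subst sum.swap) simp
      finally show ?case .
    qed
    have aU_eq: "(\<integral>\<omega>. a (U \<omega>) \<partial>\<Omega>) = (\<integral>\<omega>. (\<Sum>j\<in>J. of_int j / M * r j \<omega>) \<partial>\<Omega>)"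
    proof -
      have "(\<integral>\<omega>. a (U \<omega>) \<partial>\<Omega>) = (\<integral>\<omega>. (\<Sum>j\<in>J. of_int j / M * indicator (U -` A j) \<omega>) \<partial>\<Omega>)"
        unfolding a_sum by (simp add: indicator_def)
      also have "\<dots> = (\<Sum>j\<in>J. of_int j / M * (\<integral>\<omega>. indicator (U -` A j) \<omega> \<partial>\<Omega>))"
        using ind_int by simp
      also have "\<dots> = (\<Sum>j\<in>J. of_int j / M * (\<integral>\<omega>. r j \<omega> \<partial>\<Omega>))"
        unfolding r_def r_eq ..
      also have "\<dots> = (\<integral>\<omega>. (\<Sum>j\<in>J. of_int j / M * r j \<omega>) \<partial>\<Omega>)"
        using r_int unfolding r_def by simp
      finally show ?thesis .
    qed
    have a_meas: "a \<in> borel_measurable borel" unfolding a_def using f by measurable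
    have aU_int: "integrable \<Omega> (\<lambda>\<omega>. a (U \<omega>))"
    proof (rule integrable_const_bound[where B = "B + inverse M"])
      show "(\<lambda>\<omega>. a (U \<omega>)) \<in> borel_measurable \<Omega>" using measurable_compose[OF U a_meas] .
      have "\<bar>a x\<bar> \<le> B + inverse M" for x using a_f[of x] bound[of x] by linarith
      then show "AE \<omega> in \<Omega>. norm (a (U \<omega>)) \<le> B + inverse M" by simp
    qed
    have s_int: "integrable \<Omega> (\<lambda>\<omega>. \<Sum>j\<in>J. of_int j / M * r j \<omega>)"
      using r_int unfolding r_def by simp
    have "\<bar>(\<integral>\<omega>. f (U \<omega>) \<partial>\<Omega>) - (\<integral>\<omega>. a (U \<omega>) \<partial>\<Omega>)\<bar> \<le> inverse M"
    proof -
      have "\<bar>(\<integral>\<omega>. f (U \<omega>) \<partial>\<Omega>) - (\<integral>\<omega>. a (U \<omega>) \<partial>\<Omega>)\<bar> = \<bar>\<integral>\<omega>. f (U \<omega>) - a (U \<omega>) \<partial>\<Omega>\<bar>"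
        using fU aU_int by simp
      also have "\<dots> \<le> (\<integral>\<omega>. \<bar>f (U \<omega>) - a (U \<omega>)\<bar> \<partial>\<Omega>)" by (rule integral_abs_bound)
      also have "\<dots> \<le> (\<integral>\<omega>. inverse M \<partial>\<Omega>)"
        using fU aU_int a_f by (intro integral_mono) (auto simp: abs_minus_commute)
      finally show ?thesis using prob_space by simp
    qed
    moreover have "\<bar>(\<integral>\<omega>. (\<Sum>j\<in>J. of_int j / M * r j \<omega>) \<partial>\<Omega>) - (\<integral>\<omega>. ?avg f \<omega> \<partial>\<Omega>)\<bar> \<le> inverse M"
    proof -
      have "\<bar>(\<integral>\<omega>. (\<Sum>j\<in>J. of_int j / M * r j \<omega>) \<partial>\<Omega>) - (\<integral>\<omega>. ?avg f \<omega> \<partial>\<Omega>)\<bar> =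
          \<bar>\<integral>\<omega>. (\<Sum>j\<in>J. of_int j / M * r j \<omega>) - ?avg f \<omega> \<partial>\<Omega>\<bar>"
        using Bochner_Integration.integral_diff[OF s_int avg_int] by simp
      also have "\<dots> \<le> (\<integral>\<omega>. \<bar>(\<Sum>j\<in>J. of_int j / M * r j \<omega>) - ?avg f \<omega>\<bar> \<partial>\<Omega>)" by (rule integral_abs_bound)
      also have "\<dots> \<le> (\<integral>\<omega>. inverse M \<partial>\<Omega>)"
      proof (rule integral_mono_AE)
        show "integrable \<Omega> (\<lambda>\<omega>. \<bar>(\<Sum>j\<in>J. of_int j / M * r j \<omega>) - ?avg f \<omega>\<bar>)"
          by (intro integrable_abs Bochner_Integration.integrable_diff s_int avg_int)
        show "AE \<omega> in \<Omega>. \<bar>(\<Sum>j\<in>J. of_int j / M * r j \<omega>) - ?avg f \<omega>\<bar> \<le> inverse M"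
          using r_avg AE_space by eventually_elim (use avg_le[of _ a f, OF _ a_f] in simp)
      qed simp
      finally show ?thesis using prob_space by simp
    qed
    ultimately have "\<bar>(\<integral>\<omega>. f (U \<omega>) \<partial>\<Omega>) - (\<integral>\<omega>. ?avg f \<omega> \<partial>\<Omega>)\<bar> \<le> 2 * inverse M"
      unfolding aU_eq by linarith
    then show ?thesis by (simp only: M_def)
  qed
  note close = this
  have "(\<lambda>N. 2 * inverse (real (Suc N))) \<longlonglongrightarrow> 2 * 0"
    by (intro tendsto_mult tendsto_const LIMSEQ_inverse_real_of_nat)
  then have "\<bar>(\<integral>\<omega>. f (U \<omega>) \<partial>\<Omega>) - (\<integral>\<omega>. ?avg f \<omega> \<partial>\<Omega>)\<bar> \<le> 2 * 0"
    by (rule LIMSEQ_le_const) (use close in blast)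
  then show ?thesis by simp
qed

theorem theorem3p1:
  fixes \<nu> :: "(real ^ 3) measure"
    and \<Omega> :: "nat \<Rightarrow> 'w measure"
    and m :: "nat \<Rightarrow> 'w \<Rightarrow> complex set"
    and U :: "nat \<Rightarrow> 'w \<Rightarrow> complex"
  assumes "splitting_law \<nu>"
    and "\<And>n. n \<ge> 1 \<Longrightarrow> prob_space (\<Omega> n)"
    and "\<And>n. n \<ge> 1 \<Longrightarrow> m n \<in> \<Omega> n \<rightarrow>\<^sub>M triangulation_space n"
    and "\<And>n. n \<ge> 1 \<Longrightarrow> distr (\<Omega> n) (triangulation_space n) (m n) = triangulation_law \<nu> n"
    and "\<And>n. n \<ge> 1 \<Longrightarrow>
           conditionally_uniform (\<Omega> n) (triangulation_space n) (m n) internal_vertices (U n)"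
  shows "\<exists>(N :: complex measure) Uinf. prob_space N \<and>
           Uinf \<in> N \<rightarrow>\<^sub>M restrict_space borel filled_triangle \<and>
           converges_in_distribution euclidean \<Omega> U N Uinf \<and>
           converges_in_distribution (weak_topology filled_triangle)
             \<Omega> (\<lambda>n \<omega>. occupation_measure n (m n \<omega>))
             N (\<lambda>\<omega>. return (restrict_space borel filled_triangle) (Uinf \<omega>))"
proof -
  interpret splitting \<nu> by unfold_locales (rule assms(1))
  obtain N where N: "prob_space N" "sets N = sets triangle_borel"
    and lim: "\<And>g :: complex \<Rightarrow> real. continuous_on filled_triangle g \<Longrightarrow>
      (\<lambda>k. mean k (\<lambda>u P. g (corners P u 1))) \<longlonglongrightarrow> (\<integral>x. g x \<partial>N)"
    using limit_point_exists by blast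
  have space_N: "space N = filled_triangle"
    using sets_eq_imp_space_eq[OF N(2)] by (simp add: space_triangle_borel)
  have m_space: "m n \<omega> \<in> compact_triangulations n" if "n \<ge> 1" "\<omega> \<in> space (\<Omega> n)" for n \<omega>
    using measurable_space[OF assms(3)[OF that(1)] that(2)] by (simp add: space_triangulation_space)
  \<comment> \<open>The second assertion in integrated form. The triangulation enters through its
    law only, so the left side is an average over codes and \<open>condensation\<close>
    applies.\<close>
  have main: "(\<lambda>n. \<integral>\<omega>. F (occupation_measure n (m n \<omega>)) \<partial>\<Omega> n) \<longlonglongrightarrow> (\<integral>x. F (return triangle_borel x) \<partial>N)"
    if F: "continuous_map (weak_topology filled_triangle) euclideanreal F"
      and bdd: "bounded (F ` topspace (weak_topology filled_triangle))" for F
  proof -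
    obtain B where B: "\<And>\<mu>. \<mu> \<in> space (prob_algebra triangle_borel) \<Longrightarrow> \<bar>F \<mu>\<bar> \<le> B"
      using bdd unfolding topspace_weak_topology by (auto simp: bounded_iff)
    have "continuous_on filled_triangle (\<lambda>x. F (return triangle_borel x))"
      using continuous_map_compose[OF continuous_map_return F] by (simp add: comp_def)
    note avg = condensation[OF F B lim[OF this]]
    have "(\<integral>\<omega>. F (occupation_measure n (m n \<omega>)) \<partial>\<Omega> n) =
      (\<Sum>t\<in>ternary_trees n. \<integral>P. F (occupation_measure n (triangulation t P)) \<partial>Q) / tree_count n" if n: "n \<ge> 1" for n
    proof -
      have G: "(\<lambda>x. F (occupation_measure n x)) \<in> borel_measurable (triangulation_space n)"
        using measurable_compose[OF measurable_occupation_measure[OF n] continuous_map_measurable_borel_of[OF F]]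
        by (simp add: borel_of_euclidean)
      have "(\<integral>\<omega>. F (occupation_measure n (m n \<omega>)) \<partial>\<Omega> n) = (\<integral>x. F (occupation_measure n x) \<partial>triangulation_law \<nu> n)"
        unfolding assms(4)[OF n, symmetric] by (rule integral_distr[OF assms(3)[OF n] G, symmetric])
      also have "\<dots> = (\<Sum>t\<in>ternary_trees n. \<integral>P. F (occupation_measure n (triangulation t P)) \<partial>Q) / tree_count n"
        using B occupation_measure_prob[OF n] by (intro integral_triangulation_law[OF G]) blast
      finally show ?thesis .
    qed
    then have "\<forall>\<^sub>F n in sequentially.
      (\<Sum>t\<in>ternary_trees n. \<integral>P. F (occupation_measure n (triangulation t P)) \<partial>Q) / tree_count n =
      (\<integral>\<omega>. F (occupation_measure n (m n \<omega>)) \<partial>\<Omega> n)"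
      by (intro eventually_sequentiallyI[of 1]) simp
    with avg show ?thesis by (rule Lim_transform_eventually)
  qed
  \<comment> \<open>The limit point is realized as the identity on the filled triangle equipped with
    the law \<open>N\<close>.\<close>
  have id: "(\<lambda>x. x) \<in> N \<rightarrow>\<^sub>M triangle_borel"
    using N(2) by (rule measurable_ident_sets)
  have "converges_in_distribution (weak_topology filled_triangle)
      \<Omega> (\<lambda>n \<omega>. occupation_measure n (m n \<omega>)) N (\<lambda>x. return triangle_borel x)"
    unfolding converges_in_distribution_def
  proof (intro conjI allI impI)
    show "(\<lambda>\<omega>. occupation_measure n (m n \<omega>)) \<in> \<Omega> n \<rightarrow>\<^sub>M borel_of (weak_topology filled_triangle)" if "1 \<le> n" for n
      by (rule measurable_compose[OF assms(3)[OF that] measurable_occupation_measure[OF that]])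
    show "(\<lambda>x. return triangle_borel x) \<in> N \<rightarrow>\<^sub>M borel_of (weak_topology filled_triangle)"
      by (rule measurable_compose[OF id continuous_map_measurable_restrict_space[OF continuous_map_return]])
  qed (use main in blast)
  moreover have "converges_in_distribution euclidean \<Omega> U N (\<lambda>x. x)"
    unfolding converges_in_distribution_def
  proof (intro conjI allI impI)
    show "U n \<in> \<Omega> n \<rightarrow>\<^sub>M borel_of euclidean" if "1 \<le> n" for n
      using assms(5)[OF that] by (simp add: borel_of_euclidean conditionally_uniform_def)
    show "(\<lambda>x. x) \<in> N \<rightarrow>\<^sub>M borel_of euclidean"
      unfolding borel_of_euclidean by (rule measurable_compose[OF id]) (simp add: measurable_restrict_space1)
  next
    fix f :: "complex \<Rightarrow> real"
    assume f: "continuous_map euclidean euclideanreal f \<and> bounded (f ` topspace euclidean)"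
    then have cont: "continuous_on UNIV f" by simp
    then have cont_tri: "continuous_on filled_triangle f" by (rule continuous_on_subset) simp
    have fm: "f \<in> borel_measurable borel" using cont by (rule borel_measurable_continuous_onI)
    obtain B where B: "\<And>x. \<bar>f x\<bar> \<le> B" using f by (auto simp: bounded_iff)
    have bdd_tri: "bounded (f ` filled_triangle)" using f by (auto intro: bounded_subset)
    \<comment> \<open>Convergence of \<open>U n\<close> is \<open>main\<close> for the functional
      \<open>\<mu> \<mapsto> \<integral> f d\<mu>\<close>: conditionally on the triangulation, the
      expectation of \<open>f (U n)\<close> is its value at the occupation measure, and at a Dirac
      measure it returns the value of \<open>f\<close>.\<close>
    let ?F = "\<lambda>\<mu>. \<integral>x. f x \<partial>\<mu>"
    have F: "continuous_map (weak_topology filled_triangle) euclideanreal ?F"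
      by (rule continuous_map_integral_weak_topology[OF cont_tri bdd_tri])
    have "\<bar>?F \<mu>\<bar> \<le> B" if \<mu>: "\<mu> \<in> space (prob_algebra triangle_borel)" for \<mu>
    proof -
      interpret prob_space \<mu> using \<mu> by (simp add: space_prob_algebra)
      have "f \<in> borel_measurable \<mu>"
        using \<mu> borel_measurable_continuous_on_restrict[OF cont_tri]
        by (simp add: space_prob_algebra cong: measurable_cong_sets)
      then have int: "integrable \<mu> f" using B by (intro integrable_const_bound[where B = B]) auto
      have "\<bar>?F \<mu>\<bar> \<le> (\<integral>x. \<bar>f x\<bar> \<partial>\<mu>)" by (rule integral_abs_bound)
      also have "\<dots> \<le> (\<integral>x. B \<partial>\<mu>)" using int B by (intro integral_mono) auto
      finally show ?thesis using prob_space by simp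
    qed
    then have bdd: "bounded (?F ` topspace (weak_topology filled_triangle))"
      unfolding topspace_weak_topology by (auto simp: bounded_iff)
    have "(\<integral>\<omega>. f (U n \<omega>) \<partial>\<Omega> n) = (\<integral>\<omega>. ?F (occupation_measure n (m n \<omega>)) \<partial>\<Omega> n)" if n: "n \<ge> 1" for n
    proof -
      note avg = internal_vertices_average[OF m_space[OF n] n]
      have occ: "(\<lambda>\<omega>. ?F (occupation_measure n (m n \<omega>))) \<in> borel_measurable (\<Omega> n)"
        using measurable_compose[OF measurable_compose[OF assms(3)[OF n] measurable_occupation_measure[OF n]]
            continuous_map_measurable_borel_of[OF F]]
        by (simp add: borel_of_euclidean)
      have eq: "(\<Sum>x\<in>internal_vertices (m n \<omega>). f x) / card (internal_vertices (m n \<omega>)) =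
          ?F (occupation_measure n (m n \<omega>))" if "\<omega> \<in> space (\<Omega> n)" for \<omega>
        using avg(3)[OF that cont_tri] .
      have "(\<integral>\<omega>. f (U n \<omega>) \<partial>\<Omega> n) =
        (\<integral>\<omega>. (\<Sum>x\<in>internal_vertices (m n \<omega>). f x) / card (internal_vertices (m n \<omega>)) \<partial>\<Omega> n)"
      proof (rule conditionally_uniform_expectation[OF assms(2)[OF n] assms(3)[OF n] assms(5)[OF n] _ fm B])
        show "finite (internal_vertices (m n \<omega>)) \<and> internal_vertices (m n \<omega>) \<noteq> {}" if "\<omega> \<in> space (\<Omega> n)" for \<omega>
          using avg(1,2)[OF that] by blast
        show "(\<lambda>\<omega>. (\<Sum>x\<in>internal_vertices (m n \<omega>). f x) / card (internal_vertices (m n \<omega>))) \<in> borel_measurable (\<Omega> n)"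
          using occ eq by (simp cong: measurable_cong)
      qed
      also have "\<dots> = (\<integral>\<omega>. ?F (occupation_measure n (m n \<omega>)) \<partial>\<Omega> n)"
        by (rule Bochner_Integration.integral_cong[OF refl eq])
      finally show ?thesis .
    qed
    then have "\<forall>\<^sub>F n in sequentially.
      (\<integral>\<omega>. ?F (occupation_measure n (m n \<omega>)) \<partial>\<Omega> n) = (\<integral>\<omega>. f (U n \<omega>) \<partial>\<Omega> n)"
      by (intro eventually_sequentiallyI[of 1]) simp
    with main[OF F bdd]
    have "(\<lambda>n. \<integral>\<omega>. f (U n \<omega>) \<partial>\<Omega> n) \<longlonglongrightarrow> (\<integral>x. ?F (return triangle_borel x) \<partial>N)"
      by (rule Lim_transform_eventually)
    also have "(\<integral>x. ?F (return triangle_borel x) \<partial>N) = (\<integral>x. f x \<partial>N)"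
      by (intro Bochner_Integration.integral_cong refl) (simp add: space_N integral_return_triangle cont_tri)
    finally show "(\<lambda>n. \<integral>\<omega>. f (U n \<omega>) \<partial>\<Omega> n) \<longlonglongrightarrow> (\<integral>x. f x \<partial>N)" .
  qed
  ultimately show ?thesis using N(1) id by (intro exI[of _ N] exI[of _ "\<lambda>x. x"]) simp
qed

end
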